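(* Let $n\ge2$ and let $\mathbf a=(a_0,\dots,a_n)$ be a tuple of positive integers. The Cox ring $\mathcal R(\mathbb P\mathcal E_{\mathbf a}^\vee)$ is isomorphic to the quotient of the polynomial ring $\mathbb C[x_i,Z_{jk}\mid 0\le i\le n,\ 0\le j<k\le n]$ by the ideal $\mathcal I_{\mathbf a}^\vee$ generated by the polynomials $x_j^{a_j}Z_{ik}-x_k^{a_k}Z_{ij}-x_i^{a_i}Z_{jk}$ for $0\le i<j<k\le n$ and the quadratic Plücker relations $Z_{ij}Z_{kl}-Z_{ik}Z_{jl}+Z_{il}Z_{jk}$ for $0\le i<j<k<l\le n$.
   Context: Work over $\mathbb C$. Let $x_0,\dots,x_n$ be homogeneous coordinates on $\mathbb P^n$ and $H_j=\{x_j=0\}$. The bundle $\mathcal E_{\mathbf a}$ is the rank $n$ toric vector bundle on $\mathbb P^n$ which is the cokernel of the torus-equivariant map $\mathcal O\to\bigoplus_{j=0}^n\mathcal O(a_jH_j)\cong\bigoplus_{j=0}^n\mathcal O(a_j)$, $1\mapsto(x_0^{a_0},\dots,x_n^{a_n})$; $\mathcal E_{\mathbf a}^\vee$ is its dual. The projectivization is $\mathbb P\mathcal E=\mathrm{Proj}(\mathrm{Sym}\,\mathcal E)$. The Cox ring of a complete normal variety $X$ with free divisor class group is $\mathcal R(X)=\bigoplus_{[D]\in\mathrm{CL}(X)}H^0(X,\mathcal O(D))$; in particular $\mathcal R(\mathbb P\mathcal E_{\mathbf a}^\vee)\cong\bigoplus_{d\in\mathbb Z,\,k\ge0}H^0(\mathbb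 P^n,\mathcal O(d)\otimes\mathrm{Sym}^k\mathcal E_{\mathbf a}^\vee)$. *)

theory Defs
  imports
    Complex_Main
    "HOL-Library.Poly_Mapping"
    "HOL-Computational_Algebra.Fraction_Field"
    "HOL-Algebra.QuotRing"
begin

text \<open>
  The multivariate polynomial ring over R in variables indexed by \<open>'v\<close> is the monoid algebra
  \<open>('v \<Rightarrow>\<^sub>0 nat) \<Rightarrow>\<^sub>0 R\<close> of the monomials.
\<close>

type_synonym ('v, 'a) mpoly = "('v \<Rightarrow>\<^sub>0 nat) \<Rightarrow>\<^sub>0 'a"

definition mvar :: "'v \<Rightarrow> ('v, 'a::{zero_neq_one}) mpoly" where
  "mvar v = Poly_Mapping.single (Poly_Mapping.single v 1) 1"

definition mconst :: "'a::zero \<Rightarrow> ('v, 'a) mpoly" where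
  "mconst c = Poly_Mapping.single 0 c"

definition mpoly_carrier :: "'v set \<Rightarrow> ('v, 'a::zero) mpoly set" where
  "mpoly_carrier V = {p. \<forall>m \<in> Poly_Mapping.keys p. Poly_Mapping.keys m \<subseteq> V}"

definition homogeneous_mpoly :: "'v set \<Rightarrow> nat \<Rightarrow> ('v, 'a::zero) mpoly \<Rightarrow> bool" where
  "homogeneous_mpoly V e p \<longleftrightarrow> p \<in> mpoly_carrier V \<and>
     (\<forall>m \<in> Poly_Mapping.keys p. (\<Sum>v \<in> Poly_Mapping.keys m. Poly_Mapping.lookup m v) = e)"

definition ring_on :: "'a::comm_ring_1 set \<Rightarrow> 'a ring" where
  "ring_on A = \<lparr>carrier = A, mult = (*), one = 1, zero = 0, add = (+)\<rparr>"


section \<open>Integral schemes given by their local rings\<close>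

text \<open>
  A separated integral scheme is encoded, as in Chevalley's and Zariski's treatment, by the set
  \<open>X\<close> of its local rings, which are subrings of its function field; the function field is
  itself a subfield of an ambient field \<open>'k\<close>. The inclusion \<open>V \<subseteq> W\<close> of local rings says that
  the point with local ring W specialises to the point with local ring V, and the local ring of
  the generic point is the function field, so the latter is the union of all local rings.
\<close>

definition function_field :: "'k::field set set \<Rightarrow> 'k set" where
  "function_field X = \<Union>X"

text \<open>
  Prime divisors are represented by the local rings of their generic points, that is, of the
  points of codimension one.
\<close>

definition prime_divisors :: "'k::field set set \<Rightarrow> 'k set set" where
  "prime_divisors X = {V \<in> X. V \<noteq> function_field X \<and>
     (\<forall>W \<in> X. V \<subseteq> W \<longrightarrow> W = V \<or> W = function_field X)}"

definition normalised_valuation :: "'k::field set \<Rightarrow> 'k set \<Rightarrow> ('k \<Rightarrow> int) \<Rightarrow> bool" where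
  "normalised_valuation K V v \<longleftrightarrow>
     (\<forall>f \<in> K - {0}. \<forall>g \<in> K - {0}. v (f * g) = v f + v g) \<and>
     (\<forall>f \<in> K - {0}. \<forall>g \<in> K - {0}. f + g \<noteq> 0 \<longrightarrow> min (v f) (v g) \<le> v (f + g)) \<and>
     (\<exists>f \<in> K - {0}. v f = 1) \<and>
     V = {f \<in> K. f = 0 \<or> 0 \<le> v f}"

text \<open>
  On a normal variety the local ring at a point of codimension one is a discrete valuation
  ring, and its normalised valuation is unique on the nonzero elements of the function field.
\<close>

definition ord_along :: "'k::field set set \<Rightarrow> 'k set \<Rightarrow> 'k \<Rightarrow> int" where
  "ord_along X V f = (THE m. \<exists>v. normalised_valuation (function_field X) V v \<and> v f = m)"

definition divisor_group :: "'k::field set set \<Rightarrow> ('k set \<Rightarrow>\<^sub>0 int) monoid" where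
  "divisor_group X = \<lparr>carrier = {D. Poly_Mapping.keys D \<subseteq> prime_divisors X},
                      mult = (+), one = 0\<rparr>"

definition principal_divisors :: "'k::field set set \<Rightarrow> ('k set \<Rightarrow>\<^sub>0 int) set" where
  "principal_divisors X = {D \<in> carrier (divisor_group X).
     \<exists>f \<in> function_field X - {0}.
       \<forall>V \<in> prime_divisors X. Poly_Mapping.lookup D V = ord_along X V f}"

definition class_group :: "'k::field set set \<Rightarrow> ('k set \<Rightarrow>\<^sub>0 int) set monoid" where
  "class_group X = divisor_group X Mod principal_divisors X"

text \<open>\<open>H0 X D\<close> is \<open>H\<^sup>0(X, O(D))\<close>.\<close>

definition H0 :: "'k::field set set \<Rightarrow> ('k set \<Rightarrow>\<^sub>0 int) \<Rightarrow> 'k set" where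
  "H0 X D = {f \<in> function_field X.
     f \<noteq> 0 \<longrightarrow> (\<forall>V \<in> prime_divisors X. 0 \<le> ord_along X V f + Poly_Mapping.lookup D V)}"

text \<open>
  To multiply sections belonging to different classes one represents the classes by divisors
  in a compatible way, i.e. by a group L of divisors that maps isomorphically onto the class
  group. Such an L exists if and only if the class group is free, and up to isomorphism the
  Cox ring does not depend on it.
\<close>

definition class_group_lift :: "'k::field set set \<Rightarrow> ('k set \<Rightarrow>\<^sub>0 int) set \<Rightarrow> bool" where
  "class_group_lift X L \<longleftrightarrow> subgroup L (divisor_group X) \<and>
     bij_betw (\<lambda>D. principal_divisors X #>\<^bsub>divisor_group X\<^esub> D) L (carrier (class_group X))"

text \<open>
  An element of the direct sum of the \<open>H0 X D\<close> over D in L is a finitely supported function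
  s on divisors. The product of the monoid algebra \<open>('k set \<Rightarrow>\<^sub>0 int) \<Rightarrow>\<^sub>0 'k\<close> is the convolution
  that multiplies sections of O(D) and O(E), as rational functions, to a section of O(D + E).
\<close>

definition cox_ring ::
  "'k::field set set \<Rightarrow> ('k set \<Rightarrow>\<^sub>0 int) set \<Rightarrow> (('k set \<Rightarrow>\<^sub>0 int) \<Rightarrow>\<^sub>0 'k) ring" where
  "cox_ring X L = ring_on {s. Poly_Mapping.keys s \<subseteq> L \<and>
     (\<forall>D \<in> L. Poly_Mapping.lookup s D \<in> H0 X D)}"


section \<open>Proj of a graded domain\<close>

text \<open>
  A graded domain is given by its homogeneous parts T k inside a field; distinct parts are
  understood to meet in 0 only. A homogeneous ideal is likewise given by its homogeneous
  parts, and primeness need only be tested on homogeneous elements. The last conjunct says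
  that the ideal does not contain the irrelevant ideal.
\<close>

definition proj_point :: "(nat \<Rightarrow> 'k::field set) \<Rightarrow> (nat \<Rightarrow> 'k set) \<Rightarrow> bool" where
  "proj_point T P \<longleftrightarrow>
     (\<forall>k. P k \<subseteq> T k \<and> 0 \<in> P k \<and> (\<forall>f \<in> P k. \<forall>g \<in> P k. f + g \<in> P k)) \<and>
     (\<forall>j k. \<forall>f \<in> T j. \<forall>g \<in> P k. f * g \<in> P (j + k)) \<and>
     (\<forall>j k. \<forall>f \<in> T j. \<forall>g \<in> T k. f * g \<in> P (j + k) \<longrightarrow> f \<in> P j \<or> g \<in> P k) \<and>
     (\<exists>k>0. P k \<noteq> T k)"

definition homogeneous_localisation ::
  "(nat \<Rightarrow> 'k::field set) \<Rightarrow> (nat \<Rightarrow> 'k set) \<Rightarrow> 'k set" where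
  "homogeneous_localisation T P = {f / g | f g. \<exists>k. f \<in> T k \<and> g \<in> T k - P k}"

definition proj :: "(nat \<Rightarrow> 'k::field set) \<Rightarrow> 'k set set" where
  "proj T = {homogeneous_localisation T P | P. proj_point T P}"

text \<open>
  For a ring A and an A-module M inside a field, \<open>power_module A M k\<close> is the A-module spanned
  by the k-fold products of elements of M.
\<close>

fun power_module :: "'k::field set \<Rightarrow> 'k set \<Rightarrow> nat \<Rightarrow> 'k set" where
  "power_module A M 0 = A"
| "power_module A M (Suc k) = {(\<Sum>l<N. s l * m l) | (N::nat) s m.
     \<forall>l<N. s l \<in> power_module A M k \<and> m l \<in> M}"


section \<open>The projectivised dual bundle\<close>

text \<open>
  Ambient field: fractions of complex polynomials. The variables 0, ..., n are the homogeneous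
  coordinates of projective n-space; the variables n + 1, ..., 2 n + 1 are generators
  \<open>y\<^sub>0, \<dots>, y\<^sub>n\<close> of the direct sum of the \<open>O(-a\<^sub>j)\<close>, so that the symmetric algebra of the
  latter is a ring of polynomials in the \<open>y\<^sub>j\<close>.
\<close>

type_synonym ambient = "(nat, complex) mpoly fract"

definition coord :: "nat \<Rightarrow> ambient" where
  "coord i = Fract (mvar i) 1"

definition fibre_coord :: "nat \<Rightarrow> nat \<Rightarrow> ambient" where
  "fibre_coord n j = Fract (mvar (n + 1 + j)) 1"

definition ambient_const :: "complex \<Rightarrow> ambient" where
  "ambient_const c = Fract (mconst c) 1"

text \<open>Sections of O(d) over the chart on which the i-th coordinate does not vanish.\<close>

definition twist_sections :: "nat \<Rightarrow> nat \<Rightarrow> int \<Rightarrow> ambient set" where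
  "twist_sections n i d = {Fract p 1 / coord i ^ m | p m.
     \<exists>e. homogeneous_mpoly {..n} e p \<and> int e = int m + d}"

text \<open>
  The bundle E is the cokernel of \<open>1 \<mapsto> (x\<^sub>0^a\<^sub>0, \<dots>, x\<^sub>n^a\<^sub>n)\<close>. Hence a section of
  its dual Hom(E, O) is a homomorphism from the direct sum of the \<open>O(a\<^sub>j)\<close> to O that kills this
  element, i.e. a family of sections \<open>f\<^sub>j\<close> of \<open>O(-a\<^sub>j)\<close> with
  \<open>f\<^sub>0 x\<^sub>0^a\<^sub>0 + \<dots> + f\<^sub>n x\<^sub>n^a\<^sub>n = 0\<close>; it is written
  \<open>f\<^sub>0 y\<^sub>0 + \<dots> + f\<^sub>n y\<^sub>n\<close>.
\<close>

definition dual_sections :: "nat \<Rightarrow> (nat \<Rightarrow> nat) \<Rightarrow> nat \<Rightarrow> ambient set" where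
  "dual_sections n a i = {(\<Sum>j\<le>n. f j * fibre_coord n j) | f.
     (\<forall>j\<le>n. f j \<in> twist_sections n i (- int (a j))) \<and>
     (\<Sum>j\<le>n. f j * coord j ^ a j) = 0}"

text \<open>
  On each chart the dual bundle is a direct summand of the direct sum of the \<open>O(-a\<^sub>j)\<close>, so its
  symmetric algebra embeds into the polynomials in the \<open>y\<^sub>j\<close>, and its k-th symmetric power is
  the module spanned by the k-fold products of sections.
\<close>

definition sym_dual :: "nat \<Rightarrow> (nat \<Rightarrow> nat) \<Rightarrow> nat \<Rightarrow> nat \<Rightarrow> ambient set" where
  "sym_dual n a i = power_module (twist_sections n i 0) (dual_sections n a i)"

text \<open>The relative Proj of the symmetric algebra, glued from its parts over the charts.\<close>

definition proj_dual_bundle :: "nat \<Rightarrow> (nat \<Rightarrow> nat) \<Rightarrow> ambient set set" where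
  "proj_dual_bundle n a = (\<Union>i\<le>n. proj (sym_dual n a i))"


section \<open>The presented ring\<close>

datatype cox_var = Xvar nat | Zvar nat nat

abbreviation XX :: "nat \<Rightarrow> (cox_var, complex) mpoly" where
  "XX i \<equiv> mvar (Xvar i)"

abbreviation ZZ :: "nat \<Rightarrow> nat \<Rightarrow> (cox_var, complex) mpoly" where
  "ZZ j k \<equiv> mvar (Zvar j k)"

definition cox_vars :: "nat \<Rightarrow> cox_var set" where
  "cox_vars n = {Xvar i | i. i \<le> n} \<union> {Zvar j k | j k. j < k \<and> k \<le> n}"

definition cox_poly_ring :: "nat \<Rightarrow> (cox_var, complex) mpoly ring" where
  "cox_poly_ring n = ring_on (mpoly_carrier (cox_vars n))"

definition cox_relations :: "nat \<Rightarrow> (nat \<Rightarrow> nat) \<Rightarrow> (cox_var, complex) mpoly set" where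
  "cox_relations n a =
     {XX j ^ a j * ZZ i k - XX k ^ a k * ZZ i j - XX i ^ a i * ZZ j k | i j k.
        i < j \<and> j < k \<and> k \<le> n} \<union>
     {ZZ i j * ZZ k l - ZZ i k * ZZ j l + ZZ i l * ZZ j k | i j k l.
        i < j \<and> j < k \<and> k < l \<and> l \<le> n}"

definition cox_ideal :: "nat \<Rightarrow> (nat \<Rightarrow> nat) \<Rightarrow> (cox_var, complex) mpoly set" where
  "cox_ideal n a = genideal (cox_poly_ring n) (cox_relations n a)"

end

theory Submission
  imports Defs "HOL-Computational_Algebra.Polynomial" "HOL-Library.Product_Plus"
begin

text \<open>
  The additive group acts on \<open>\<complex>[x, y]\<close> by \<open>y\<^sub>j \<mapsto> y\<^sub>j + s x\<^sub>j^a\<^sub>j\<close>, and the sections of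
  \<open>O(d) \<otimes> Sym\<^sup>k E\<^sup>\<or>\<close> are its invariants of bidegree (d, k), where \<open>y\<^sub>j\<close> has bidegree \<open>(a\<^sub>j, 1)\<close>.
  A factor of an invariant is invariant and \<open>\<complex>[x, y]\<close> is factorial. Hence the prime divisors of the
  projectivised bundle correspond to the homogeneous primes among the invariants, the class of a
  divisor is the bidegree of a homogeneous fraction defining it, and the Cox ring is the ring of
  invariants.

  The invariants are presented by sending \<open>Z\<^sub>j\<^sub>k\<close> to the minor \<open>x\<^sub>j^a\<^sub>j y\<^sub>k - x\<^sub>k^a\<^sub>k y\<^sub>j\<close>. Modulo the
  relations every polynomial is a combination of monomials without crossing chords. Restricting to
  the hyperplanes \<open>x\<^sub>0 = 0\<close>, \<open>x\<^sub>1 = 0\<close>, ... in turn shows that the images of these monomials are linearly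
  independent, and that an element of \<open>\<complex>[x, y]\<close> lies in the presented subring as soon as its product
  with \<open>x\<^sub>0\<close> does. Since every invariant becomes a polynomial in the \<open>x\<^sub>i\<close> and the minors \<open>Z\<^sub>0\<^sub>k\<close> after
  inverting \<open>x\<^sub>0\<close>, the presented subring is the whole ring of invariants.
\<close>

text \<open>The condition that defines dual sections is itself an invariance: adding
  \<open>s * x j ^ a j\<close> to every \<open>y j\<close> changes the sum of the
  \<open>q j * y j\<close> by \<open>s\<close> times the sum of the \<open>q j * x j ^ a j\<close>.
  All polynomials live in one type with infinitely many variables, so a spare variable can serve as
  the parameter \<open>s\<close>, and a ring in fewer variables is a subring closed under factors.
  Factoriality enters as one statement, that every nonzero nonunit has a prime factor; the total
  degree bounds every descent that strips off primes. The obstacle in comparing primes with divisors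
  is that a prime could be lost on the charts or in the irrelevant ideal. Here n \<ge> 2 helps: a
  prime divides at most one of three coordinates and at most one of the three minors on their
  indices. Hence even two primes can be avoided at once, by a coordinate and by a minor. Neither
  coordinates nor minors are rational functions on the bundle. Orders of vanishing are therefore
  defined for all fractions, and a multiplicative choice of a homogeneous fraction for each divisor
  translates between sections of O(D) and invariant polynomials.\<close>

abbreviation keys :: "('a \<Rightarrow>\<^sub>0 'b::zero) \<Rightarrow> 'a set" where "keys \<equiv> Poly_Mapping.keys"

abbreviation lookup :: "('a \<Rightarrow>\<^sub>0 'b::zero) \<Rightarrow> 'a \<Rightarrow> 'b" where "lookup \<equiv> Poly_Mapping.lookup"

abbreviation single :: "'a \<Rightarrow> 'b \<Rightarrow> 'a \<Rightarrow>\<^sub>0 'b::zero" where "single \<equiv> Poly_Mapping.single"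

section \<open>Evaluation homomorphisms\<close>

definition is_hom :: "('a::comm_ring_1 \<Rightarrow> 'b::comm_ring_1) \<Rightarrow> bool" where
  "is_hom h \<longleftrightarrow> h 0 = 0 \<and> h 1 = 1 \<and> (\<forall>a b. h (a + b) = h a + h b) \<and> (\<forall>a b. h (a * b) = h a * h b)"

lemma
  assumes "is_hom h"
  shows is_hom_0: "h 0 = 0" and is_hom_1: "h 1 = 1" and is_hom_add: "h (a + b) = h a + h b"
    and is_hom_mult: "h (a * b) = h a * h b"
  using assms by (auto simp: is_hom_def)

lemma is_hom_uminus:
  assumes "is_hom h"
  shows "h (- a) = - h a"
proof -
  have "h (- a) + h a = 0"
    using is_hom_add[OF assms, of "- a" a] is_hom_0[OF assms] by simp
  thus ?thesis
    by (simp add: eq_neg_iff_add_eq_0)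
qed

lemma is_hom_diff:
  assumes "is_hom h"
  shows "h (a - b) = h a - h b"
  using is_hom_add[OF assms, of a "- b"] is_hom_uminus[OF assms, of b] by simp

lemma is_hom_power:
  assumes "is_hom h"
  shows "h (a ^ k) = h a ^ k"
  by (induction k) (simp_all add: is_hom_1[OF assms] is_hom_mult[OF assms])

lemma is_hom_sum:
  assumes "is_hom h"
  shows "h (\<Sum>i\<in>I. f i) = (\<Sum>i\<in>I. h (f i))"
  by (induction I rule: infinite_finite_induct) (simp_all add: is_hom_0[OF assms] is_hom_add[OF assms])

lemma is_hom_prod:
  assumes "is_hom h"
  shows "h (\<Prod>i\<in>I. f i) = (\<Prod>i\<in>I. h (f i))"
  by (induction I rule: infinite_finite_induct) (simp_all add: is_hom_1[OF assms] is_hom_mult[OF assms])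

lemmas is_hom_simps = is_hom_0 is_hom_1 is_hom_add is_hom_mult is_hom_uminus is_hom_diff is_hom_power

lemma is_hom_id: "is_hom (\<lambda>x. x)"
  by (simp add: is_hom_def)

lemma is_hom_comp: "is_hom g \<Longrightarrow> is_hom h \<Longrightarrow> is_hom (\<lambda>x. g (h x))"
  by (auto simp: is_hom_def)

text \<open>Stated for an arbitrary exponent monoid because two monoid algebras occur: polynomials,
  evaluated through \<open>mon_eval\<close>, and the ring graded by divisors, evaluated through
  \<open>gen_frac\<close> in \<open>total\<close>.\<close>

definition pm_eval :: "('b::comm_ring_1 \<Rightarrow> 'c::comm_ring_1) \<Rightarrow> ('a \<Rightarrow> 'c) \<Rightarrow> ('a \<Rightarrow>\<^sub>0 'b) \<Rightarrow> 'c" where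
  "pm_eval h \<chi> p = (\<Sum>m\<in>keys p. h (lookup p m) * \<chi> m)"

lemma pm_eval_superset:
  assumes "is_hom h" "finite A" "keys p \<subseteq> A"
  shows "pm_eval h \<chi> p = (\<Sum>m\<in>A. h (lookup p m) * \<chi> m)"
  unfolding pm_eval_def
  by (rule sum.mono_neutral_left)
    (use assms in \<open>auto simp: in_keys_iff is_hom_0\<close>)

lemma pm_eval_0: "pm_eval h \<chi> 0 = 0"
  by (simp add: pm_eval_def)

lemma pm_eval_add:
  assumes "is_hom h"
  shows "pm_eval h \<chi> (p + q) = pm_eval h \<chi> p + pm_eval h \<chi> q"
proof -
  let ?A = "keys p \<union> keys q"
  have *: "keys p \<subseteq> ?A" "keys q \<subseteq> ?A" "keys (p + q) \<subseteq> ?A"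
    using keys_add[of p q] by auto
  show ?thesis
    unfolding pm_eval_superset[OF assms _ *(1), simplified] pm_eval_superset[OF assms _ *(2), simplified]
      pm_eval_superset[OF assms _ *(3), simplified]
    by (simp add: lookup_add is_hom_add[OF assms] algebra_simps sum.distrib)
qed

lemma pm_eval_sum:
  assumes "is_hom h"
  shows "pm_eval h \<chi> (\<Sum>i\<in>I. f i) = (\<Sum>i\<in>I. pm_eval h \<chi> (f i))"
  by (induction I rule: infinite_finite_induct) (simp_all add: pm_eval_0 pm_eval_add[OF assms])

lemma pm_eval_single:
  assumes "is_hom h"
  shows "pm_eval h \<chi> (single m c) = h c * \<chi> m"
  by (simp add: pm_eval_def is_hom_0[OF assms])

lemma poly_mapping_sum_single:
  "(\<Sum>m\<in>keys p. single m (lookup p m)) = p"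
proof (rule poly_mapping_eqI)
  fix k
  show "lookup (\<Sum>m\<in>keys p. single m (lookup p m)) k
    = lookup p k"
    by (simp add: lookup_sum lookup_single when_def in_keys_iff)
qed

lemma poly_mapping_mult_eq:
  fixes p q :: "'a::comm_monoid_add \<Rightarrow>\<^sub>0 'b::comm_ring_1"
  shows "p * q = (\<Sum>m\<in>keys p. \<Sum>m'\<in>keys q.
      single (m + m') (lookup p m * lookup q m'))"
proof -
  have "p * q = (\<Sum>m\<in>keys p. single m (lookup p m)) *
      (\<Sum>m'\<in>keys q. single m' (lookup q m'))"
    by (simp only: poly_mapping_sum_single)
  thus ?thesis
    by (simp add: sum_product mult_single)
qed

lemma pm_eval_mult:
  fixes p q :: "'a::comm_monoid_add \<Rightarrow>\<^sub>0 'b::comm_ring_1"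
  assumes h: "is_hom h" and "keys p \<subseteq> L" "keys q \<subseteq> L"
    and "\<And>m m'. m \<in> L \<Longrightarrow> m' \<in> L \<Longrightarrow> \<chi> (m + m') = \<chi> m * \<chi> m'"
  shows "pm_eval h \<chi> (p * q) = pm_eval h \<chi> p * pm_eval h \<chi> q"
proof -
  have "pm_eval h \<chi> (p * q) = (\<Sum>m\<in>keys p. \<Sum>m'\<in>keys q.
      (h (lookup p m) * h (lookup q m')) * \<chi> (m + m'))"
    by (subst poly_mapping_mult_eq) (simp add: pm_eval_sum[OF h] pm_eval_single[OF h] is_hom_mult[OF h])
  also have "\<dots> = (\<Sum>m\<in>keys p. \<Sum>m'\<in>keys q.
      (h (lookup p m) * \<chi> m) * (h (lookup q m') * \<chi> m'))"
    using assms by (intro sum.cong refl) (auto simp: subset_iff algebra_simps)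
  finally show ?thesis
    by (simp add: pm_eval_def sum_product)
qed

definition mon_eval :: "('v \<Rightarrow> 'c::comm_ring_1) \<Rightarrow> ('v \<Rightarrow>\<^sub>0 nat) \<Rightarrow> 'c" where
  "mon_eval s m = (\<Prod>v\<in>keys m. s v ^ lookup m v)"

lemma mon_eval_superset:
  assumes "finite A" "keys m \<subseteq> A"
  shows "mon_eval s m = (\<Prod>v\<in>A. s v ^ lookup m v)"
  unfolding mon_eval_def
  by (rule prod.mono_neutral_left) (use assms in \<open>auto simp: in_keys_iff\<close>)

lemma mon_eval_0: "mon_eval s 0 = 1"
  by (simp add: mon_eval_def)

lemma mon_eval_single: "mon_eval s (single v k) = s v ^ k"
  by (simp add: mon_eval_def)

lemma mon_eval_add: "mon_eval s (m + m') = mon_eval s m * mon_eval s m'"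
proof -
  let ?A = "keys m \<union> keys m'"
  have *: "keys m \<subseteq> ?A" "keys m' \<subseteq> ?A" "keys (m + m') \<subseteq> ?A"
    using keys_add[of m m'] by auto
  show ?thesis
    unfolding mon_eval_superset[OF _ *(1), simplified] mon_eval_superset[OF _ *(2), simplified]
      mon_eval_superset[OF _ *(3), simplified]
    by (simp add: lookup_add power_add prod.distrib)
qed

definition mpoly_eval :: "('a::comm_ring_1 \<Rightarrow> 'c::comm_ring_1) \<Rightarrow> ('v \<Rightarrow> 'c) \<Rightarrow> ('v, 'a) mpoly \<Rightarrow> 'c" where
  "mpoly_eval h s = pm_eval h (mon_eval s)"

lemma mpoly_eval_single:
  "is_hom h \<Longrightarrow> mpoly_eval h s (single m c) = h c * mon_eval s m"
  by (simp add: mpoly_eval_def pm_eval_single)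

lemma mpoly_eval_mvar: "is_hom h \<Longrightarrow> mpoly_eval h s (mvar v) = s v"
  by (simp add: mvar_def mpoly_eval_single mon_eval_single is_hom_1)

lemma mpoly_eval_mconst: "is_hom h \<Longrightarrow> mpoly_eval h s (mconst c) = h c"
  by (simp add: mconst_def mpoly_eval_single mon_eval_0)

lemma is_hom_mpoly_eval:
  assumes "is_hom h"
  shows "is_hom (mpoly_eval h s)"
  unfolding is_hom_def
proof (intro conjI allI)
  show "mpoly_eval h s 0 = 0"
    by (simp add: mpoly_eval_def pm_eval_0)
  show "mpoly_eval h s 1 = 1"
    using mpoly_eval_mconst[OF assms, of s 1] by (simp add: mconst_def is_hom_1[OF assms])
  fix p q
  show "mpoly_eval h s (p + q) = mpoly_eval h s p + mpoly_eval h s q"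
    by (simp add: mpoly_eval_def pm_eval_add[OF assms])
  show "mpoly_eval h s (p * q) = mpoly_eval h s p * mpoly_eval h s q"
    unfolding mpoly_eval_def
    by (rule pm_eval_mult[OF assms, where L = UNIV]) (simp_all add: mon_eval_add)
qed

lemma mpoly_eval_cong:
  assumes "p \<in> mpoly_carrier V" "\<And>v. v \<in> V \<Longrightarrow> s v = s' v"
  shows "mpoly_eval h s p = mpoly_eval h s' p"
  unfolding mpoly_eval_def pm_eval_def mon_eval_def
  using assms by (auto simp: mpoly_carrier_def subset_iff intro!: sum.cong prod.cong)

lemma hom_mpoly_eval:
  assumes "is_hom \<phi>"
  shows "\<phi> (mpoly_eval h s p) = mpoly_eval (\<lambda>c. \<phi> (h c)) (\<lambda>v. \<phi> (s v)) p"
  by (simp add: mpoly_eval_def pm_eval_def mon_eval_def is_hom_sum[OF assms] is_hom_prod[OF assms]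
      is_hom_power[OF assms] is_hom_mult[OF assms])

lemma is_hom_mconst: "is_hom (mconst :: 'a::comm_ring_1 \<Rightarrow> ('v, 'a) mpoly)"
  by (simp add: is_hom_def mconst_def single_add mult_single)

lemma mon_eval_mvar: "mon_eval mvar m = (single m 1 :: ('v, 'a::comm_ring_1) mpoly)"
proof -
  have pow: "mvar v ^ k = (single (single v k) 1 :: ('v, 'a) mpoly)" for v k
    by (induction k) (simp_all add: mvar_def mult_single single_add[symmetric])
  have "(\<Prod>v\<in>A. (single (g v) 1 :: ('v, 'a) mpoly)) = single (\<Sum>v\<in>A. g v) 1"
    for A and g :: "'v \<Rightarrow> 'v \<Rightarrow>\<^sub>0 nat"
    by (induction A rule: infinite_finite_induct) (simp_all add: mult_single)
  thus ?thesis
    by (simp add: mon_eval_def pow poly_mapping_sum_single)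
qed

lemma mpoly_eval_mvar_id: "mpoly_eval mconst mvar p = p"
proof -
  have "mpoly_eval mconst mvar p
      = (\<Sum>m\<in>keys p. single m (lookup p m))"
    by (simp add: mpoly_eval_def pm_eval_def mon_eval_mvar mconst_def mult_single)
  thus ?thesis
    by (simp only: poly_mapping_sum_single)
qed

lemma hom_eq_mpoly_eval:
  assumes "is_hom \<phi>"
  shows "\<phi> p = mpoly_eval (\<lambda>c. \<phi> (mconst c)) (\<lambda>v. \<phi> (mvar v)) p"
  using hom_mpoly_eval[OF assms, of mconst mvar p] by (simp add: mpoly_eval_mvar_id)

abbreviation subst :: "('v \<Rightarrow> ('w, 'a) mpoly) \<Rightarrow> ('v, 'a::comm_ring_1) mpoly \<Rightarrow> ('w, 'a) mpoly" where
  "subst \<equiv> mpoly_eval mconst"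

lemmas is_hom_subst = is_hom_mpoly_eval[OF is_hom_mconst]
lemmas subst_mvar = mpoly_eval_mvar[OF is_hom_mconst]
lemmas subst_mconst = mpoly_eval_mconst[OF is_hom_mconst]
lemmas subst_single = mpoly_eval_single[OF is_hom_mconst]
lemmas subst_simps = is_hom_simps[OF is_hom_subst] subst_mvar subst_mconst

lemma subst_subst: "subst \<sigma> (subst \<tau> p) = subst (\<lambda>v. subst \<sigma> (\<tau> v)) p"
  by (simp add: hom_mpoly_eval[OF is_hom_subst] subst_mconst)

lemma subst_fix:
  assumes "p \<in> mpoly_carrier V" "\<And>v. v \<in> V \<Longrightarrow> s v = mvar v"
  shows "subst s p = p"
  using mpoly_eval_cong[OF assms, where h = mconst] by (simp add: mpoly_eval_mvar_id)

section \<open>Polynomials in a set of variables\<close>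

lemma mpoly_carrier_mono: "V \<subseteq> W \<Longrightarrow> mpoly_carrier V \<subseteq> mpoly_carrier W"
  by (auto simp: mpoly_carrier_def)

lemma mpoly_carrier_0: "0 \<in> mpoly_carrier V"
  by (simp add: mpoly_carrier_def)

lemma mpoly_carrier_mconst: "mconst c \<in> mpoly_carrier V"
  by (simp add: mpoly_carrier_def mconst_def)

lemma mconst_1: "mconst 1 = 1"
  by (simp add: mconst_def)

lemma mpoly_carrier_1: "(1 :: ('v, 'a::comm_ring_1) mpoly) \<in> mpoly_carrier V"
  using mpoly_carrier_mconst[of "1::'a" V] by (simp add: mconst_1)

lemma mpoly_carrier_mvar: "v \<in> V \<Longrightarrow> mvar v \<in> mpoly_carrier V"
  by (simp add: mpoly_carrier_def mvar_def)

lemma mpoly_carrier_add: "p \<in> mpoly_carrier V \<Longrightarrow> q \<in> mpoly_carrier V \<Longrightarrow> p + q \<in> mpoly_carrier V"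
  using keys_add[of p q] by (auto simp: mpoly_carrier_def)

lemma mpoly_carrier_uminus: "p \<in> mpoly_carrier V \<Longrightarrow> - p \<in> mpoly_carrier V"
  for p :: "('v, 'a::ab_group_add) mpoly"
  by (auto simp: mpoly_carrier_def in_keys_iff)

lemma mpoly_carrier_mult:
  assumes "p \<in> mpoly_carrier V" "q \<in> mpoly_carrier V"
  shows "p * q \<in> mpoly_carrier V"
  unfolding mpoly_carrier_def
proof (intro CollectI ballI)
  fix m assume "m \<in> keys (p * q)"
  then obtain a b where "m = a + b" "a \<in> keys p" "b \<in> keys q"
    using keys_mult[of p q] by auto
  thus "keys m \<subseteq> V"
    using assms keys_add[of a b] by (fastforce simp: mpoly_carrier_def)
qed

lemma mpoly_carrier_diff: "p \<in> mpoly_carrier V \<Longrightarrow> q \<in> mpoly_carrier V \<Longrightarrow> p - q \<in> mpoly_carrier V"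
  for p :: "('v, 'a::ab_group_add) mpoly"
  using mpoly_carrier_add[OF _ mpoly_carrier_uminus, of p V q] by simp

lemma mpoly_carrier_power:
  "p \<in> mpoly_carrier V \<Longrightarrow> p ^ k \<in> mpoly_carrier V" for p :: "('v, 'a::comm_ring_1) mpoly"
  by (induction k) (simp_all add: mpoly_carrier_1 mpoly_carrier_mult)

lemma mpoly_carrier_sum:
  "(\<And>i. i \<in> I \<Longrightarrow> f i \<in> mpoly_carrier V) \<Longrightarrow> (\<Sum>i\<in>I. f i) \<in> mpoly_carrier V"
  by (induction I rule: infinite_finite_induct) (auto simp: mpoly_carrier_0 mpoly_carrier_add)

lemma mpoly_carrier_prod:
  fixes f :: "'i \<Rightarrow> ('v, 'a::comm_ring_1) mpoly"
  shows "(\<And>i. i \<in> I \<Longrightarrow> f i \<in> mpoly_carrier V) \<Longrightarrow> (\<Prod>i\<in>I. f i) \<in> mpoly_carrier V"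
  by (induction I rule: infinite_finite_induct) (auto simp: mpoly_carrier_1 mpoly_carrier_mult)

lemmas mpoly_carrier_intros = mpoly_carrier_0 mpoly_carrier_1 mpoly_carrier_mconst mpoly_carrier_mvar
  mpoly_carrier_add mpoly_carrier_uminus mpoly_carrier_diff mpoly_carrier_mult mpoly_carrier_power

lemma mpoly_carrier_subst:
  assumes "p \<in> mpoly_carrier V" "\<And>v. v \<in> V \<Longrightarrow> \<sigma> v \<in> mpoly_carrier W"
  shows "subst \<sigma> p \<in> mpoly_carrier W"
  unfolding mpoly_eval_def pm_eval_def mon_eval_def
  by (intro mpoly_carrier_sum mpoly_carrier_mult mpoly_carrier_mconst mpoly_carrier_prod
      mpoly_carrier_power assms(2)) (use assms(1) in \<open>auto simp: mpoly_carrier_def\<close>)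

section \<open>Weights of monomials\<close>

definition wdeg :: "('v \<Rightarrow> int) \<Rightarrow> ('v \<Rightarrow>\<^sub>0 nat) \<Rightarrow> int" where
  "wdeg w m = (\<Sum>v\<in>keys m. w v * int (lookup m v))"

lemma wdeg_superset:
  assumes "finite A" "keys m \<subseteq> A"
  shows "wdeg w m = (\<Sum>v\<in>A. w v * int (lookup m v))"
  unfolding wdeg_def
  by (rule sum.mono_neutral_left) (use assms in \<open>auto simp: in_keys_iff\<close>)

lemma wdeg_0 [simp]: "wdeg w 0 = 0"
  by (simp add: wdeg_def)

lemma wdeg_single [simp]: "wdeg w (single v k) = w v * int k"
  by (simp add: wdeg_def)

lemma wdeg_add: "wdeg w (m + m') = wdeg w m + wdeg w m'"
proof -
  let ?A = "keys m \<union> keys m'"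
  have *: "keys m \<subseteq> ?A" "keys m' \<subseteq> ?A" "keys (m + m') \<subseteq> ?A"
    using keys_add[of m m'] by auto
  show ?thesis
    unfolding wdeg_superset[OF _ *(1), simplified] wdeg_superset[OF _ *(2), simplified]
      wdeg_superset[OF _ *(3), simplified]
    by (simp add: lookup_add algebra_simps sum.distrib)
qed

lemma wdeg_uminus: "wdeg (\<lambda>v. - w v) m = - wdeg w m"
  by (simp add: wdeg_def sum_negf)

lemma wdeg_nonneg: "(\<And>v. w v \<ge> 0) \<Longrightarrow> wdeg w m \<ge> 0"
  by (simp add: wdeg_def sum_nonneg)

definition whom :: "('v \<Rightarrow> int) \<Rightarrow> int \<Rightarrow> ('v, 'a::zero) mpoly \<Rightarrow> bool" where
  "whom w d p \<longleftrightarrow> (\<forall>m\<in>keys p. wdeg w m = d)"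

lemma whom_0: "whom w d 0"
  by (simp add: whom_def)

lemma whom_mconst: "whom w 0 (mconst c)"
  by (simp add: whom_def mconst_def)

lemma whom_1: "whom w 0 (1 :: ('v, 'a::comm_ring_1) mpoly)"
  using whom_mconst[of w "1::'a"] by (simp add: mconst_1)

lemma whom_mvar: "w v = d \<Longrightarrow> whom w d (mvar v)"
  by (simp add: whom_def mvar_def)

lemma whom_add: "whom w d p \<Longrightarrow> whom w d q \<Longrightarrow> whom w d (p + q)"
  using keys_add[of p q] by (auto simp: whom_def)

lemma whom_uminus: "whom w d p \<Longrightarrow> whom w d (- p)" for p :: "('v, 'a::ab_group_add) mpoly"
  by (auto simp: whom_def in_keys_iff)

lemma whom_diff: "whom w d p \<Longrightarrow> whom w d q \<Longrightarrow> whom w d (p - q)"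
  for p :: "('v, 'a::ab_group_add) mpoly"
  using whom_add[OF _ whom_uminus, of w d p q] by simp

lemma whom_mult:
  assumes "whom w d p" "whom w e q"
  shows "whom w (d + e) (p * q)"
  unfolding whom_def
proof
  fix m assume "m \<in> keys (p * q)"
  then obtain a b where "m = a + b" "a \<in> keys p" "b \<in> keys q"
    using keys_mult[of p q] by auto
  thus "wdeg w m = d + e"
    using assms by (auto simp: whom_def wdeg_add)
qed

lemma whom_power: "whom w d p \<Longrightarrow> whom w (int k * d) (p ^ k)" for p :: "('v, 'a::comm_ring_1) mpoly"
proof (induction k)
  case (Suc k)
  thus ?case
    using whom_mult[of w d p "int k * d" "p ^ k"] by (simp add: algebra_simps)
qed (simp add: whom_1)

lemma whom_sum: "(\<And>i. i \<in> I \<Longrightarrow> whom w d (f i)) \<Longrightarrow> whom w d (\<Sum>i\<in>I. f i)"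
  by (induction I rule: infinite_finite_induct) (auto simp: whom_0 whom_add)

lemma whom_unique: "p \<noteq> 0 \<Longrightarrow> whom w d p \<Longrightarrow> whom w e p \<Longrightarrow> d = e"
  by (metis all_not_in_conv keys_eq_empty whom_def)

text \<open>The parts of top weight have a nonzero product because the ring is a domain, and every
  other contribution to the product has strictly smaller weight, so nothing can cancel it.\<close>

lemma top_weight_mult:
  fixes p q :: "('v::linorder, 'a::idom) mpoly"
  assumes p: "\<And>m. m \<in> keys p \<Longrightarrow> wdeg w m \<le> d" "a \<in> keys p" "wdeg w a = d"
    and q: "\<And>m. m \<in> keys q \<Longrightarrow> wdeg w m \<le> e" "b \<in> keys q" "wdeg w b = e"
  shows "\<exists>m\<in>keys (p * q). wdeg w m = d + e"
proof -
  define top where "top d p = (\<Sum>m\<in>{m\<in>keys p. wdeg w m = d}.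
    single m (lookup p m))" for d and p :: "('v, 'a) mpoly"
  have lt: "lookup (top d p) m = (if wdeg w m = d then lookup p m else 0)"
    for d p m
    by (auto simp: top_def lookup_sum lookup_single when_def in_keys_iff)
  have "lookup (top d p) a \<noteq> 0" "lookup (top e q) b \<noteq> 0"
    using p q by (auto simp: lt in_keys_iff)
  hence "top d p \<noteq> 0" "top e q \<noteq> 0"
    by auto
  hence "top d p * top e q \<noteq> 0"
    by simp
  then obtain m where m: "m \<in> keys (top d p * top e q)"
    by (metis all_not_in_conv keys_eq_empty)
  have hom: "whom w d (top d p)" for d p
    by (auto simp: whom_def lt in_keys_iff split: if_splits)
  have wm: "wdeg w m = d + e"
    using whom_mult[OF hom[of d p] hom[of e q]] m by (auto simp: whom_def)
  define p' where "p' = p - top d p"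
  define q' where "q' = q - top e q"
  have p': "wdeg w m < d" if "m \<in> keys p'" for m
    using that p(1)[of m] by (auto simp: p'_def lookup_minus lt in_keys_iff split: if_splits)
  have q': "wdeg w m < e" if "m \<in> keys q'" for m
    using that q(1)[of m] by (auto simp: q'_def lookup_minus lt in_keys_iff split: if_splits)
  have "p * q = top d p * top e q + (top d p * q' + p' * q)"
    by (simp add: p'_def q'_def algebra_simps)
  moreover have "m \<notin> keys (top d p * q')"
  proof
    assume "m \<in> keys (top d p * q')"
    then obtain x y where "m = x + y" "x \<in> keys (top d p)" "y \<in> keys q'"
      using keys_mult[of "top d p" q'] by auto
    thus False
      using hom[of d p] q'[of y] wm by (auto simp: whom_def wdeg_add)
  qed
  moreover have "m \<notin> keys (p' * q)"
  proof
    assume "m \<in> keys (p' * q)"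
    then obtain x y where "m = x + y" "x \<in> keys p'" "y \<in> keys q"
      using keys_mult[of p' q] by auto
    thus False
      using p'[of x] q(1)[of y] wm by (auto simp: wdeg_add)
  qed
  ultimately have "m \<in> keys (p * q)"
    using m by (auto simp: in_keys_iff lookup_add)
  thus ?thesis
    using wm by blast
qed

text \<open>Highest weights add under multiplication, and so do lowest weights. If both sums equal
  \<open>k\<close>, neither factor has room for two different weights.\<close>

lemma whom_factor:
  fixes p q :: "('v::linorder, 'a::idom) mpoly"
  assumes "p \<noteq> 0" "q \<noteq> 0" and hom: "whom w k (p * q)"
  obtains d e where "whom w d p" "whom w e q" "d + e = k"
proof -
  have max: "\<exists>d. (\<forall>m\<in>keys p. wdeg w m \<le> d) \<and> (\<exists>m\<in>keys p. wdeg w m = d)"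
    if "p \<noteq> 0" for p :: "('v, 'a) mpoly" and w
  proof (intro exI[of _ "Max (wdeg w ` keys p)"] conjI ballI)
    have "Max (wdeg w ` keys p) \<in> wdeg w ` keys p"
      using that by (intro Max_in) auto
    thus "\<exists>m\<in>keys p. wdeg w m = Max (wdeg w ` keys p)"
      by auto
  qed auto
  obtain d a where d: "\<And>m. m \<in> keys p \<Longrightarrow> wdeg w m \<le> d" "a \<in> keys p" "wdeg w a = d"
    using max[OF assms(1), of w] by blast
  obtain e b where e: "\<And>m. m \<in> keys q \<Longrightarrow> wdeg w m \<le> e" "b \<in> keys q" "wdeg w b = e"
    using max[OF assms(2), of w] by blast
  \<comment> \<open>The maximum for the negated weight is minus the lowest weight.\<close>
  let ?w = "\<lambda>v. - w v"
  obtain d' a' where d': "\<And>m. m \<in> keys p \<Longrightarrow> wdeg ?w m \<le> d'" "a' \<in> keys p" "wdeg ?w a' = d'"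
    using max[OF assms(1), of ?w] by blast
  obtain e' b' where e': "\<And>m. m \<in> keys q \<Longrightarrow> wdeg ?w m \<le> e'" "b' \<in> keys q" "wdeg ?w b' = e'"
    using max[OF assms(2), of ?w] by blast
  have "d + e = k"
    using top_weight_mult[OF d e] hom by (auto simp: whom_def)
  moreover have "d' + e' = - k"
    using top_weight_mult[OF d' e'] hom by (auto simp: whom_def wdeg_uminus)
  moreover have "- d' \<le> d" "- e' \<le> e"
    using d d'(1)[of a] e e'(1)[of b] by (auto simp: wdeg_uminus)
  ultimately have "d' = - d" "e' = - e"
    by auto
  hence "whom w d p" "whom w e q"
    using d(1) e(1) d'(1) e'(1) by (force simp: whom_def wdeg_uminus)+
  thus ?thesis
    using that \<open>d + e = k\<close> by blast
qed

text \<open>Not involving a variable is homogeneity of degree 0 in that variable. In this form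
  \<open>whom_factor\<close> shows that factors use no new variables.\<close>

lemma mpoly_carrier_iff_whom:
  "p \<in> mpoly_carrier V \<longleftrightarrow> (\<forall>v. v \<notin> V \<longrightarrow> whom (\<lambda>u. if u = v then 1 else 0) 0 p)"
proof -
  have "wdeg (\<lambda>u. if u = v then 1 else 0) m = int (lookup m v)" for v :: 'a and m
  proof -
    let ?A = "insert v (keys m)"
    have "wdeg (\<lambda>u. if u = v then 1 else 0) m
        = (\<Sum>u\<in>?A. (if u = v then 1 else 0) * int (lookup m u))"
      by (rule wdeg_superset) auto
    also have "\<dots> = (\<Sum>u\<in>?A. if u = v then int (lookup m u) else 0)"
      by (rule sum.cong) auto
    finally show ?thesis
      by simp
  qed
  thus ?thesis
    unfolding mpoly_carrier_def whom_def by (auto simp: subset_iff in_keys_iff)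
qed

lemma mpoly_carrier_factor:
  fixes p q :: "('v::linorder, 'a::idom) mpoly"
  assumes "p * q \<in> mpoly_carrier V" "p \<noteq> 0" "q \<noteq> 0"
  shows "p \<in> mpoly_carrier V"
  unfolding mpoly_carrier_iff_whom
proof (intro allI impI)
  fix v assume "v \<notin> V"
  let ?w = "\<lambda>u. if u = v then 1 else 0"
  have "whom ?w 0 (p * q)"
    using assms(1) \<open>v \<notin> V\<close> by (simp add: mpoly_carrier_iff_whom)
  then obtain d e where de: "whom ?w d p" "whom ?w e q" "d + e = 0"
    using whom_factor[OF assms(2,3)] by metis
  obtain a b where "a \<in> keys p" "b \<in> keys q"
    using assms(2,3) by (metis all_not_in_conv keys_eq_empty)
  hence "d \<ge> 0" "e \<ge> 0"
    using de(1,2) wdeg_nonneg[of ?w a] wdeg_nonneg[of ?w b] by (auto simp: whom_def)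
  hence "d = 0"
    using de(3) by simp
  thus "whom ?w 0 p"
    using de(1) by simp
qed

text \<open>Summands of different degrees have disjoint supports. The grading \<open>g\<close> takes
  values in any type, since it is applied both to the degree in one variable and to pairs of
  weights.\<close>

lemma homogeneous_sum_eq_0:
  assumes "finite I" "inj_on f I" "\<And>i m. i \<in> I \<Longrightarrow> m \<in> keys (p i) \<Longrightarrow> g m = f i"
    and "(\<Sum>i\<in>I. p i) = 0" "i \<in> I"
  shows "p i = 0"
proof (rule ccontr)
  assume "p i \<noteq> 0"
  then obtain m where m: "m \<in> keys (p i)"
    by (metis all_not_in_conv keys_eq_empty)
  have "lookup (p j) m = 0" if "j \<in> I - {i}" for j
  proof (rule ccontr)
    assume "lookup (p j) m \<noteq> 0"
    hence "f j = f i"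
      using assms(3)[of j m] assms(3)[of i m] that m assms(5) by (auto simp: in_keys_iff)
    thus False
      using that assms(2,5) by (auto dest: inj_onD)
  qed
  hence "(\<Sum>j\<in>I. lookup (p j) m) = lookup (p i) m"
    using assms(1,5) by (simp add: sum.remove)
  hence "lookup (p i) m = 0"
    using arg_cong[OF assms(4), of "\<lambda>x. lookup x m"] by (simp add: lookup_sum)
  thus False
    using m by (simp add: in_keys_iff)
qed

section \<open>Prime factors of polynomials\<close>

text \<open>Closure under factors makes divisibility inside \<open>A\<close> agree, for nonzero
  elements, with divisibility in the whole ring. Thus the induction over the number of variables can
  run through subrings of a single type; \<open>size\<close> is the measure for cancelling
  nonunits.\<close>

locale saturated_subring =
  fixes A :: "'a::idom set" and size :: "'a \<Rightarrow> nat"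
  assumes sub_0: "0 \<in> A" and sub_1: "1 \<in> A"
    and sub_add: "x \<in> A \<Longrightarrow> y \<in> A \<Longrightarrow> x + y \<in> A"
    and sub_uminus: "x \<in> A \<Longrightarrow> - x \<in> A"
    and sub_mult: "x \<in> A \<Longrightarrow> y \<in> A \<Longrightarrow> x * y \<in> A"
    and sub_factor: "x * y \<in> A \<Longrightarrow> x \<noteq> 0 \<Longrightarrow> y \<noteq> 0 \<Longrightarrow> x \<in> A"
    and size_mult: "x \<noteq> 0 \<Longrightarrow> y \<noteq> 0 \<Longrightarrow> size (x * y) = size x + size y"
    and size_pos: "x \<noteq> 0 \<Longrightarrow> \<not> x dvd 1 \<Longrightarrow> size x > 0"
begin

definition prime_in :: "'a \<Rightarrow> bool" where
  "prime_in p \<longleftrightarrow> p \<in> A \<and> p \<noteq> 0 \<and> \<not> p dvd 1 \<and>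
     (\<forall>u\<in>A. \<forall>v\<in>A. p dvd u * v \<longrightarrow> p dvd u \<or> p dvd v)"

text \<open>This is the form of factoriality that passes from coefficients to polynomials in one
  more variable.\<close>

definition has_prime_factors :: bool where
  "has_prime_factors \<longleftrightarrow> (\<forall>f\<in>A. f \<noteq> 0 \<longrightarrow> \<not> f dvd 1 \<longrightarrow> (\<exists>p. prime_in p \<and> p dvd f))"

lemma sub_diff: "x \<in> A \<Longrightarrow> y \<in> A \<Longrightarrow> x - y \<in> A"
  using sub_add[OF _ sub_uminus, of x y] by simp

lemma sub_sum: "(\<And>i. i \<in> I \<Longrightarrow> f i \<in> A) \<Longrightarrow> (\<Sum>i\<in>I. f i) \<in> A"
  by (induction I rule: infinite_finite_induct) (auto simp: sub_0 sub_add)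

definition poly_on :: "'a poly set" where
  "poly_on = {P. \<forall>i. coeff P i \<in> A}"

lemma poly_on_add: "P \<in> poly_on \<Longrightarrow> Q \<in> poly_on \<Longrightarrow> P + Q \<in> poly_on"
  by (simp add: poly_on_def sub_add)

lemma poly_on_diff: "P \<in> poly_on \<Longrightarrow> Q \<in> poly_on \<Longrightarrow> P - Q \<in> poly_on"
  by (simp add: poly_on_def sub_diff)

lemma poly_on_mult: "P \<in> poly_on \<Longrightarrow> Q \<in> poly_on \<Longrightarrow> P * Q \<in> poly_on"
  by (simp add: poly_on_def coeff_mult sub_mult sub_sum)

lemma poly_on_smult: "c \<in> A \<Longrightarrow> P \<in> poly_on \<Longrightarrow> smult c P \<in> poly_on"
  by (simp add: poly_on_def sub_mult)

lemma poly_on_monom: "c \<in> A \<Longrightarrow> monom c k \<in> poly_on"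
  by (simp add: poly_on_def sub_0)

lemma poly_on_const: "c \<in> A \<Longrightarrow> [:c:] \<in> poly_on"
  using poly_on_monom[of c 0] by (simp add: monom_0)

text \<open>Gauss's lemma: if \<open>i\<close> and \<open>j\<close> are the first indices where
  \<open>p\<close> fails to divide the coefficients, all other terms of the coefficient at
  \<open>i + j\<close> of the product are divisible by \<open>p\<close>.\<close>

lemma prime_in_const_dvd:
  assumes p: "prime_in p" and UV: "U \<in> poly_on" "V \<in> poly_on" "[:p:] dvd U * V"
  shows "[:p:] dvd U \<or> [:p:] dvd V"
proof (rule ccontr)
  assume "\<not> ?thesis"
  hence "\<exists>i. \<not> p dvd coeff U i" "\<exists>j. \<not> p dvd coeff V j"
    by (auto simp: const_poly_dvd_iff)
  define i where "i = (LEAST i. \<not> p dvd coeff U i)"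
  define j where "j = (LEAST j. \<not> p dvd coeff V j)"
  have i: "\<not> p dvd coeff U i" "\<And>k. k < i \<Longrightarrow> p dvd coeff U k"
    using LeastI_ex[OF \<open>\<exists>i. \<not> p dvd coeff U i\<close>] not_less_Least by (auto simp: i_def)
  have j: "\<not> p dvd coeff V j" "\<And>k. k < j \<Longrightarrow> p dvd coeff V k"
    using LeastI_ex[OF \<open>\<exists>j. \<not> p dvd coeff V j\<close>] not_less_Least by (auto simp: j_def)
  have "p dvd coeff (U * V) (i + j)"
    using UV(3) by (simp add: const_poly_dvd_iff)
  also have "coeff (U * V) (i + j) = (\<Sum>k\<le>i + j. coeff U k * coeff V (i + j - k))"
    by (simp add: coeff_mult)
  also have "\<dots> = coeff U i * coeff V j + (\<Sum>k\<in>{..i + j} - {i}. coeff U k * coeff V (i + j - k))"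
    by (subst sum.remove[of _ i]) auto
  finally have "p dvd coeff U i * coeff V j + (\<Sum>k\<in>{..i + j} - {i}. coeff U k * coeff V (i + j - k))" .
  moreover have "p dvd (\<Sum>k\<in>{..i + j} - {i}. coeff U k * coeff V (i + j - k))"
  proof (rule dvd_sum)
    fix k assume "k \<in> {..i + j} - {i}"
    hence "k < i \<or> i + j - k < j"
      by auto
    thus "p dvd coeff U k * coeff V (i + j - k)"
      using i(2)[of k] j(2)[of "i + j - k"] by auto
  qed
  ultimately have "p dvd coeff U i * coeff V j"
    by (metis dvd_add_left_iff)
  thus False
    using p i(1) j(1) UV by (auto simp: prime_in_def poly_on_def)
qed

text \<open>The leading coefficient of \<open>Q\<close> is a factor of an element of
  \<open>A\<close>, hence in \<open>A\<close>; removing the leading term lowers the degree.\<close>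

lemma poly_on_factor:
  assumes "P * Q \<in> poly_on" "P \<in> poly_on" "P \<noteq> 0"
  shows "Q \<in> poly_on"
  using assms(1)
proof (induction "degree Q" arbitrary: Q rule: less_induct)
  case less
  show ?case
  proof (cases "Q = 0")
    case True
    thus ?thesis
      by (simp add: poly_on_def sub_0)
  next
    case False
    have "lead_coeff Q * lead_coeff P \<in> A"
      using less.prems by (simp add: poly_on_def lead_coeff_mult[symmetric] mult.commute)
    hence lc: "lead_coeff Q \<in> A"
      using sub_factor False assms(3) by simp
    define Q' where "Q' = Q - monom (lead_coeff Q) (degree Q)"
    have PQ': "P * Q' \<in> poly_on"
      unfolding Q'_def right_diff_distrib
      by (intro poly_on_diff poly_on_mult poly_on_monom less.prems assms lc)
    have "Q' \<in> poly_on"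
    proof (cases "degree Q = 0")
      case True
      hence "Q' = 0"
        by (auto simp: Q'_def monom_0 elim!: degree_eq_zeroE)
      thus ?thesis
        by (simp add: poly_on_def sub_0)
    next
      case False
      have "degree Q' < degree Q"
      proof (rule degree_lessI)
        show "Q' \<noteq> 0 \<or> 0 < degree Q"
          using False by simp
        show "\<forall>k\<ge>degree Q. coeff Q' k = 0"
          by (auto simp: Q'_def coeff_eq_0)
      qed
      thus ?thesis
        using less.hyps PQ' by simp
    qed
    hence "Q' + monom (lead_coeff Q) (degree Q) \<in> poly_on"
      by (intro poly_on_add poly_on_monom lc)
    thus ?thesis
      by (simp add: Q'_def)
  qed
qed

text \<open>The leading coefficient of \<open>Q\<close> need not be invertible, so each division
  step first multiplies \<open>P\<close> by it; these multipliers accumulate in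
  \<open>c\<close>.\<close>

lemma pseudo_division:
  assumes "P \<in> poly_on" "Q \<in> poly_on" "Q \<noteq> 0"
  shows "\<exists>c\<in>A. \<exists>D\<in>poly_on. \<exists>S\<in>poly_on. c \<noteq> 0 \<and> smult c P = Q * D + S \<and> (S = 0 \<or> degree S < degree Q)"
  using assms(1)
proof (induction "degree P" arbitrary: P rule: less_induct)
  case less
  have z: "0 \<in> poly_on"
    by (simp add: poly_on_def sub_0)
  show ?case
  proof (cases "P = 0 \<or> degree P < degree Q")
    case True
    thus ?thesis
      using less.prems z by (intro bexI[of _ 1] bexI[of _ 0] bexI[of _ P]) (auto simp: sub_1)
  next
    case False
    define a b k where "a = lead_coeff P" and "b = lead_coeff Q" and "k = degree P - degree Q"
    have ab: "a \<in> A" "b \<in> A" "a \<noteq> 0" "b \<noteq> 0"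
      using less.prems assms False by (auto simp: a_def b_def poly_on_def)
    define P' where "P' = smult b P - Q * monom a k"
    have P': "P' \<in> poly_on"
      unfolding P'_def by (intro poly_on_diff poly_on_smult poly_on_mult poly_on_monom ab less.prems assms)
    have d: "degree (Q * monom a k) = degree P"
    proof -
      have "degree Q + k = degree P"
        using False by (simp add: k_def)
      thus ?thesis
        using degree_mult_eq[of Q "monom a k"] assms(3) degree_monom_eq[OF ab(3), of k] ab(3)
        by (metis monom_eq_0_iff)
    qed
    have vanish: "coeff P' i = 0" if "i \<ge> degree P" for i
    proof (cases "i = degree P")
      case True
      have "coeff (Q * monom a k) (degree P) = b * a"
        unfolding d[symmetric] lead_coeff_mult by (simp add: b_def degree_monom_eq ab)
      thus ?thesis
        unfolding True P'_def coeff_diff coeff_smult by (simp add: a_def)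
    next
      case False
      thus ?thesis
        using that d coeff_eq_0[of P i] coeff_eq_0[of "Q * monom a k" i] by (simp add: P'_def)
    qed
    show ?thesis
    proof (cases "P' = 0")
      case True
      hence "smult b P = Q * monom a k + 0"
        by (simp add: P'_def)
      thus ?thesis
        using ab z poly_on_monom by blast
    next
      case P'0: False
      have "degree P' < degree P"
      proof (rule ccontr)
        assume "\<not> degree P' < degree P"
        hence "lead_coeff P' = 0"
          by (intro vanish) simp
        thus False
          using P'0 by simp
      qed
      then obtain c D S where *: "c \<in> A" "D \<in> poly_on" "S \<in> poly_on" "c \<noteq> 0" "smult c P' = Q * D + S"
        "S = 0 \<or> degree S < degree Q"
        using less.hyps[OF _ P'] by blast
      have "smult (c * b) P = smult c P' + smult c (Q * monom a k)"
        by (simp add: P'_def smult_diff_right)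
      also have "\<dots> = Q * (D + smult c (monom a k)) + S"
        using *(5) by (simp add: algebra_simps)
      finally have "smult (c * b) P = Q * (D + smult c (monom a k)) + S" .
      moreover have "D + smult c (monom a k) \<in> poly_on"
        by (intro poly_on_add poly_on_smult poly_on_monom ab *)
      ultimately show ?thesis
        using * ab sub_mult[of c b] by (metis mult_eq_0_iff)
    qed
  qed
qed

definition primitive :: "'a poly \<Rightarrow> bool" where
  "primitive P \<longleftrightarrow> (\<forall>p. prime_in p \<longrightarrow> \<not> [:p:] dvd P)"

lemma prime_in_cofactor:
  assumes "p \<in> A" "p \<noteq> 0" "p * c \<in> A"
  shows "c \<in> A"
  using sub_factor[of c p] assms sub_0 by (cases "c = 0") (auto simp: mult.commute)

context
  assumes fact: has_prime_factors
begin

text \<open>A prime factor \<open>p\<close> of \<open>c\<close> divides \<open>H * W\<close>, where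
  \<open>smult c V = H * W\<close>. By Gauss's lemma it divides \<open>W\<close>, as
  \<open>H\<close> is primitive, so it can be cancelled on both sides. The size of \<open>c\<close>
  drops.\<close>

lemma primitive_dvd_smult:
  assumes "c \<in> A" "c \<noteq> 0" "H \<in> poly_on" "H \<noteq> 0" "primitive H" "V \<in> poly_on" "H dvd smult c V"
  shows "H dvd V"
  using assms(1,2,6,7)
proof (induction "size c" arbitrary: c V rule: less_induct)
  case less
  show ?case
  proof (cases "c dvd 1")
    case True
    then obtain d where "c * d = 1"
      by (metis dvdE)
    hence "V = smult d (smult c V)"
      by (simp add: mult.commute)
    thus ?thesis
      using dvd_smult[OF less.prems(4), of d] by simp
  next
    case False
    then obtain p where p: "prime_in p" "p dvd c"
      using fact less.prems unfolding has_prime_factors_def by blast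
    then obtain c' where c': "c = p * c'"
      by (auto elim: dvdE)
    have pc: "p \<in> A" "p \<noteq> 0" "\<not> p dvd 1"
      using p by (auto simp: prime_in_def)
    have c'A: "c' \<in> A" "c' \<noteq> 0"
      using prime_in_cofactor[of p c'] pc c' less.prems by auto
    obtain W where W: "smult c V = H * W"
      using less.prems(4) by (auto elim: dvdE)
    have "W \<in> poly_on"
      using poly_on_factor[of H W] W assms poly_on_smult[OF less.prems(1,3)] by simp
    moreover have "[:p:] dvd H * W"
      unfolding W[symmetric] c' by (simp add: const_poly_dvd_iff)
    ultimately have "[:p:] dvd W"
      using prime_in_const_dvd[OF p(1) assms(3)] p(1) assms(5) by (auto simp: primitive_def)
    then obtain W' where "W = smult p W'"
      by (auto elim!: dvdE)
    hence "smult p (smult c' V) = smult p (H * W')"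
      using W c' by simp
    hence "smult c' V = H * W'"
      using pc(2) smult_cancel by blast
    moreover have "size c' < size c"
      using size_mult[of p c'] size_pos[of p] pc c'A c' by simp
    ultimately show ?thesis
      using less.hyps[OF _ c'A less.prems(3)] by simp
  qed
qed

text \<open>Prime constants are divided out one by one; the size of the leading coefficient
  decreases each time.\<close>

lemma primitive_part:
  assumes "P \<in> poly_on" "P \<noteq> 0"
  shows "\<exists>c\<in>A. \<exists>Q\<in>poly_on. c \<noteq> 0 \<and> primitive Q \<and> P = smult c Q"
  using assms
proof (induction "size (lead_coeff P)" arbitrary: P rule: less_induct)
  case less
  show ?case
  proof (cases "primitive P")
    case True
    thus ?thesis
      using less.prems sub_1 by (metis one_neq_zero smult_1_left)
  next
    case False
    then obtain p where p: "prime_in p" "[:p:] dvd P"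
      by (auto simp: primitive_def)
    then obtain Q where Q: "P = smult p Q"
      by (auto elim!: dvdE)
    have pc: "p \<in> A" "p \<noteq> 0" "\<not> p dvd 1"
      using p by (auto simp: prime_in_def)
    have "Q \<in> poly_on" "Q \<noteq> 0"
      using poly_on_factor[of "[:p:]" Q] Q less.prems poly_on_const pc by auto
    moreover have "size (lead_coeff Q) < size (lead_coeff P)"
      using size_mult[of p "lead_coeff Q"] size_pos[of p] pc \<open>Q \<noteq> 0\<close> Q by simp
    ultimately obtain c R where "c \<in> A" "R \<in> poly_on" "c \<noteq> 0" "primitive R" "Q = smult c R"
      using less.hyps by blast
    thus ?thesis
      using Q pc sub_mult by (metis mult_eq_0_iff smult_smult)
  qed
qed

definition poly_prime_in :: "'a poly \<Rightarrow> bool" where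
  "poly_prime_in H \<longleftrightarrow> H \<in> poly_on \<and> H \<noteq> 0 \<and> \<not> H dvd 1 \<and>
     (\<forall>U\<in>poly_on. \<forall>V\<in>poly_on. H dvd U * V \<longrightarrow> H dvd U \<or> H dvd V)"

text \<open>
  A primitive divisor of minimal positive degree is prime: otherwise a combination of it with
  one of the factors of a multiple is a nonzero constant, by pseudo-division.
\<close>

lemma minimal_divisor_prime:
  assumes H: "H \<in> poly_on" "degree H > 0" "primitive H"
    and min: "\<And>G. G \<in> poly_on \<Longrightarrow> degree G > 0 \<Longrightarrow> G dvd H \<Longrightarrow> degree H \<le> degree G"
  shows "poly_prime_in H"
  unfolding poly_prime_in_def
proof (intro conjI ballI impI)
  show "H \<in> poly_on" by fact
  show H0: "H \<noteq> 0" using H by auto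
  show "\<not> H dvd 1"
  proof
    assume "H dvd 1"
    then obtain K where K: "1 = H * K"
      by (auto elim: dvdE)
    hence "degree H + degree K = 0"
      using degree_mult_eq[of H K] H0 by (metis degree_1 mult_zero_right zero_neq_one)
    thus False
      using H(2) by simp
  qed
  fix U V assume UV: "U \<in> poly_on" "V \<in> poly_on" "H dvd U * V"
  \<comment> \<open>The nonzero elements of the ideal generated by \<open>H\<close> and
    \<open>U\<close>. The primitive part of an element of least degree plays the role of a greatest
    common divisor.\<close>
  define I where "I = {X * H + Y * U | X Y. X \<in> poly_on \<and> Y \<in> poly_on} - {0}"
  have one: "1 \<in> poly_on" and zero: "0 \<in> poly_on"
    using poly_on_const[OF sub_1] by (simp_all add: poly_on_def sub_0 one_pCons)
  have HI: "H \<in> I"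
  proof -
    have "H = 1 * H + 0 * U"
      by simp
    thus ?thesis
      using H0 one zero unfolding I_def by blast
  qed
  obtain r where r: "r \<in> I" "\<And>s. s \<in> I \<Longrightarrow> degree r \<le> degree s"
    using ex_has_least_nat[of "\<lambda>r. r \<in> I" H degree] HI by auto
  obtain X Y where XY: "r = X * H + Y * U" "X \<in> poly_on" "Y \<in> poly_on" "r \<noteq> 0"
    using r(1) by (auto simp: I_def)
  have rp: "r \<in> poly_on"
    unfolding XY by (intro poly_on_add poly_on_mult XY H UV)
  obtain e r' where e: "e \<in> A" "r' \<in> poly_on" "e \<noteq> 0" "primitive r'" "r = smult e r'"
    using primitive_part[OF rp XY(4)] by blast
  have r'0: "r' \<noteq> 0" "degree r' = degree r"
    using XY(4) e(3,5) by auto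
  have r'dvd: "r' dvd F" if F: "F = H \<or> F = U" for F
  proof -
    have Fp: "F \<in> poly_on"
      using F H UV by auto
    obtain c D S where c: "c \<in> A" "D \<in> poly_on" "S \<in> poly_on" "c \<noteq> 0" "smult c F = r * D + S"
      "S = 0 \<or> degree S < degree r"
      using pseudo_division[OF Fp rp XY(4)] by blast
    \<comment> \<open>A nonzero pseudo-remainder would lie in \<open>I\<close> and have smaller
      degree than \<open>r\<close>.\<close>
    have "S = 0"
    proof (rule ccontr)
      assume S: "S \<noteq> 0"
      have mem: "[:c:] - X * D \<in> poly_on" "- (X * D) \<in> poly_on" "[:c:] - Y * D \<in> poly_on" "- (Y * D) \<in> poly_on"
        using poly_on_diff[OF zero poly_on_mult[OF XY(2) c(2)]] poly_on_diff[OF zero poly_on_mult[OF XY(3) c(2)]]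
        by (auto intro!: poly_on_diff poly_on_mult poly_on_const XY c)
      have "S = smult c F - r * D"
        using c(5) by simp
      hence "S = ([:c:] - X * D) * H + (- (Y * D)) * U \<or> S = (- (X * D)) * H + ([:c:] - Y * D) * U"
        using F by (auto simp: XY(1) algebra_simps)
      hence "S \<in> I"
        using S mem unfolding I_def by blast
      thus False
        using r(2) c(6) S by fastforce
    qed
    hence "smult c F = r' * smult e D"
      using c(5) e(5) by simp
    hence "r' dvd smult c F"
      by (rule dvdI)
    thus "r' dvd F"
      using primitive_dvd_smult[OF c(1,4) e(2) r'0(1) e(4) Fp] by simp
  qed
  show "H dvd U \<or> H dvd V"
  proof (cases "degree r' = 0")
    case True
    then obtain d where d: "r = [:d:]"
      using r'0 by (metis degree_eq_zeroE)
    hence dA: "d \<in> A" "d \<noteq> 0"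
      using rp XY(4) by (auto simp: poly_on_def dest: spec[of _ 0])
    \<comment> \<open>The Bezout identity \<open>d = X * H + Y * U\<close> multiplied by
      \<open>V\<close>.\<close>
    have "smult d V = X * V * H + Y * (U * V)"
      using arg_cong[OF XY(1), of "\<lambda>z. z * V"] d by (simp add: algebra_simps)
    hence "H dvd smult d V"
      using UV(3) by simp
    thus ?thesis
      using primitive_dvd_smult[OF dA H(1) H0 H(3) UV(2)] by simp
  next
    case False
    hence "degree H \<le> degree r'"
      using min[OF e(2)] r'dvd by simp
    obtain k where k: "H = r' * k"
      using r'dvd[of H] by (auto elim: dvdE)
    have k0: "k \<noteq> 0" "k \<in> poly_on"
      using k H0 poly_on_factor[of r' k] H(1) e(2) r'0 by auto
    have "degree k = 0"
      using \<open>degree H \<le> degree r'\<close> degree_mult_eq[of r' k] k k0(1) r'0(1) by simp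
    then obtain c where c: "k = [:c:]"
      by (metis degree_eq_zeroE)
    have cA: "c \<in> A" "c \<noteq> 0"
      using k0 c by (auto simp: poly_on_def dest: spec[of _ 0])
    \<comment> \<open>A nonunit constant factor of \<open>H\<close> would have a prime factor,
      against primitivity. So \<open>H\<close> and \<open>r'\<close> are associated.\<close>
    have "c dvd 1"
    proof (rule ccontr)
      assume "\<not> c dvd 1"
      then obtain p where p: "prime_in p" "p dvd c"
        using fact cA unfolding has_prime_factors_def by blast
      hence "[:p:] dvd k"
        unfolding c by (simp add: const_poly_dvd_iff coeff_pCons split: nat.splits)
      hence "[:p:] dvd H"
        using k by simp
      thus False
        using p H(3) by (auto simp: primitive_def)
    qed
    hence "k dvd 1"
      unfolding c by (simp add: is_unit_const_poly_iff)
    hence "H dvd r'"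
      using k mult_dvd_mono[OF dvd_refl, of k 1 r'] by simp
    thus ?thesis
      using r'dvd[of U] dvd_trans by blast
  qed
qed

text \<open>Two kinds of primes occur: prime constants, when \<open>P\<close> is not primitive, and
  otherwise divisors of least positive degree.\<close>

lemma poly_has_prime_factor:
  assumes "P \<in> poly_on" "P \<noteq> 0" "\<not> P dvd 1"
  shows "\<exists>H. poly_prime_in H \<and> H dvd P"
proof (cases "primitive P")
  case False
  then obtain p where p: "prime_in p" "[:p:] dvd P"
    by (auto simp: primitive_def)
  have "poly_prime_in [:p:]"
    using p(1) prime_in_const_dvd[OF p(1)] poly_on_const[of p]
    by (auto simp: poly_prime_in_def prime_in_def is_unit_const_poly_iff)
  thus ?thesis
    using p(2) by blast
next
  case True
  have "degree P > 0"
  proof (rule ccontr)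
    assume "\<not> degree P > 0"
    then obtain c where c: "P = [:c:]"
      by (metis degree_eq_zeroE neq0_conv)
    have "c \<in> A" "c \<noteq> 0" "\<not> c dvd 1"
      using assms c by (auto simp: poly_on_def is_unit_const_poly_iff dest: spec[of _ 0])
    then obtain p where p: "prime_in p" "p dvd c"
      using fact unfolding has_prime_factors_def by blast
    hence "[:p:] dvd P"
      unfolding c by (simp add: const_poly_dvd_iff coeff_pCons split: nat.splits)
    thus False
      using True p by (auto simp: primitive_def)
  qed
  then obtain H where H: "H \<in> poly_on" "degree H > 0" "H dvd P"
    and min: "\<And>G. G \<in> poly_on \<Longrightarrow> degree G > 0 \<Longrightarrow> G dvd P \<Longrightarrow> degree H \<le> degree G"
    using ex_has_least_nat[of "\<lambda>H. H \<in> poly_on \<and> degree H > 0 \<and> H dvd P" P degree] assms(1) by auto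
  have "poly_prime_in H"
  proof (rule minimal_divisor_prime)
    show "primitive H"
      using True H(3) unfolding primitive_def by (meson dvd_trans)
    fix G assume "G \<in> poly_on" "degree G > 0" "G dvd H"
    thus "degree H \<le> degree G"
      using min H(3) dvd_trans by blast
  qed (use H in auto)
  thus ?thesis
    using H(3) by blast
qed

end

end

section \<open>Factorisation in polynomial rings over a field, by induction on the number of
  variables\<close>

lemma mpoly_eval_closed:
  assumes "p \<in> mpoly_carrier V" "0 \<in> S" "1 \<in> S"
    and add: "\<And>x y. x \<in> S \<Longrightarrow> y \<in> S \<Longrightarrow> x + y \<in> S"
    and mult: "\<And>x y. x \<in> S \<Longrightarrow> y \<in> S \<Longrightarrow> x * y \<in> S"
    and "\<And>c. h c \<in> S" "\<And>v. v \<in> V \<Longrightarrow> s v \<in> S"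
  shows "mpoly_eval h s p \<in> S"
proof -
  have sum: "(\<Sum>i\<in>I. f i) \<in> S" if "\<And>i. i \<in> I \<Longrightarrow> f i \<in> S" for f and I :: "('a \<Rightarrow>\<^sub>0 nat) set"
    using that by (induction I rule: infinite_finite_induct) (auto simp: assms(2) add)
  have prod: "(\<Prod>i\<in>I. f i) \<in> S" if "\<And>i. i \<in> I \<Longrightarrow> f i \<in> S" for f and I :: "'a set"
    using that by (induction I rule: infinite_finite_induct) (auto simp: assms(3) mult)
  have pow: "x ^ k \<in> S" if "x \<in> S" for x k
    using that by (induction k) (auto simp: assms(3) mult)
  show ?thesis
    unfolding mpoly_eval_def pm_eval_def mon_eval_def
    by (intro sum mult prod pow assms(6,7)) (use assms(1) in \<open>auto simp: mpoly_carrier_def\<close>)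
qed

lemma mconst_unit: "c \<noteq> 0 \<Longrightarrow> mconst c dvd (1 :: ('v, 'a::field) mpoly)"
  by (rule dvdI[of _ _ "mconst (inverse c)"]) (simp add: mconst_def mult_single)

lemma wdeg_1_eq_0_iff: "wdeg (\<lambda>_. 1) m = 0 \<longleftrightarrow> m = 0"
proof
  assume "wdeg (\<lambda>_. 1) m = 0"
  hence "lookup m v = 0" for v
    by (cases "v \<in> keys m") (auto simp: wdeg_def sum_nonneg_eq_0_iff in_keys_iff)
  thus "m = 0"
    by (intro poly_mapping_eqI) simp
qed simp

text \<open>Meaningful for \<open>p \<noteq> 0\<close> only. Over a field it is additive on products
  and positive on nonzero nonunits, which makes it the \<open>size\<close> of
  \<open>saturated_subring\<close>.\<close>

definition tdeg :: "('v, 'a::zero) mpoly \<Rightarrow> nat" where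
  "tdeg p = nat (Max (wdeg (\<lambda>_. 1) ` keys p))"

lemma tdeg:
  assumes "p \<noteq> 0"
  shows "\<And>m. m \<in> keys p \<Longrightarrow> wdeg (\<lambda>_. 1) m \<le> int (tdeg p)"
    and "\<exists>m\<in>keys p. wdeg (\<lambda>_. 1) m = int (tdeg p)"
proof -
  let ?D = "wdeg (\<lambda>_. 1) ` keys p"
  have ne: "?D \<noteq> {}"
    using assms by simp
  then obtain m where m: "m \<in> keys p" "wdeg (\<lambda>_. 1) m = Max ?D"
    using Max_in[OF finite_imageI[OF finite_keys] ne] by (metis imageE)
  have "Max ?D = int (tdeg p)"
    using wdeg_nonneg[of "\<lambda>_. 1" m] m(2) by (simp add: tdeg_def)
  thus "wdeg (\<lambda>_. 1) m \<le> int (tdeg p)" if "m \<in> keys p" for m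
    using that Max_ge[of ?D "wdeg (\<lambda>_. 1) m"] by simp
  show "\<exists>m\<in>keys p. wdeg (\<lambda>_. 1) m = int (tdeg p)"
    using m \<open>Max ?D = int (tdeg p)\<close> by auto
qed

lemma tdeg_mult:
  fixes p q :: "('v::linorder, 'a::idom) mpoly"
  assumes "p \<noteq> 0" "q \<noteq> 0"
  shows "tdeg (p * q) = tdeg p + tdeg q"
proof -
  have pq: "p * q \<noteq> 0"
    using assms by simp
  obtain a b where ab: "a \<in> keys p" "wdeg (\<lambda>_. 1) a = int (tdeg p)"
    "b \<in> keys q" "wdeg (\<lambda>_. 1) b = int (tdeg q)"
    using tdeg(2)[OF assms(1)] tdeg(2)[OF assms(2)] by blast
  obtain m where "m \<in> keys (p * q)" "wdeg (\<lambda>_. 1) m = int (tdeg p) + int (tdeg q)"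
    using top_weight_mult[OF tdeg(1)[OF assms(1)] ab(1,2) tdeg(1)[OF assms(2)] ab(3,4)] by blast
  hence "int (tdeg p) + int (tdeg q) \<le> int (tdeg (p * q))"
    using tdeg(1)[OF pq] by metis
  moreover obtain m where m: "m \<in> keys (p * q)" "wdeg (\<lambda>_. 1) m = int (tdeg (p * q))"
    using tdeg(2)[OF pq] by blast
  moreover obtain x y where "m = x + y" "x \<in> keys p" "y \<in> keys q"
    using keys_mult[of p q] m(1) by auto
  ultimately show ?thesis
    using tdeg(1)[OF assms(1), of x] tdeg(1)[OF assms(2), of y] by (simp add: wdeg_add)
qed

lemma tdeg_0_mconst:
  assumes "p \<noteq> 0" "tdeg p = 0"
  shows "p = mconst (lookup p 0)"
proof (rule poly_mapping_eqI)
  fix m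
  have "m = 0" if "m \<in> keys p"
    using tdeg(1)[OF assms(1) that] assms(2) wdeg_nonneg[of "\<lambda>_. 1" m] wdeg_1_eq_0_iff[of m] by simp
  thus "lookup p m = lookup (mconst (lookup p 0)) m"
    by (auto simp: mconst_def lookup_single when_def in_keys_iff)
qed

lemma tdeg_pos:
  fixes p :: "('v, 'a::field) mpoly"
  assumes "p \<noteq> 0" "\<not> p dvd 1"
  shows "tdeg p > 0"
  by (metis assms gr0I mconst_unit tdeg_0_mconst lookup_zero poly_mapping_eqI mconst_def single_zero)

lemma unit_mconst:
  fixes p :: "('v::linorder, 'a::field) mpoly"
  assumes "p dvd 1"
  shows "\<exists>c. c \<noteq> 0 \<and> p = mconst c"
proof -
  obtain q where q: "1 = p * q"
    using assms by (auto elim: dvdE)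
  hence "p \<noteq> 0" "q \<noteq> 0"
    by auto
  moreover have "tdeg (1 :: ('v, 'a) mpoly) = 0"
    by (simp add: tdeg_def)
  ultimately have "tdeg p = 0"
    using tdeg_mult[of p q] q by simp
  thus ?thesis
    using tdeg_0_mconst[OF \<open>p \<noteq> 0\<close>] \<open>p \<noteq> 0\<close> by (metis mconst_def single_zero)
qed

lemma saturated_subring_mpoly_carrier:
  "saturated_subring (mpoly_carrier V :: ('v::linorder, 'a::field) mpoly set) tdeg"
  by unfold_locales
    (use mpoly_carrier_factor tdeg_mult tdeg_pos in \<open>blast intro: mpoly_carrier_intros\<close>)+

abbreviation prime_upto :: "nat \<Rightarrow> (nat, 'a::field) mpoly \<Rightarrow> bool" where
  "prime_upto m \<equiv> saturated_subring.prime_in (mpoly_carrier {..<m})"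

lemma is_hom_const_poly: "is_hom (\<lambda>c. [:c:])"
  by (simp add: is_hom_def one_pCons)

lemma is_hom_poly: "is_hom (\<lambda>P. poly P a)"
  by (simp add: is_hom_def)

text \<open>Reads a polynomial as a univariate one in the variable \<open>m\<close>; evaluation at
  \<open>mvar m\<close> undoes this.\<close>

definition last_var :: "nat \<Rightarrow> (nat, 'a::field) mpoly \<Rightarrow> (nat, 'a) mpoly poly" where
  "last_var m = mpoly_eval (\<lambda>c. [:mconst c:]) (\<lambda>v. if v = m then [:0, 1:] else [:mvar v:])"

lemma is_hom_last_var: "is_hom (last_var m)"
  unfolding last_var_def by (intro is_hom_mpoly_eval is_hom_comp[OF is_hom_const_poly is_hom_mconst])

lemma poly_last_var: "poly (last_var m f) (mvar m) = f"
proof -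
  have "poly (last_var m f) (mvar m) = subst mvar f"
    unfolding last_var_def hom_mpoly_eval[OF is_hom_poly]
    by (rule arg_cong2[of _ _ _ _ "\<lambda>h s. mpoly_eval h s f"]) auto
  thus ?thesis
    by (simp add: mpoly_eval_mvar_id)
qed

lemma last_var_const:
  assumes "f \<in> mpoly_carrier {..<m}"
  shows "last_var m f = [:f:]"
proof -
  have "last_var m f = mpoly_eval (\<lambda>c. [:mconst c:]) (\<lambda>v. [:mvar v:]) f"
    unfolding last_var_def by (rule mpoly_eval_cong[OF assms]) auto
  thus ?thesis
    using hom_eq_mpoly_eval[OF is_hom_const_poly, of f] by simp
qed

lemma last_var_mvar: "last_var m (mvar m) = [:0, 1:]"
  unfolding last_var_def by (simp add: mpoly_eval_mvar is_hom_comp[OF is_hom_const_poly is_hom_mconst])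

text \<open>Both \<open>last_var\<close> and its left inverse, evaluation at \<open>mvar m\<close>,
  are homomorphisms, so divisibility passes in both directions.\<close>

lemma last_var_dvd_iff: "last_var m f dvd last_var m g \<longleftrightarrow> f dvd g"
proof
  assume "last_var m f dvd last_var m g"
  then obtain Q where "last_var m g = last_var m f * Q"
    by (auto elim: dvdE)
  hence "poly (last_var m g) (mvar m) = poly (last_var m f) (mvar m) * poly Q (mvar m)"
    by simp
  thus "f dvd g"
    by (simp add: poly_last_var)
qed (auto simp: is_hom_mult[OF is_hom_last_var] elim!: dvdE)

context
  fixes m :: nat
begin

interpretation A: saturated_subring "mpoly_carrier {..<m} :: (nat, 'a::field) mpoly set" tdeg
  by (rule saturated_subring_mpoly_carrier)

interpretation B: saturated_subring "mpoly_carrier {..<Suc m} :: (nat, 'a::field) mpoly set" tdeg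
  by (rule saturated_subring_mpoly_carrier)

lemma last_var_poly_on:
  assumes "(f :: (nat, 'a::field) mpoly) \<in> mpoly_carrier {..<Suc m}"
  shows "last_var m f \<in> A.poly_on"
  unfolding last_var_def
proof (rule mpoly_eval_closed[OF assms])
  have one: "[:1:] \<in> A.poly_on" and zero: "[:0:] \<in> A.poly_on"
    by (intro A.poly_on_const A.sub_1 A.sub_0)+
  show "0 \<in> A.poly_on" "1 \<in> A.poly_on"
    using one zero by (simp_all add: one_pCons)
  fix v assume "v \<in> {..<Suc m}"
  moreover have "[:0, 1 :: (nat, 'a) mpoly:] \<in> A.poly_on"
    using A.poly_on_monom[OF A.sub_1, of 1] by (simp add: monom_altdef)
  ultimately show "(if v = m then [:0, 1:] else [:mvar v :: (nat, 'a) mpoly:]) \<in> A.poly_on"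
    by (auto intro!: A.poly_on_const mpoly_carrier_mvar)
qed (auto intro: A.poly_on_add A.poly_on_mult A.poly_on_const mpoly_carrier_mconst)

lemma last_var_poly:
  assumes "P \<in> A.poly_on"
  shows "last_var m (poly P (mvar m)) = (P :: (nat, 'a::field) mpoly poly)"
proof -
  have "last_var m (poly P (mvar m)) = (\<Sum>i\<le>degree P. last_var m (coeff P i) * [:0, 1:] ^ i)"
    unfolding poly_altdef is_hom_sum[OF is_hom_last_var]
    by (simp add: is_hom_simps[OF is_hom_last_var] last_var_mvar)
  also have "\<dots> = (\<Sum>i\<le>degree P. monom (coeff P i) i)"
    using assms by (intro sum.cong refl) (simp add: last_var_const A.poly_on_def monom_altdef)
  finally show ?thesis
    by (simp add: poly_as_sum_of_monoms)
qed

lemma poly_mpoly_carrier: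
  assumes "P \<in> A.poly_on"
  shows "poly P (mvar m) \<in> (mpoly_carrier {..<Suc m} :: (nat, 'a::field) mpoly set)"
proof -
  have "coeff P i \<in> mpoly_carrier {..<Suc m}" for i
    using assms mpoly_carrier_mono[of "{..<m}" "{..<Suc m}"] by (auto simp: A.poly_on_def)
  thus ?thesis
    unfolding poly_altdef
    by (intro mpoly_carrier_sum mpoly_carrier_mult mpoly_carrier_power mpoly_carrier_mvar) auto
qed

lemma last_var_dvd_1: "last_var m f dvd 1 \<longleftrightarrow> f dvd 1"
  using last_var_dvd_iff[of m f 1] by (simp add: is_hom_1[OF is_hom_last_var])

lemma prime_in_Suc:
  assumes "A.prime_in p"
  shows "B.prime_in (p :: (nat, 'a::field) mpoly)"
  unfolding B.prime_in_def
proof (intro conjI ballI impI)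
  have p: "p \<in> mpoly_carrier {..<m}"
    using assms by (simp add: A.prime_in_def)
  show "p \<in> mpoly_carrier {..<Suc m}"
    using p mpoly_carrier_mono[of "{..<m}" "{..<Suc m}"] by auto
  show "p \<noteq> 0" "\<not> p dvd 1"
    using assms by (auto simp: A.prime_in_def)
  fix u v :: "(nat, 'a) mpoly"
  assume uv: "u \<in> mpoly_carrier {..<Suc m}" "v \<in> mpoly_carrier {..<Suc m}" "p dvd u * v"
  have "last_var m p dvd last_var m u * last_var m v"
    using uv(3) last_var_dvd_iff[of m p "u * v"] by (simp add: is_hom_mult[OF is_hom_last_var])
  hence "last_var m p dvd last_var m u \<or> last_var m p dvd last_var m v"
    using A.prime_in_const_dvd[OF assms last_var_poly_on last_var_poly_on, OF uv(1,2)]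
    by (simp add: last_var_const[OF p])
  thus "p dvd u \<or> p dvd v"
    by (simp add: last_var_dvd_iff)
qed

lemma has_prime_factors_Suc:
  assumes "saturated_subring.has_prime_factors (mpoly_carrier {..<m} :: (nat, 'a::field) mpoly set)"
  shows "saturated_subring.has_prime_factors (mpoly_carrier {..<Suc m} :: (nat, 'a) mpoly set)"
  unfolding B.has_prime_factors_def
proof (intro ballI impI)
  fix f :: "(nat, 'a) mpoly"
  assume f: "f \<in> mpoly_carrier {..<Suc m}" "f \<noteq> 0" "\<not> f dvd 1"
  have "last_var m f \<noteq> 0"
    using f(2) poly_last_var[of m f] by auto
  moreover have "\<not> last_var m f dvd 1"
    using f(3) by (simp add: last_var_dvd_1)
  ultimately obtain H where H: "A.poly_prime_in H" "H dvd last_var m f"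
    using A.poly_has_prime_factor[OF assms last_var_poly_on[OF f(1)]] by auto
  define p where "p = poly H (mvar m)"
  have Hp: "H \<in> A.poly_on" "last_var m p = H"
    using H(1) last_var_poly by (auto simp: A.poly_prime_in_def[OF assms] p_def)
  have "B.prime_in p"
    unfolding B.prime_in_def
  proof (intro conjI ballI impI)
    show "p \<in> mpoly_carrier {..<Suc m}"
      unfolding p_def by (rule poly_mpoly_carrier[OF Hp(1)])
    show "p \<noteq> 0"
      using H(1) Hp(2) is_hom_0[OF is_hom_last_var, of m] by (auto simp: A.poly_prime_in_def[OF assms])
    show "\<not> p dvd 1"
      using H(1) Hp(2) last_var_dvd_1[of p] by (auto simp: A.poly_prime_in_def[OF assms])
    fix u v :: "(nat, 'a) mpoly"
    assume uv: "u \<in> mpoly_carrier {..<Suc m}" "v \<in> mpoly_carrier {..<Suc m}" "p dvd u * v"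
    have "last_var m p dvd last_var m u * last_var m v"
      using uv(3) last_var_dvd_iff[of m p "u * v"] by (simp add: is_hom_mult[OF is_hom_last_var])
    hence "last_var m p dvd last_var m u \<or> last_var m p dvd last_var m v"
      using H(1) Hp(2) last_var_poly_on[OF uv(1)] last_var_poly_on[OF uv(2)]
      by (auto simp: A.poly_prime_in_def[OF assms])
    thus "p dvd u \<or> p dvd v"
      by (simp add: last_var_dvd_iff)
  qed
  moreover have "p dvd f"
    using H(2) Hp(2) last_var_dvd_iff[of m p f] by simp
  ultimately show "\<exists>p. B.prime_in p \<and> p dvd f"
    by blast
qed

end

lemma prime_upto_mono:
  assumes "prime_upto m p" "m \<le> k"
  shows "prime_upto k p"
  using assms(2,1) by (induction k rule: dec_induct) (auto intro: prime_in_Suc)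

lemma mpoly_carrier_bound:
  fixes p :: "(nat, 'a::zero) mpoly"
  shows "\<exists>m. \<forall>k\<ge>m. p \<in> mpoly_carrier {..<k}"
proof -
  have "finite (\<Union>m\<in>keys p. keys m)"
    by simp
  then obtain b where "\<forall>v\<in>(\<Union>m\<in>keys p. keys m). v < b"
    using finite_nat_set_iff_bounded by blast
  thus ?thesis
    by (intro exI[of _ b]) (fastforce simp: mpoly_carrier_def)
qed

text \<open>Any two given factors involve only finitely many variables, so primality can be tested
  in a large enough \<open>K\<close>, to which it extends by Gauss's lemma.\<close>

lemma prime_upto_prime_elem:
  fixes p :: "(nat, 'a::field) mpoly"
  assumes "prime_upto m p"
  shows "prime_elem p"
proof (rule prime_elemI)
  interpret A: saturated_subring "mpoly_carrier {..<m} :: (nat, 'a::field) mpoly set" tdeg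
    by (rule saturated_subring_mpoly_carrier)
  show "p \<noteq> 0" "\<not> p dvd 1"
    using assms by (auto simp: A.prime_in_def)
  fix u v :: "(nat, 'a) mpoly"
  assume uv: "p dvd u * v"
  obtain k1 k2 where k: "\<And>k. k \<ge> k1 \<Longrightarrow> u \<in> mpoly_carrier {..<k}" "\<And>k. k \<ge> k2 \<Longrightarrow> v \<in> mpoly_carrier {..<k}"
    using mpoly_carrier_bound by metis
  define K where "K = max m (max k1 k2)"
  interpret K: saturated_subring "mpoly_carrier {..<K} :: (nat, 'a::field) mpoly set" tdeg
    by (rule saturated_subring_mpoly_carrier)
  have "K.prime_in p" "u \<in> mpoly_carrier {..<K}" "v \<in> mpoly_carrier {..<K}"
    using prime_upto_mono[OF assms, of K] k by (auto simp: K_def)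
  thus "p dvd u \<or> p dvd v"
    using uv by (auto simp: K.prime_in_def)
qed

theorem mpoly_prime_factor:
  fixes f :: "(nat, 'a::field) mpoly"
  assumes "f \<noteq> 0" "\<not> f dvd 1"
  shows "\<exists>p. prime_elem p \<and> p dvd f"
proof -
  have all: "saturated_subring.has_prime_factors (mpoly_carrier {..<m} :: (nat, 'a) mpoly set)" for m
  proof (induction m)
    \<comment> \<open>Without variables only constants remain, and the nonzero ones are
      units.\<close>
    case 0
    interpret A: saturated_subring "mpoly_carrier {..<0::nat} :: (nat, 'a::field) mpoly set" tdeg
      by (rule saturated_subring_mpoly_carrier)
    show ?case
      unfolding A.has_prime_factors_def
    proof (intro ballI impI)
      fix f :: "(nat, 'a) mpoly"
      assume f: "f \<in> mpoly_carrier {..<0}" "f \<noteq> 0" "\<not> f dvd 1"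
      then obtain m where m: "m \<in> keys f" "wdeg (\<lambda>_. 1) m = int (tdeg f)"
        using tdeg(2) by blast
      hence "m = 0"
        using f(1) by (auto simp: mpoly_carrier_def)
      hence False
        using m(2) tdeg_pos[OF f(2,3)] by simp
      thus "\<exists>p. A.prime_in p \<and> p dvd f" ..
    qed
  qed (rule has_prime_factors_Suc)
  obtain m where m: "f \<in> mpoly_carrier {..<m}"
    using mpoly_carrier_bound by blast
  interpret A: saturated_subring "mpoly_carrier {..<m} :: (nat, 'a::field) mpoly set" tdeg
    by (rule saturated_subring_mpoly_carrier)
  show ?thesis
    using all[of m] m assms prime_upto_prime_elem unfolding A.has_prime_factors_def by blast
qed

section \<open>Orders of vanishing\<close>

abbreviation emb :: "(nat, complex) mpoly \<Rightarrow> ambient" where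
  "emb f \<equiv> Fract f 1"

lemma is_hom_emb: "is_hom emb"
  by (simp add: is_hom_def Zero_fract_def One_fract_def)

lemma emb_eq_0_iff: "emb f = 0 \<longleftrightarrow> f = 0"
  by (simp add: Zero_fract_def eq_fract)

lemma Fract_emb: "Fract f g = emb f / emb g"
  by simp

lemma fract_eq_emb: "\<exists>f g. g \<noteq> 0 \<and> x = emb f / emb g"
  by (metis Fract_cases Fract_emb)

definition pval :: "'a::idom \<Rightarrow> 'a \<Rightarrow> nat" where
  "pval p f = (THE k. \<exists>g. f = p ^ k * g \<and> \<not> p dvd g)"

lemma pval_eqI:
  assumes "p \<noteq> 0" "f = p ^ k * g" "\<not> p dvd g"
  shows "pval p f = k"
  unfolding pval_def
proof (rule the_equality)
  have aux: False if "p ^ i * g = p ^ j * h" "i < j" "\<not> p dvd g" for i j g h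
  proof -
    have "p ^ i * g = p ^ i * (p ^ (j - i) * h)"
      using that by (simp add: power_add[symmetric] mult.assoc[symmetric])
    hence "g = p ^ (j - i) * h"
      using assms(1) by simp
    thus False
      using that(2,3) by (metis dvd_power dvd_mult2 zero_less_diff)
  qed
  fix l assume "\<exists>g. f = p ^ l * g \<and> \<not> p dvd g"
  then obtain h where h: "f = p ^ l * h" "\<not> p dvd h"
    by blast
  show "l = k"
    using aux[of k g l h] aux[of l h k g] assms(2,3) h by (cases l k rule: linorder_cases) auto
qed (use assms in blast)

text \<open>Cancelling \<open>p\<close> lowers the total degree, so it is possible only finitely
  often.\<close>

lemma pval_decomp:
  fixes f :: "(nat, 'a::field) mpoly"
  assumes "prime_elem p" "f \<noteq> 0"
  shows "\<exists>g. f = p ^ pval p f * g \<and> \<not> p dvd g"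
proof -
  have p: "p \<noteq> 0" "\<not> p dvd 1"
    using assms(1) by (auto simp: prime_elem_def)
  have "\<exists>k g. f = p ^ k * g \<and> \<not> p dvd g"
    using assms(2)
  proof (induction "tdeg f" arbitrary: f rule: less_induct)
    case less
    show ?case
    proof (cases "p dvd f")
      case True
      then obtain f' where f': "f = p * f'"
        by (auto elim: dvdE)
      hence "f' \<noteq> 0" "tdeg f' < tdeg f"
        using less.prems tdeg_mult[of p f'] tdeg_pos[OF p] p(1) by auto
      then obtain k g where "f' = p ^ k * g" "\<not> p dvd g"
        using less.hyps by blast
      thus ?thesis
        using f' by (intro exI[of _ "Suc k"] exI[of _ g]) simp
    next
      case False
      thus ?thesis
        by (intro exI[of _ 0] exI[of _ f]) simp
    qed
  qed
  thus ?thesis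
    using pval_eqI[OF p(1)] by metis
qed

lemma pval_mult:
  fixes f :: "(nat, 'a::field) mpoly"
  assumes "prime_elem p" "f \<noteq> 0" "g \<noteq> 0"
  shows "pval p (f * g) = pval p f + pval p g"
proof -
  obtain f' g' where *: "f = p ^ pval p f * f'" "\<not> p dvd f'" "g = p ^ pval p g * g'" "\<not> p dvd g'"
    using pval_decomp[OF assms(1,2)] pval_decomp[OF assms(1,3)] by blast
  show ?thesis
  proof (rule pval_eqI)
    show "p \<noteq> 0"
      using assms by auto
    show "\<not> p dvd f' * g'"
      using * assms(1) by (auto dest: prime_elem_dvd_multD)
    have "f * g = (p ^ pval p f * f') * (p ^ pval p g * g')"
      using * by simp
    thus "f * g = p ^ (pval p f + pval p g) * (f' * g')"
      by (simp add: power_add algebra_simps)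
  qed
qed

lemma pval_ge_iff:
  fixes f :: "(nat, 'a::field) mpoly"
  assumes "prime_elem p" "f \<noteq> 0"
  shows "k \<le> pval p f \<longleftrightarrow> p ^ k dvd f"
proof
  obtain g where g: "f = p ^ pval p f * g" "\<not> p dvd g"
    using pval_decomp[OF assms] by blast
  {
    assume "k \<le> pval p f"
    thus "p ^ k dvd f"
      using g(1) by (metis dvd_mult2 le_imp_power_dvd)
  next
    assume "p ^ k dvd f"
    then obtain h where h: "f = p ^ k * h"
      by (auto elim: dvdE)
    hence "h \<noteq> 0"
      using assms by auto
    then obtain h' where "h = p ^ pval p h * h'" "\<not> p dvd h'"
      using pval_decomp[OF assms(1)] by blast
    hence "pval p f = k + pval p h"
      using h assms(1) by (intro pval_eqI[of _ _ _ h']) (auto simp: power_add mult.assoc)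
    thus "k \<le> pval p f"
      by simp
  }
qed

lemma pval_pos_iff:
  "prime_elem p \<Longrightarrow> f \<noteq> 0 \<Longrightarrow> 0 < pval p f \<longleftrightarrow> p dvd f" for f :: "(nat, 'a::field) mpoly"
  using pval_ge_iff[of p f 1] by (simp add: Suc_le_eq)

lemma pval_add:
  fixes f :: "(nat, 'a::field) mpoly"
  assumes "prime_elem p" "f \<noteq> 0" "g \<noteq> 0" "f + g \<noteq> 0"
  shows "min (pval p f) (pval p g) \<le> pval p (f + g)"
  using pval_ge_iff[OF assms(1,4)] pval_ge_iff[OF assms(1,2)] pval_ge_iff[OF assms(1,3)]
  by (meson dvd_add min.cobounded1 min.cobounded2)

lemma pval_self: "prime_elem p \<Longrightarrow> pval p p = 1"
  by (rule pval_eqI[of _ _ _ 1]) (auto simp: prime_elem_def)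

lemma pval_not_dvd: "prime_elem p \<Longrightarrow> \<not> p dvd f \<Longrightarrow> pval p f = 0"
  by (rule pval_eqI[of _ _ _ f]) auto

text \<open>The value does not depend on the chosen fraction because \<open>pval\<close> is
  additive. At 0 it is unspecified, so uses of the order keep 0 apart.\<close>

definition pord :: "(nat, complex) mpoly \<Rightarrow> ambient \<Rightarrow> int" where
  "pord p x = (THE k. \<exists>f g. f \<noteq> 0 \<and> g \<noteq> 0 \<and> x = emb f / emb g \<and> k = int (pval p f) - int (pval p g))"

context
  fixes p :: "(nat, complex) mpoly"
  assumes p: "prime_elem p"
begin

lemma pord_frac:
  assumes "f \<noteq> 0" "g \<noteq> 0"
  shows "pord p (emb f / emb g) = int (pval p f) - int (pval p g)"
  unfolding pord_def
proof (rule the_equality)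
  fix k assume "\<exists>f' g'. f' \<noteq> 0 \<and> g' \<noteq> 0 \<and> emb f / emb g = emb f' / emb g' \<and> k = int (pval p f') - int (pval p g')"
  then obtain f' g' where *: "f' \<noteq> 0" "g' \<noteq> 0" "emb f / emb g = emb f' / emb g'" "k = int (pval p f') - int (pval p g')"
    by blast
  hence "f * g' = f' * g"
    using assms by (simp add: eq_fract)
  thus "k = int (pval p f) - int (pval p g)"
    using pval_mult[OF p assms(1) *(2)] pval_mult[OF p *(1) assms(2)] *(4) by simp
qed (use assms in blast)

lemma pord_emb: "f \<noteq> 0 \<Longrightarrow> pord p (emb f) = int (pval p f)"
  using pord_frac[of f 1] pval_not_dvd[OF p, of 1] p by (simp add: prime_elem_def One_fract_def[symmetric])

lemma nonzero_frac:
  assumes "x \<noteq> 0"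
  obtains f g where "f \<noteq> 0" "g \<noteq> 0" "x = emb f / emb g"
  using fract_eq_emb[of x] assms by (metis div_0 emb_eq_0_iff)

lemma pord_mult:
  assumes "x \<noteq> 0" "y \<noteq> 0"
  shows "pord p (x * y) = pord p x + pord p y"
proof -
  obtain f g where fg: "f \<noteq> 0" "g \<noteq> 0" "x = emb f / emb g"
    using nonzero_frac[OF assms(1)] .
  obtain f' g' where fg': "f' \<noteq> 0" "g' \<noteq> 0" "y = emb f' / emb g'"
    using nonzero_frac[OF assms(2)] .
  have xy: "x * y = emb (f * f') / emb (g * g')"
    by (simp add: fg fg')
  have "pord p (x * y) = int (pval p (f * f')) - int (pval p (g * g'))"
    unfolding xy by (rule pord_frac) (use fg fg' in auto)
  moreover have "pord p x = int (pval p f) - int (pval p g)" "pord p y = int (pval p f') - int (pval p g')"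
    using fg fg' pord_frac by blast+
  ultimately show ?thesis
    using fg fg' by (simp add: pval_mult[OF p])
qed

lemma pord_1: "pord p 1 = 0"
  using pord_mult[of 1 1] by simp

lemma pord_inverse:
  assumes "x \<noteq> 0"
  shows "pord p (inverse x) = - pord p x"
  using pord_mult[of x "inverse x"] assms by (simp add: pord_1)

lemma pord_divide: "x \<noteq> 0 \<Longrightarrow> y \<noteq> 0 \<Longrightarrow> pord p (x / y) = pord p x - pord p y"
  using pord_mult[of x "inverse y"] pord_inverse[of y] by (simp add: divide_inverse)

lemma pord_power: "x \<noteq> 0 \<Longrightarrow> pord p (x ^ k) = int k * pord p x"
  by (induction k) (simp_all add: pord_1 pord_mult algebra_simps)

lemma pord_power_int: "x \<noteq> 0 \<Longrightarrow> pord p (x powi k) = k * pord p x"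
  by (cases "k \<ge> 0") (simp_all add: power_int_def pord_power pord_inverse)

lemma pord_add:
  assumes "x \<noteq> 0" "y \<noteq> 0" "x + y \<noteq> 0"
  shows "min (pord p x) (pord p y) \<le> pord p (x + y)"
proof -
  obtain f g where fg: "f \<noteq> 0" "g \<noteq> 0" "x = emb f / emb g"
    using nonzero_frac[OF assms(1)] .
  obtain f' g' where fg': "f' \<noteq> 0" "g' \<noteq> 0" "y = emb f' / emb g'"
    using nonzero_frac[OF assms(2)] .
  have xy: "x + y = emb (f * g' + f' * g) / emb (g * g')"
    using fg fg' by simp
  hence nz: "f * g' + f' * g \<noteq> 0"
    using assms(3) by (auto simp: fract_collapse)
  have "pord p (x + y) = int (pval p (f * g' + f' * g)) - int (pval p g) - int (pval p g')"
    unfolding xy using pord_frac[OF nz, of "g * g'"] fg fg' by (simp add: pval_mult[OF p])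
  moreover have "min (pval p f + pval p g') (pval p f' + pval p g) \<le> pval p (f * g' + f' * g)"
    using pval_add[OF p _ _ nz] fg fg' by (simp add: pval_mult[OF p])
  moreover have "pord p x = int (pval p f) - int (pval p g)" "pord p y = int (pval p f') - int (pval p g')"
    using fg fg' pord_frac by blast+
  ultimately show ?thesis
    by linarith
qed

end

section \<open>The ring of invariants\<close>

text \<open>Scaling variables according to a weight multiplies a homogeneous polynomial by one
  power. With \<open>t = x i ^ a i\<close> and the weight \<open>ydeg\<close> this clears
  denominators in \<open>sections_minors\<close>.\<close>

lemma subst_scale:
  fixes F :: "('v, 'a::comm_ring_1) mpoly"
  assumes "whom (\<lambda>v. int (u v)) (int k) F"
  shows "subst (\<lambda>v. t ^ u v * mvar v) F = t ^ k * F"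
proof -
  have mon: "mon_eval (\<lambda>v. t ^ u v * mvar v) m = t ^ nat (wdeg (\<lambda>v. int (u v)) m) * mon_eval mvar m" for m
  proof -
    have "wdeg (\<lambda>v. int (u v)) m = int (\<Sum>v\<in>keys m. u v * lookup m v)"
      by (simp add: wdeg_def)
    hence *: "nat (wdeg (\<lambda>v. int (u v)) m) = (\<Sum>v\<in>keys m. u v * lookup m v)"
      by (simp only: nat_int)
    show ?thesis
      unfolding * by (simp add: mon_eval_def power_mult_distrib prod.distrib power_mult[symmetric] power_sum)
  qed
  have "subst (\<lambda>v. t ^ u v * mvar v) F =
      (\<Sum>m\<in>keys F. mconst (lookup F m) * (t ^ k * mon_eval mvar m))"
    unfolding mpoly_eval_def pm_eval_def mon
    using assms by (intro sum.cong refl) (simp add: whom_def)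
  also have "\<dots> = t ^ k * subst mvar F"
    by (simp add: mpoly_eval_def pm_eval_def sum_distrib_left algebra_simps)
  finally show ?thesis
    by (simp add: mpoly_eval_mvar_id)
qed

lemma emb_0: "emb 0 = 0" and emb_1: "emb 1 = 1"
  by (rule is_hom_0[OF is_hom_emb], rule is_hom_1[OF is_hom_emb])

lemma emb_add: "emb (f + g) = emb f + emb g"
  by (rule is_hom_add[OF is_hom_emb])

lemma emb_diff: "emb (f - g) = emb f - emb g"
  by (rule is_hom_diff[OF is_hom_emb])

lemma emb_uminus: "emb (- f) = - emb f"
  by (rule is_hom_uminus[OF is_hom_emb])

lemma emb_mult: "emb (f * g) = emb f * emb g"
  by (rule is_hom_mult[OF is_hom_emb])

lemma emb_power: "emb (f ^ k) = emb f ^ k"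
  by (rule is_hom_power[OF is_hom_emb])

lemma emb_sum: "emb (\<Sum>i\<in>I. f i) = (\<Sum>i\<in>I. emb (f i))"
  by (rule is_hom_sum[OF is_hom_emb])

lemmas emb_simps = emb_0 emb_1 emb_add emb_diff emb_uminus emb_mult emb_power

lemma frac_eq_iff: "g \<noteq> 0 \<Longrightarrow> g' \<noteq> 0 \<Longrightarrow> emb f / emb g = emb f' / emb g' \<longleftrightarrow> f * g' = f' * g"
  by (simp add: eq_fract)

text \<open>Keeps quotients such as \<open>emb F / emb G\<close> in the language of fields instead
  of letting the simplifier merge them into \<open>Fract\<close>.\<close>

declare divide_fract [simp del] mult_fract [simp del] add_fract [simp del] diff_fract [simp del]
  minus_fract [simp del] inverse_fract [simp del]

lemma mvar_neq_0: "mvar v \<noteq> (0 :: ('v, 'a::zero_neq_one) mpoly)"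
  by (metis mvar_def lookup_single_eq lookup_zero zero_neq_one)

locale dual_bundle =
  fixes n :: nat and a :: "nat \<Rightarrow> nat"
  assumes n2: "n \<ge> 2" and a_pos: "i \<le> n \<Longrightarrow> a i > 0"
begin

abbreviation x :: "nat \<Rightarrow> (nat, complex) mpoly" where "x i \<equiv> mvar i"

abbreviation y :: "nat \<Rightarrow> (nat, complex) mpoly" where "y j \<equiv> mvar (n + 1 + j)"

abbreviation is_y :: "nat \<Rightarrow> bool" where "is_y v \<equiv> n < v \<and> v \<le> 2 * n + 1"

abbreviation xy_polys :: "(nat, complex) mpoly set" where "xy_polys \<equiv> mpoly_carrier {..2 * n + 1}"

definition minor :: "nat \<Rightarrow> nat \<Rightarrow> (nat, complex) mpoly" where
  "minor i j = x i ^ a i * y j - x j ^ a j * y i"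

definition ydeg :: "nat \<Rightarrow> nat" where
  "ydeg v = (if is_y v then 1 else 0)"

text \<open>The coefficient of \<open>y j\<close> in a dual section has degree \<open>- a j\<close>.
  The weight \<open>a j\<close> on \<open>y j\<close> compensates this, so that sections of the
  untwisted symmetric powers get first degree 0.\<close>

definition xdeg :: "nat \<Rightarrow> nat" where
  "xdeg v = (if v \<le> n then 1 else if is_y v then a (v - n - 1) else 0)"

abbreviation xwt :: "nat \<Rightarrow> int" where "xwt v \<equiv> int (xdeg v)"

abbreviation ywt :: "nat \<Rightarrow> int" where "ywt v \<equiv> int (ydeg v)"

text \<open>
  The translations by the parameter s, which is the variable 2 n + 2, form the action of the
  additive group whose infinitesimal generator contracts with \<open>(x\<^sub>0^a\<^sub>0, \<dots>, x\<^sub>n^a\<^sub>n)\<close>.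
\<close>

definition translate :: "nat \<Rightarrow> (nat, complex) mpoly" where
  "translate v = (if is_y v then mvar v + mvar (2 * n + 2) * x (v - n - 1) ^ a (v - n - 1) else mvar v)"

definition invariants :: "(nat, complex) mpoly set" where
  "invariants = {F \<in> xy_polys. subst translate F = F}"

definition sections :: "int \<Rightarrow> int \<Rightarrow> (nat, complex) mpoly set" where
  "sections d k = {F \<in> invariants. whom xwt d F \<and> whom ywt k F}"

lemma invariants_mconst: "mconst c \<in> invariants"
  by (simp add: invariants_def subst_mconst mpoly_carrier_mconst)

lemma invariants_0: "0 \<in> invariants"
  by (simp add: invariants_def subst_simps mpoly_carrier_0)

lemma invariants_1: "1 \<in> invariants"
  by (simp add: invariants_def subst_simps mpoly_carrier_1)

lemma invariants_add: "F \<in> invariants \<Longrightarrow> G \<in> invariants \<Longrightarrow> F + G \<in> invariants"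
  by (simp add: invariants_def subst_simps mpoly_carrier_add)

lemma invariants_uminus: "F \<in> invariants \<Longrightarrow> - F \<in> invariants"
  by (simp add: invariants_def subst_simps mpoly_carrier_uminus)

lemma invariants_mult: "F \<in> invariants \<Longrightarrow> G \<in> invariants \<Longrightarrow> F * G \<in> invariants"
  by (simp add: invariants_def subst_simps mpoly_carrier_mult)

lemma invariants_x: "i \<le> n \<Longrightarrow> x i \<in> invariants"
  by (simp add: invariants_def subst_simps translate_def mpoly_carrier_mvar)

lemma minor_xy: "i \<le> n \<Longrightarrow> j \<le> n \<Longrightarrow> minor i j \<in> xy_polys"
  unfolding minor_def
  by (intro mpoly_carrier_diff mpoly_carrier_mult mpoly_carrier_power mpoly_carrier_mvar) auto

lemma invariants_minor: "i \<le> n \<Longrightarrow> j \<le> n \<Longrightarrow> minor i j \<in> invariants"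
  using minor_xy[of i j] by (simp add: invariants_def minor_def subst_simps translate_def algebra_simps)

lemma invariants_x_poly:
  assumes "F \<in> mpoly_carrier {..n}"
  shows "F \<in> invariants"
proof -
  have "F \<in> xy_polys"
    using assms mpoly_carrier_mono[of "{..n}" "{..2 * n + 1}"] by auto
  moreover have "subst translate F = F"
    by (rule subst_fix[OF assms]) (simp add: translate_def)
  ultimately show ?thesis
    by (simp add: invariants_def)
qed

text \<open>The product of the two translated factors is \<open>F * G\<close>, which is free of the
  parameter. In a domain each translated factor is then free of it as well, so setting the parameter
  to 0 changes nothing and recovers \<open>F\<close>.\<close>

lemma invariants_factor:
  assumes "F * G \<in> invariants" "F \<noteq> 0" "G \<noteq> 0"
  shows "F \<in> invariants"
proof -
  define drop :: "nat \<Rightarrow> (nat, complex) mpoly" where "drop v = (if v = 2 * n + 2 then 0 else mvar v)" for v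
  have untranslate: "subst drop (subst translate H) = H" if "H \<in> xy_polys" for H
  proof -
    have "subst (\<lambda>v. subst drop (translate v)) H = H"
      by (rule subst_fix[OF that]) (auto simp: translate_def subst_simps drop_def)
    thus ?thesis
      by (simp add: subst_subst)
  qed
  have FG: "F \<in> xy_polys" "G \<in> xy_polys"
    using assms mpoly_carrier_factor[of F G] mpoly_carrier_factor[of G F]
    by (auto simp: invariants_def mult.commute)
  have "subst translate F * subst translate G = F * G"
    using assms(1) by (simp add: invariants_def subst_simps)
  moreover have "subst translate F \<noteq> 0" "subst translate G \<noteq> 0"
    using untranslate[OF FG(1)] untranslate[OF FG(2)] assms(2,3) by (auto simp: subst_simps)
  ultimately have *: "subst translate F \<in> xy_polys"
    using mpoly_carrier_factor[of "subst translate F" "subst translate G"] assms(1)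
    by (auto simp: invariants_def)
  have "subst drop (subst translate F) = subst translate F"
    by (rule subst_fix[OF *]) (auto simp: drop_def)
  thus ?thesis
    using FG untranslate by (simp add: invariants_def)
qed

lemma sections_0: "0 \<in> sections d k"
  by (simp add: sections_def invariants_0 whom_0)

lemma sections_mconst: "mconst c \<in> sections 0 0"
  by (simp add: sections_def invariants_mconst whom_mconst)

lemma sections_1: "1 \<in> sections 0 0"
  by (simp add: sections_def invariants_1 whom_1)

lemma sections_add: "F \<in> sections d k \<Longrightarrow> G \<in> sections d k \<Longrightarrow> F + G \<in> sections d k"
  by (simp add: sections_def invariants_add whom_add)

lemma sections_uminus: "F \<in> sections d k \<Longrightarrow> - F \<in> sections d k"
  by (simp add: sections_def invariants_uminus whom_uminus)

lemma sections_mult: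
  "F \<in> sections d k \<Longrightarrow> G \<in> sections e l \<Longrightarrow> d + e = d' \<Longrightarrow> k + l = k' \<Longrightarrow> F * G \<in> sections d' k'"
  using whom_mult[of _ d F e G] whom_mult[of _ k F l G] by (auto simp: sections_def invariants_mult)

lemma sections_power: "F \<in> sections d k \<Longrightarrow> F ^ N \<in> sections (int N * d) (int N * k)"
proof (induction N)
  case (Suc N)
  thus ?case
    using sections_mult[of F d k "F ^ N"] by (simp add: algebra_simps)
qed (simp add: sections_1)

lemma sections_x: "i \<le> n \<Longrightarrow> x i \<in> sections 1 0"
  by (simp add: sections_def invariants_x whom_mvar xdeg_def ydeg_def)

lemma sections_x_power: "i \<le> n \<Longrightarrow> x i ^ N \<in> sections (int N) 0"
  using sections_power[OF sections_x, of i N] by simp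

lemma sections_minor:
  assumes "i \<le> n" "j \<le> n"
  shows "minor i j \<in> sections (int (a i) + int (a j)) 1"
proof -
  have "whom xwt (int (a i) * 1 + int (a j)) (x i ^ a i * y j)"
    if "i \<le> n" "j \<le> n" for i j
    using that by (intro whom_mult whom_power whom_mvar) (auto simp: xdeg_def)
  moreover have "whom ywt (int (a i) * 0 + 1) (x i ^ a i * y j)"
    if "i \<le> n" "j \<le> n" for i j
    using that by (intro whom_mult whom_power whom_mvar) (auto simp: ydeg_def)
  ultimately show ?thesis
    using assms invariants_minor[OF assms]
    by (auto simp: sections_def minor_def intro!: whom_diff) (metis add.commute mult.right_neutral)
qed

lemma sections_factor:
  assumes "F * G \<in> sections d k" "F \<noteq> 0" "G \<noteq> 0"
  obtains d1 k1 d2 k2 where "F \<in> sections d1 k1" "G \<in> sections d2 k2" "d1 + d2 = d" "k1 + k2 = k"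
proof -
  obtain d1 d2 where d: "whom xwt d1 F" "whom xwt d2 G" "d1 + d2 = d"
    using assms whom_factor[OF assms(2,3)] by (metis (no_types, lifting) mem_Collect_eq sections_def)
  obtain k1 k2 where k: "whom ywt k1 F" "whom ywt k2 G" "k1 + k2 = k"
    using assms whom_factor[OF assms(2,3)] by (metis (no_types, lifting) mem_Collect_eq sections_def)
  have "F \<in> invariants" "G \<in> invariants"
    using assms invariants_factor[of F G] invariants_factor[of G F]
    by (auto simp: sections_def mult.commute)
  thus ?thesis
    using that d k by (simp add: sections_def)
qed

lemma sections_cofactor:
  assumes "F * G \<in> sections d k" "F \<in> sections d1 k1" "F \<noteq> 0"
  shows "G \<in> sections (d - d1) (k - k1)"
proof (cases "G = 0")
  case False
  then obtain d1' k1' d2 k2 where *: "F \<in> sections d1' k1'" "G \<in> sections d2 k2" "d1' + d2 = d" "k1' + k2 = k"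
    using sections_factor[OF assms(1,3)] by metis
  hence "d1' = d1" "k1' = k1"
    using assms whom_unique[OF assms(3)] by (auto simp: sections_def)
  thus ?thesis
    using * by auto
qed (simp add: sections_0)

lemma sections_nonneg:
  assumes "F \<in> sections d k" "F \<noteq> 0"
  shows "d \<ge> 0" "k \<ge> 0"
proof -
  obtain m where "m \<in> keys F"
    using assms(2) by (metis all_not_in_conv keys_eq_empty)
  thus "d \<ge> 0" "k \<ge> 0"
    using assms(1) wdeg_nonneg[of "xwt" m] wdeg_nonneg[of "ywt" m]
    by (auto simp: sections_def whom_def)
qed

definition minors :: "nat \<Rightarrow> nat \<Rightarrow> (nat, complex) mpoly" where
  "minors i v = (if is_y v then minor i (v - n - 1) else mvar v)"

text \<open>Translating by \<open>- y\<^sub>i / x\<^sub>i^a\<^sub>i\<close> turns every \<open>y\<^sub>j\<close> into a multiple of a minor.\<close>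

lemma sections_minors:
  assumes "F \<in> sections d (int k)" "i \<le> n"
  shows "x i ^ (a i * k) * F = subst (minors i) F"
proof -
  \<comment> \<open>The translation by \<open>- y i / x i ^ a i\<close> without denominators: the
    parameter becomes \<open>- y i\<close>, while each \<open>y j\<close> is scaled by
    \<open>x i ^ a i\<close>. Thus \<open>\<theta>\<close> sends the translate of \<open>y j\<close>
    to \<open>minor i j\<close>.\<close>
  define \<theta> where "\<theta> v = (if v = 2 * n + 2 then - y i else (x i ^ a i) ^ ydeg v * mvar v)" for v
  have F: "F \<in> xy_polys" "subst translate F = F" "whom ywt (int k) F"
    using assms by (auto simp: sections_def invariants_def)
  have "subst \<theta> F = subst (\<lambda>v. (x i ^ a i) ^ ydeg v * mvar v) F"
    by (rule mpoly_eval_cong[OF F(1)]) (simp add: \<theta>_def)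
  hence "subst \<theta> F = x i ^ (a i * k) * F"
    by (simp add: subst_scale[OF F(3)] power_mult)
  moreover have "subst \<theta> F = subst (\<lambda>v. subst \<theta> (translate v)) F"
    using F(2) subst_subst[of \<theta> translate F] by simp
  moreover have "subst (\<lambda>v. subst \<theta> (translate v)) F = subst (minors i) F"
  proof (rule mpoly_eval_cong[OF F(1)])
    fix v assume v: "v \<in> {..2 * n + 1}"
    show "subst \<theta> (translate v) = minors i v"
    proof (cases "is_y v")
      case True
      hence "n + 1 + (v - n - 1) = v" "v - n - 1 \<le> n"
        by auto
      thus ?thesis
        using True assms(2)
        by (auto simp: translate_def minors_def minor_def subst_simps \<theta>_def ydeg_def algebra_simps)
    next
      case False
      thus ?thesis
        using v by (auto simp: translate_def minors_def subst_simps \<theta>_def ydeg_def)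
    qed
  qed
  ultimately show ?thesis
    by simp
qed

lemma minor_self: "minor i i = 0"
  by (simp add: minor_def)

lemma minor_swap: "minor j i = - minor i j"
  by (simp add: minor_def)

section \<open>Symmetric powers over a chart\<close>

lemma homogeneous_mpoly_iff:
  "homogeneous_mpoly {..n} e p \<longleftrightarrow> p \<in> mpoly_carrier {..n} \<and> whom xwt (int e) p"
proof -
  have "wdeg xwt m = int (\<Sum>v\<in>keys m. lookup m v)"
    if "keys m \<subseteq> {..n}" for m
  proof -
    have "wdeg xwt m = (\<Sum>v\<in>keys m. int (lookup m v))"
      unfolding wdeg_def using that by (intro sum.cong refl) (auto simp: xdeg_def)
    thus ?thesis
      by simp
  qed
  thus ?thesis
    unfolding homogeneous_mpoly_def whom_def
    by (metis (no_types, lifting) mpoly_carrier_def mem_Collect_eq of_nat_eq_iff)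
qed

lemma x_poly_ydeg: "p \<in> mpoly_carrier {..n} \<Longrightarrow> whom ywt 0 p"
  unfolding whom_def wdeg_def mpoly_carrier_def
  by (fastforce intro!: sum.neutral simp: ydeg_def)

lemma sections_x_poly:
  "p \<in> mpoly_carrier {..n} \<Longrightarrow> whom xwt d p \<Longrightarrow> p \<in> sections d 0"
  by (simp add: sections_def invariants_x_poly x_poly_ydeg)

lemma sections_ydeg_0:
  assumes "F \<in> sections d 0"
  shows "F \<in> mpoly_carrier {..n}"
  unfolding mpoly_carrier_def
proof (intro CollectI ballI subsetI)
  fix m v assume m: "m \<in> keys F" and v: "v \<in> keys m"
  have "(\<Sum>v\<in>keys m. int (ydeg v) * int (lookup m v)) = 0"
    using assms m by (simp add: sections_def whom_def wdeg_def)
  hence "int (ydeg v) * int (lookup m v) = 0"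
    using v by (subst (asm) sum_nonneg_eq_0_iff) auto
  moreover have "v \<le> 2 * n + 1"
    using assms m v by (auto simp: sections_def invariants_def mpoly_carrier_def)
  ultimately show "v \<in> {..n}"
    using v by (auto simp: ydeg_def in_keys_iff split: if_splits)
qed

text \<open>An explicit model of the k-th symmetric power over the chart: invariants with a power of
  \<open>x i\<close> as denominator, of total first degree 0. It agrees with \<open>sym_dual\<close>
  by \<open>sym_dual_eq\<close>.\<close>

definition chart_sections :: "nat \<Rightarrow> nat \<Rightarrow> ambient set" where
  "chart_sections i k = {emb F / emb (x i) ^ N | F N. F \<in> sections (int N) (int k)}"

lemma x_neq_0: "x i \<noteq> 0"
  by (rule mvar_neq_0)

lemma emb_x_neq_0: "emb (x i) \<noteq> 0"
  by (simp add: emb_eq_0_iff x_neq_0)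

lemma chart_sectionsI: "F \<in> sections (int N) (int k) \<Longrightarrow> emb F / emb (x i) ^ N \<in> chart_sections i k"
  by (auto simp: chart_sections_def)

lemma chart_sections_expand:
  assumes "F \<in> sections (int N) k" "i \<le> n"
  shows "emb F / emb (x i) ^ N = emb (x i ^ K * F) / emb (x i) ^ (K + N)"
    and "x i ^ K * F \<in> sections (int (K + N)) k"
  using emb_x_neq_0[of i] sections_mult[OF sections_x_power[OF assms(2), of K] assms(1)]
  by (auto simp: emb_simps power_add)

lemma chart_sections_0: "0 \<in> chart_sections i k"
  using chart_sectionsI[OF sections_0, of i 0 k] by (simp add: emb_simps)

lemma chart_sections_add:
  assumes "i \<le> n" "f \<in> chart_sections i k" "g \<in> chart_sections i k"
  shows "f + g \<in> chart_sections i k"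
proof -
  obtain F M G N where f: "f = emb F / emb (x i) ^ M" "F \<in> sections (int M) (int k)"
    and g: "g = emb G / emb (x i) ^ N" "G \<in> sections (int N) (int k)"
    using assms unfolding chart_sections_def by blast
  have f': "f = emb (x i ^ N * F) / emb (x i) ^ (N + M)" "x i ^ N * F \<in> sections (int (N + M)) (int k)"
    using chart_sections_expand[OF f(2) assms(1), of N] f(1) by auto
  have g': "g = emb (x i ^ M * G) / emb (x i) ^ (N + M)" "x i ^ M * G \<in> sections (int (N + M)) (int k)"
    using chart_sections_expand[OF g(2) assms(1), of M] g(1) by (auto simp: add.commute)
  have "f + g = emb (x i ^ N * F + x i ^ M * G) / emb (x i) ^ (N + M)"
    unfolding f'(1) g'(1) emb_add by (simp add: add_divide_distrib)
  thus ?thesis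
    using chart_sectionsI[OF sections_add[OF f'(2) g'(2)]] by simp
qed

lemma chart_sections_sum:
  "i \<le> n \<Longrightarrow> (\<And>l. l \<in> I \<Longrightarrow> f l \<in> chart_sections i k) \<Longrightarrow> (\<Sum>l\<in>I. f l) \<in> chart_sections i k"
  by (induction I rule: infinite_finite_induct) (auto intro: chart_sections_0 chart_sections_add)

lemma chart_sections_mult:
  assumes "f \<in> chart_sections i k" "g \<in> chart_sections i l"
  shows "f * g \<in> chart_sections i (k + l)"
proof -
  obtain F M G N where f: "f = emb F / emb (x i) ^ M" "F \<in> sections (int M) (int k)"
    and g: "g = emb G / emb (x i) ^ N" "G \<in> sections (int N) (int l)"
    using assms unfolding chart_sections_def by blast
  have "f * g = emb (F * G) / emb (x i) ^ (M + N)"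
    by (simp add: f g emb_simps power_add)
  moreover have "F * G \<in> sections (int (M + N)) (int (k + l))"
    using f g by (auto intro: sections_mult)
  ultimately show ?thesis
    using chart_sectionsI by simp
qed

lemma twist_sectionsE:
  assumes "f \<in> twist_sections n i d"
  obtains p m where "f = emb p / emb (x i) ^ m" "p \<in> sections (int m + d) 0"
proof -
  obtain p m e where p: "f = emb p / emb (x i) ^ m" "homogeneous_mpoly {..n} e p" "int e = int m + d"
    using assms unfolding twist_sections_def coord_def by blast
  have "p \<in> sections (int m + d) 0"
    using p(2) unfolding homogeneous_mpoly_iff p(3)[symmetric] by (auto intro: sections_x_poly)
  thus ?thesis
    using that p(1) by blast
qed

lemma twist_sectionsI:
  assumes "p \<in> sections (int m + d) 0"
  shows "emb p / emb (x i) ^ m \<in> twist_sections n i d"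
proof (cases "p = 0")
  \<comment> \<open>The degree of a polynomial is a natural number, but \<open>int m + d\<close> may
    be negative when \<open>p = 0\<close>. The denominator is therefore replaced by one of exponent
    \<open>nat (- d)\<close>.\<close>
  case True
  have "emb p / emb (x i) ^ m = emb 0 / coord i ^ nat (- d)"
    using True by (simp add: emb_simps)
  moreover have "homogeneous_mpoly {..n} (nat (int (nat (- d)) + d)) 0"
    by (simp add: homogeneous_mpoly_def mpoly_carrier_0)
  ultimately show ?thesis
    unfolding twist_sections_def by (force simp: coord_def)
next
  case False
  hence "int m + d \<ge> 0"
    using sections_nonneg[OF assms] by simp
  moreover have "homogeneous_mpoly {..n} (nat (int m + d)) p"
    using assms sections_ydeg_0[OF assms] \<open>int m + d \<ge> 0\<close>
    by (simp add: homogeneous_mpoly_iff sections_def)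
  ultimately show ?thesis
    unfolding twist_sections_def coord_def by (intro CollectI exI[of _ p] exI[of _ m]) auto
qed

lemma twist_sections_0: "twist_sections n i 0 = chart_sections i 0"
proof (intro equalityI subsetI)
  fix f assume "f \<in> twist_sections n i 0"
  thus "f \<in> chart_sections i 0"
    by (elim twist_sectionsE) (auto intro: chart_sectionsI)
next
  fix f assume "f \<in> chart_sections i 0"
  thus "f \<in> twist_sections n i 0"
    by (auto simp: chart_sections_def intro: twist_sectionsI)
qed

text \<open>With a common denominator cleared, the equation between the coefficients
  \<open>q j\<close> is exactly the vanishing of the term that translation adds to the sum of the
  \<open>q j * y j\<close>.\<close>

lemma dual_sections_chart:
  assumes "i \<le> n" "f \<in> dual_sections n a i"
  shows "f \<in> chart_sections i 1"
proof -
  obtain g where f: "f = (\<Sum>j\<le>n. g j * fibre_coord n j)"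
    and g: "\<And>j. j \<le> n \<Longrightarrow> g j \<in> twist_sections n i (- int (a j))"
    and 0: "(\<Sum>j\<le>n. g j * coord j ^ a j) = 0"
    using assms(2) unfolding dual_sections_def by blast
  have "\<forall>j. \<exists>p m. j \<le> n \<longrightarrow> g j = emb p / emb (x i) ^ m \<and> p \<in> sections (int m + - int (a j)) 0"
    using g by (metis twist_sectionsE)
  then obtain p m where pm: "\<And>j. j \<le> n \<Longrightarrow> g j = emb (p j) / emb (x i) ^ m j"
    "\<And>j. j \<le> n \<Longrightarrow> p j \<in> sections (int (m j) + - int (a j)) 0"
    by metis
  \<comment> \<open>The sum of all exponents, as a common bound for them.\<close>
  define N where "N = (\<Sum>j\<le>n. m j)"
  have mN: "m j \<le> N" if "j \<le> n" for j
    unfolding N_def using that by (intro member_le_sum) auto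
  define q where "q j = x i ^ (N - m j) * p j" for j
  have q: "q j \<in> sections (int N - int (a j)) 0" if "j \<le> n" for j
    unfolding q_def using mN[OF that]
    by (intro sections_mult[OF sections_x_power[OF assms(1)] pm(2)[OF that]]) auto
  have gq: "g j = emb (q j) / emb (x i) ^ N" if "j \<le> n" for j
  proof -
    have "emb (x i) ^ N = emb (x i) ^ (N - m j) * emb (x i) ^ m j"
      using mN[OF that] by (simp add: power_add[symmetric])
    thus ?thesis
      using pm(1)[OF that] emb_x_neq_0[of i] by (simp add: q_def emb_simps)
  qed
  have "(\<Sum>j\<le>n. g j * coord j ^ a j) = (\<Sum>j\<le>n. emb (q j * x j ^ a j) / emb (x i) ^ N)"
    by (intro sum.cong refl) (simp add: gq coord_def emb_simps)
  also have "\<dots> = emb (\<Sum>j\<le>n. q j * x j ^ a j) / emb (x i) ^ N"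
    by (simp add: emb_sum sum_divide_distrib)
  finally have q0: "(\<Sum>j\<le>n. q j * x j ^ a j) = 0"
    using 0 emb_x_neq_0[of i] by (simp add: emb_eq_0_iff)
  define F where "F = (\<Sum>j\<le>n. q j * y j)"
  have "f = (\<Sum>j\<le>n. emb (q j * y j) / emb (x i) ^ N)"
    unfolding f by (intro sum.cong refl) (simp add: gq fibre_coord_def emb_simps)
  hence fF: "f = emb F / emb (x i) ^ N"
    by (simp add: F_def emb_sum sum_divide_distrib)
  have qc: "q j \<in> mpoly_carrier {..n}" "q j \<in> xy_polys" if "j \<le> n" for j
    using sections_ydeg_0[OF q[OF that]] mpoly_carrier_mono[of "{..n}" "{..2 * n + 1}"] by auto
  have "subst translate F = (\<Sum>j\<le>n. q j * (y j + mvar (2 * n + 2) * x j ^ a j))"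
    unfolding F_def is_hom_sum[OF is_hom_subst]
  proof (intro sum.cong refl)
    fix j assume "j \<in> {..n}"
    hence "subst translate (q j) = q j"
      by (intro subst_fix[OF qc(1)]) (auto simp: translate_def)
    thus "subst translate (q j * y j) = q j * (y j + mvar (2 * n + 2) * x j ^ a j)"
      using \<open>j \<in> {..n}\<close> by (simp add: subst_simps translate_def)
  qed
  also have "\<dots> = F + mvar (2 * n + 2) * (\<Sum>j\<le>n. q j * x j ^ a j)"
    by (simp add: F_def algebra_simps sum.distrib sum_distrib_left)
  finally have "subst translate F = F"
    by (simp add: q0)
  moreover have "F \<in> xy_polys"
    unfolding F_def using qc by (intro mpoly_carrier_sum mpoly_carrier_mult mpoly_carrier_mvar) auto
  moreover have "whom xwt (int N) (q j * y j)" if "j \<le> n" for j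
    using whom_mult[of _ "int N - int (a j)" "q j" "int (a j)" "y j"] q[OF that] that
    by (auto simp: sections_def xdeg_def whom_mvar)
  moreover have "whom ywt 1 (q j * y j)" if "j \<le> n" for j
    using whom_mult[of _ 0 "q j" 1 "y j"] q[OF that] that
    by (auto simp: sections_def ydeg_def whom_mvar)
  ultimately have "F \<in> sections (int N) (int 1)"
    by (auto simp: sections_def invariants_def F_def intro!: whom_sum)
  thus ?thesis
    unfolding fF by (rule chart_sectionsI)
qed

text \<open>The minor is the Koszul relation between \<open>x i ^ a i\<close> and
  \<open>x j ^ a j\<close>. Together the minors with first index \<open>i\<close> are the generators
  used over this chart.\<close>

lemma dual_sections_minor:
  assumes "i \<le> n" "j \<le> n"
  shows "emb (minor i j) / emb (x i) ^ (a i + a j) \<in> dual_sections n a i"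
proof (cases "i = j")
  case True
  have "0 \<in> twist_sections n i d" for d
    using twist_sectionsI[OF sections_0, of i 0 d] by (simp add: emb_simps)
  hence "0 \<in> dual_sections n a i"
    unfolding dual_sections_def by (intro CollectI exI[of _ "\<lambda>_. 0"]) auto
  thus ?thesis
    using True by (simp add: minor_self emb_simps)
next
  case False
  \<comment> \<open>The coefficients of \<open>y j\<close> and \<open>y i\<close> in the minor,
    divided by the stated power of \<open>x i\<close>.\<close>
  define g where "g l = (if l = j then emb 1 / emb (x i) ^ a j
    else if l = i then emb (- (x j ^ a j)) / emb (x i) ^ (a i + a j) else 0)" for l
  have z: "0 \<in> twist_sections n i d" for d
    using twist_sectionsI[OF sections_0, of i 0 d] by (simp add: emb_simps)
  have sum: "(\<Sum>l\<le>n. g l * h l) = g j * h j + g i * h i" for h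
  proof -
    have "(\<Sum>l\<le>n. g l * h l) = (\<Sum>l\<in>{i, j}. g l * h l)"
      by (rule sum.mono_neutral_right) (use assms in \<open>auto simp: g_def\<close>)
    thus ?thesis
      using False by (simp add: add.commute)
  qed
  have "g l \<in> twist_sections n i (- int (a l))" if "l \<le> n" for l
  proof -
    have "emb 1 / emb (x i) ^ a j \<in> twist_sections n i (- int (a j))"
      by (rule twist_sectionsI) (simp add: sections_1)
    moreover have "emb (- (x j ^ a j)) / emb (x i) ^ (a i + a j) \<in> twist_sections n i (- int (a i))"
      by (rule twist_sectionsI) (use sections_uminus[OF sections_x_power[OF assms(2), of "a j"]] in simp)
    ultimately show ?thesis
      by (auto simp: g_def z)
  qed
  moreover have "(\<Sum>l\<le>n. g l * coord l ^ a l) = 0"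
    unfolding sum using False emb_x_neq_0[of i]
    by (simp add: g_def coord_def emb_simps power_add field_simps)
  moreover have "(\<Sum>l\<le>n. g l * fibre_coord n l) = emb (minor i j) / emb (x i) ^ (a i + a j)"
    unfolding sum using False emb_x_neq_0[of i]
    by (simp add: g_def fibre_coord_def minor_def emb_simps power_add field_simps)
  ultimately show ?thesis
    unfolding dual_sections_def by (intro CollectI exI[of _ g]) auto
qed

lemma power_module_add:
  assumes "\<And>s t. s \<in> A \<Longrightarrow> t \<in> A \<Longrightarrow> s + t \<in> A" "f \<in> power_module A M k" "g \<in> power_module A M k"
  shows "f + g \<in> power_module A M k"
proof (cases k)
  case 0
  thus ?thesis
    using assms by simp
next
  case (Suc l)
  obtain N1 s1 m1 N2 s2 m2 where f: "f = (\<Sum>l<N1::nat. s1 l * m1 l)" "\<forall>i<N1. s1 i \<in> power_module A M l \<and> m1 i \<in> M"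
    and g: "g = (\<Sum>l<N2::nat. s2 l * m2 l)" "\<forall>i<N2. s2 i \<in> power_module A M l \<and> m2 i \<in> M"
    using assms(2,3) unfolding Suc power_module.simps by blast
  define s where "s i = (if i < N1 then s1 i else s2 (i - N1))" for i
  define m where "m i = (if i < N1 then m1 i else m2 (i - N1))" for i
  have "{..<N1 + N2} = {..<N1} \<union> {N1..<N1 + N2}"
    by auto
  hence "(\<Sum>i<N1 + N2. s i * m i) = (\<Sum>i<N1. s i * m i) + (\<Sum>i\<in>{N1..<N1 + N2}. s i * m i)"
    by (simp add: sum.union_disjoint ivl_disj_int)
  also have "(\<Sum>i\<in>{N1..<N1 + N2}. s i * m i) = (\<Sum>i<N2. s (i + N1) * m (i + N1))"
    using sum.shift_bounds_nat_ivl[of "\<lambda>i. s i * m i" 0 N1 N2] by (simp add: atLeast0LessThan add.commute)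
  finally have "(\<Sum>i<N1 + N2. s i * m i) = f + g"
    by (simp add: s_def m_def f g)
  moreover have "\<forall>i<N1 + N2. s i \<in> power_module A M l \<and> m i \<in> M"
    using f(2) g(2) by (auto simp: s_def m_def)
  ultimately show ?thesis
    unfolding Suc power_module.simps by (intro CollectI exI[of _ "N1 + N2"] exI[of _ s] exI[of _ m]) auto
qed

lemma power_module_mult:
  assumes "s \<in> power_module A M k" "m \<in> M"
  shows "s * m \<in> power_module A M (Suc k)"
  unfolding power_module.simps
  by (intro CollectI exI[of _ 1] exI[of _ "\<lambda>_. s"] exI[of _ "\<lambda>_. m"]) (use assms in auto)

lemma sym_dual_chart:
  assumes "i \<le> n" "f \<in> sym_dual n a i k"
  shows "f \<in> chart_sections i k"
  using assms(2) unfolding sym_dual_def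
proof (induction k arbitrary: f)
  case 0
  thus ?case
    by (simp add: twist_sections_0)
next
  case (Suc k)
  obtain N s m where f: "f = (\<Sum>l<N::nat. s l * m l)"
    "\<forall>l<N. s l \<in> power_module (twist_sections n i 0) (dual_sections n a i) k \<and> m l \<in> dual_sections n a i"
    using Suc.prems unfolding power_module.simps by blast
  have "s l * m l \<in> chart_sections i (Suc k)" if "l < N" for l
    using chart_sections_mult[of "s l" i k "m l" 1] Suc.IH f(2) that dual_sections_chart[OF assms(1)] by auto
  thus ?case
    unfolding f(1) by (intro chart_sections_sum assms) auto
qed

lemma power_module_scale:
  assumes "\<And>s t. s \<in> A \<Longrightarrow> t \<in> A \<Longrightarrow> s * t \<in> A" "c \<in> A" "f \<in> power_module A M k"
  shows "c * f \<in> power_module A M k"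
  using assms(3)
proof (induction k arbitrary: f)
  case 0
  thus ?case
    using assms by simp
next
  case (Suc k)
  obtain N s m where f: "f = (\<Sum>l<N::nat. s l * m l)" "\<forall>l<N. s l \<in> power_module A M k \<and> m l \<in> M"
    using Suc.prems unfolding power_module.simps by blast
  hence "c * f = (\<Sum>l<N. (c * s l) * m l)"
    by (simp add: sum_distrib_left mult.assoc)
  thus ?case
    unfolding power_module.simps using Suc.IH f(2)
    by (intro CollectI exI[of _ N] exI[of _ "\<lambda>l. c * s l"] exI[of _ m]) auto
qed

lemma sym_dual_add:
  assumes "i \<le> n" "f \<in> sym_dual n a i k" "g \<in> sym_dual n a i k"
  shows "f + g \<in> sym_dual n a i k"
  using assms unfolding sym_dual_def twist_sections_0
  by (intro power_module_add chart_sections_add)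

lemma sym_dual_scale:
  assumes "c \<in> chart_sections i 0" "f \<in> sym_dual n a i k"
  shows "c * f \<in> sym_dual n a i k"
  using assms chart_sections_mult[of _ i 0 _ 0] unfolding sym_dual_def twist_sections_0
  by (intro power_module_scale) auto

lemma mon_induct [consumes 1, case_names zero add]:
  assumes "keys m \<subseteq> V" "P 0"
    and step: "\<And>m v. keys m \<subseteq> V \<Longrightarrow> P m \<Longrightarrow> v \<in> V \<Longrightarrow> P (m + single v (1::nat))"
  shows "P m"
  using assms(1)
proof (induction "\<Sum>v\<in>keys m. lookup m v" arbitrary: m rule: less_induct)
  case less
  show ?case
  proof (cases "m = 0")
    case False
    then obtain v where v: "v \<in> keys m"
      by (metis all_not_in_conv keys_eq_empty)
    define m' where "m' = m - single v 1"
    have look: "lookup m' u = (if u = v then lookup m v - 1 else lookup m u)" for u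
      by (auto simp: m'_def lookup_minus lookup_single when_def)
    have mm: "m = m' + single v 1"
      using v by (intro poly_mapping_eqI) (auto simp: look lookup_add lookup_single when_def in_keys_iff)
    have sub: "keys m' \<subseteq> keys m"
      by (auto simp: look in_keys_iff split: if_splits)
    have "(\<Sum>u\<in>keys m'. lookup m' u) = (\<Sum>u\<in>keys m. lookup m' u)"
      using sub by (intro sum.mono_neutral_left) (auto simp: in_keys_iff)
    also have "\<dots> < (\<Sum>u\<in>keys m. lookup m u)"
      using v by (intro sum_strict_mono_ex1) (auto simp: look in_keys_iff)
    finally have "P m'"
      using less.hyps sub less.prems by blast
    thus ?thesis
      unfolding mm using step[of m' v] sub less.prems v by blast
  qed (simp add: assms)
qed

text \<open>Each \<open>y j\<close>, of weight \<open>a j\<close>, is replaced by a minor of weight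
  \<open>a i + a j\<close>. A monomial of bidegree (d, k) thus acquires weight
  \<open>d + a i * k\<close>, which is the exponent needed in the denominator.\<close>

lemma sym_dual_minors:
  assumes "keys m \<subseteq> {..2 * n + 1}" "i \<le> n"
  shows "\<exists>d k. wdeg xwt m = int d \<and> wdeg ywt m = int k \<and>
    emb (mon_eval (minors i) m) / emb (x i) ^ (d + a i * k) \<in> sym_dual n a i k"
  using assms(1)
proof (induction rule: mon_induct)
  case zero
  have "emb 1 / emb (x i) ^ 0 \<in> twist_sections n i 0"
    by (rule twist_sectionsI) (simp add: sections_1)
  thus ?case
    by (intro exI[of _ 0]) (simp add: mon_eval_0 sym_dual_def)
next
  case (add m v)
  then obtain d k where dk: "wdeg xwt m = int d" "wdeg ywt m = int k"
    "emb (mon_eval (minors i) m) / emb (x i) ^ (d + a i * k) \<in> sym_dual n a i k"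
    by blast
  show ?case
  proof (cases "is_y v")
    case True
    define j where "j = v - n - 1"
    have j: "j \<le> n" "minors i v = minor i j" "xdeg v = a j" "ydeg v = 1"
      using True by (auto simp: j_def minors_def xdeg_def ydeg_def)
    have "emb (mon_eval (minors i) m) / emb (x i) ^ (d + a i * k) * (emb (minor i j) / emb (x i) ^ (a i + a j))
        \<in> sym_dual n a i (Suc k)"
      using power_module_mult[OF _ dual_sections_minor[OF assms(2) j(1)]] dk(3) unfolding sym_dual_def by blast
    moreover have "emb (mon_eval (minors i) m) / emb (x i) ^ (d + a i * k) * (emb (minor i j) / emb (x i) ^ (a i + a j))
        = emb (mon_eval (minors i) (m + single v 1)) / emb (x i) ^ ((d + a j) + a i * Suc k)"
      using j by (simp add: mon_eval_add mon_eval_single emb_simps power_add algebra_simps)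
    ultimately have "emb (mon_eval (minors i) (m + single v 1)) / emb (x i) ^ ((d + a j) + a i * Suc k)
        \<in> sym_dual n a i (Suc k)"
      by (simp only:)
    moreover have "wdeg xwt (m + single v 1) = int (d + a j)"
      "wdeg ywt (m + single v 1) = int (Suc k)"
      using dk j by (simp_all add: wdeg_add)
    ultimately show ?thesis
      by blast
  next
    case False
    hence v: "v \<le> n" "minors i v = x v" "xdeg v = 1" "ydeg v = 0"
      using False add.hyps(2) by (auto simp: minors_def xdeg_def ydeg_def)
    have "emb (x v) / emb (x i) ^ 1 \<in> chart_sections i 0"
      by (rule chart_sectionsI) (use sections_x[OF v(1)] in simp)
    hence "emb (x v) / emb (x i) ^ 1 * (emb (mon_eval (minors i) m) / emb (x i) ^ (d + a i * k)) \<in> sym_dual n a i k"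
      by (rule sym_dual_scale[OF _ dk(3)])
    moreover have "emb (x v) / emb (x i) ^ 1 * (emb (mon_eval (minors i) m) / emb (x i) ^ (d + a i * k))
        = emb (mon_eval (minors i) (m + single v 1)) / emb (x i) ^ (Suc d + a i * k)"
      using v by (simp add: mon_eval_add mon_eval_single emb_simps power_add algebra_simps)
    ultimately have "emb (mon_eval (minors i) (m + single v 1)) / emb (x i) ^ (Suc d + a i * k)
        \<in> sym_dual n a i k"
      by (simp only:)
    moreover have "wdeg xwt (m + single v 1) = int (Suc d)"
      "wdeg ywt (m + single v 1) = int k"
      using dk v by (simp_all add: wdeg_add)
    ultimately show ?thesis
      by blast
  qed
qed

text \<open>Multiplied by \<open>x i ^ (a i * k)\<close>, an invariant becomes a polynomial in
  coordinates and minors with first index \<open>i\<close>, by \<open>sections_minors\<close>. Each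
  of its monomials lies in the symmetric power.\<close>

lemma sym_dual_eq:
  assumes "i \<le> n"
  shows "sym_dual n a i k = chart_sections i k"
proof (intro equalityI subsetI sym_dual_chart assms)
  fix f assume "f \<in> chart_sections i k"
  then obtain F N where F: "f = emb F / emb (x i) ^ N" "F \<in> sections (int N) (int k)"
    unfolding chart_sections_def by blast
  define summand where "summand m = emb (mconst (lookup F m)) *
    (emb (mon_eval (minors i) m) / emb (x i) ^ (N + a i * k))" for m
  have "f = emb (x i ^ (a i * k) * F) / emb (x i) ^ (N + a i * k)"
    using F(1) emb_x_neq_0[of i] by (simp add: emb_simps power_add)
  also have "\<dots> = (\<Sum>m\<in>keys F. summand m)"
    unfolding sections_minors[OF F(2) assms] mpoly_eval_def pm_eval_def
    by (simp add: emb_sum emb_mult sum_divide_distrib summand_def)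
  finally have f: "f = (\<Sum>m\<in>keys F. summand m)" .
  have t: "summand m \<in> sym_dual n a i k" if m: "m \<in> keys F" for m
  proof -
    have "keys m \<subseteq> {..2 * n + 1}" "wdeg xwt m = int N"
      "wdeg ywt m = int k"
      using F(2) m by (auto simp: sections_def invariants_def mpoly_carrier_def whom_def)
    hence "emb (mon_eval (minors i) m) / emb (x i) ^ (N + a i * k) \<in> sym_dual n a i k"
      using sym_dual_minors[OF _ assms, of m] by auto
    moreover have "emb (mconst (lookup F m)) \<in> chart_sections i 0"
      using chart_sectionsI[of "mconst (lookup F m)" 0 0 i] sections_mconst by simp
    ultimately show ?thesis
      unfolding summand_def by (intro sym_dual_scale)
  qed
  have z: "0 \<in> sym_dual n a i k"
  proof (cases k)
    case 0
    thus ?thesis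
      by (simp add: sym_dual_def twist_sections_0 chart_sections_0)
  next
    case (Suc l)
    thus ?thesis
      by (auto simp: sym_dual_def intro!: exI[of _ "0::nat"])
  qed
  have "(\<Sum>m\<in>I. summand m) \<in> sym_dual n a i k" if "finite I" "I \<subseteq> keys F" for I
    using that by (induction I rule: finite_induct) (simp_all add: sym_dual_add[OF assms] z t)
  from this[of "keys F"] show "f \<in> sym_dual n a i k"
    unfolding f by simp
qed

end

section \<open>Straightening\<close>

lemma cring_ring_on:
  fixes A :: "'a::comm_ring_1 set"
  assumes "0 \<in> A" "1 \<in> A" "\<And>x y. x \<in> A \<Longrightarrow> y \<in> A \<Longrightarrow> x + y \<in> A"
    "\<And>x. x \<in> A \<Longrightarrow> - x \<in> A" "\<And>x y. x \<in> A \<Longrightarrow> y \<in> A \<Longrightarrow> x * y \<in> A"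
  shows "cring (ring_on A)"
proof (rule cringI)
  show "abelian_group (ring_on A)"
  proof (rule abelian_groupI)
    fix x assume "x \<in> carrier (ring_on A)"
    thus "\<exists>y\<in>carrier (ring_on A). y \<oplus>\<^bsub>ring_on A\<^esub> x = \<zero>\<^bsub>ring_on A\<^esub>"
      using assms(4)[of x] by (intro bexI[of _ "- x"]) (auto simp: ring_on_def)
  qed (use assms in \<open>auto simp: ring_on_def algebra_simps\<close>)
  show "Group.comm_monoid (ring_on A)"
    by (rule comm_monoidI) (use assms in \<open>auto simp: ring_on_def algebra_simps\<close>)
qed (auto simp: ring_on_def algebra_simps)

lemma mvar_power: "mvar v ^ k = (single (single v k) 1 :: ('v, 'a::comm_ring_1) mpoly)"
  by (induction k) (simp_all add: mvar_def mult_single single_add[symmetric])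

lemma mpoly_carrier_iff_keys:
  "single m c \<in> mpoly_carrier V \<longleftrightarrow> c = 0 \<or> keys m \<subseteq> V"
  by (auto simp: mpoly_carrier_def)

context dual_bundle
begin

definition present_var :: "cox_var \<Rightarrow> (nat, complex) mpoly" where
  "present_var v = (case v of Xvar i \<Rightarrow> x i | Zvar j k \<Rightarrow> minor j k)"

abbreviation present :: "(cox_var, complex) mpoly \<Rightarrow> (nat, complex) mpoly" where
  "present \<equiv> subst present_var"

abbreviation cox_polys :: "(cox_var, complex) mpoly set" where
  "cox_polys \<equiv> mpoly_carrier (cox_vars n)"

lemma cring_cox_poly_ring: "cring (cox_poly_ring n)"
  unfolding cox_poly_ring_def by (rule cring_ring_on) (auto intro: mpoly_carrier_intros)

lemma carrier_cox_poly_ring: "carrier (cox_poly_ring n) = cox_polys"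
  by (simp add: cox_poly_ring_def ring_on_def)

lemma cox_vars_iff: "Xvar i \<in> cox_vars n \<longleftrightarrow> i \<le> n" "Zvar j k \<in> cox_vars n \<longleftrightarrow> j < k \<and> k \<le> n"
  by (auto simp: cox_vars_def)

lemma cox_relations_subset: "cox_relations n a \<subseteq> cox_polys"
  by (auto simp: cox_relations_def cox_vars_iff intro!: mpoly_carrier_intros)

lemma ideal_cox_ideal: "ideal (cox_ideal n a) (cox_poly_ring n)"
  unfolding cox_ideal_def
  by (rule ring.genideal_ideal[OF cring.axioms(1)[OF cring_cox_poly_ring]])
    (simp add: carrier_cox_poly_ring cox_relations_subset)

lemma linear_relation:
  assumes "i < j" "j < k" "k \<le> n"
  shows "XX j ^ a j * ZZ i k - XX k ^ a k * ZZ i j - XX i ^ a i * ZZ j k \<in> cox_relations n a"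
  unfolding cox_relations_def using assms by (intro UnI1) blast

lemma pluecker_relation:
  assumes "i < j" "j < k" "k < l" "l \<le> n"
  shows "ZZ i j * ZZ k l - ZZ i k * ZZ j l + ZZ i l * ZZ j k \<in> cox_relations n a"
  unfolding cox_relations_def using assms by (intro UnI2) blast

lemma cox_relations_ideal: "cox_relations n a \<subseteq> cox_ideal n a"
  unfolding cox_ideal_def
  by (rule ring.genideal_self[OF cring.axioms(1)[OF cring_cox_poly_ring]])
    (simp add: carrier_cox_poly_ring cox_relations_subset)

lemma cox_ideal_subset: "cox_ideal n a \<subseteq> cox_polys"
  using ideal.Icarr[OF ideal_cox_ideal] by (auto simp: carrier_cox_poly_ring)

lemma cox_ideal_mult: "p \<in> cox_ideal n a \<Longrightarrow> q \<in> cox_polys \<Longrightarrow> q * p \<in> cox_ideal n a"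
  using ideal.I_l_closed[OF ideal_cox_ideal, of p q]
  by (simp add: cox_poly_ring_def ring_on_def)

lemma cox_ideal_add: "p \<in> cox_ideal n a \<Longrightarrow> q \<in> cox_ideal n a \<Longrightarrow> p + q \<in> cox_ideal n a"
  using additive_subgroup.a_closed[OF ideal.axioms(1)[OF ideal_cox_ideal], of p q]
  by (simp add: cox_poly_ring_def ring_on_def)

lemma cox_ideal_0: "0 \<in> cox_ideal n a"
  using additive_subgroup.zero_closed[OF ideal.axioms(1)[OF ideal_cox_ideal]]
  by (simp add: cox_poly_ring_def ring_on_def)

lemma present_ring_hom: "ring_hom_ring (cox_poly_ring n) (ring_on UNIV) present"
proof (rule ring_hom_ringI2)
  show "ring (cox_poly_ring n)"
    by (rule cring.axioms(1)[OF cring_cox_poly_ring])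
  show "ring (ring_on UNIV :: (nat, complex) mpoly ring)"
    by (rule cring.axioms(1), rule cring_ring_on) auto
  show "present \<in> ring_hom (cox_poly_ring n) (ring_on UNIV)"
    by (auto simp: ring_hom_def cox_poly_ring_def ring_on_def subst_simps)
qed

lemma present_relations:
  assumes "p \<in> cox_relations n a"
  shows "present p = 0"
  using assms unfolding cox_relations_def
  by (elim UnE CollectE exE conjE)
    (simp_all only: subst_simps present_var_def cox_var.case minor_def, simp_all add: algebra_simps)

lemma present_cox_ideal:
  assumes "p \<in> cox_ideal n a"
  shows "present p = 0"
proof -
  interpret ring_hom_ring "cox_poly_ring n" "ring_on UNIV" present
    by (rule present_ring_hom)
  have "cox_ideal n a \<subseteq> a_kernel (cox_poly_ring n) (ring_on UNIV) present"
    unfolding cox_ideal_def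
  proof (rule R.genideal_minimal[OF kernel_is_ideal])
    show "cox_relations n a \<subseteq> a_kernel (cox_poly_ring n) (ring_on UNIV) present"
    proof
      fix q assume "q \<in> cox_relations n a"
      with cox_relations_subset present_relations have "q \<in> cox_polys" "present q = 0"
        by blast+
      thus "q \<in> a_kernel (cox_poly_ring n) (ring_on UNIV) present"
        unfolding a_kernel_def' by (simp add: carrier_cox_poly_ring) (simp add: ring_on_def)
    qed
  qed
  with assms have "p \<in> a_kernel (cox_poly_ring n) (ring_on UNIV) present" ..
  thus ?thesis
    unfolding a_kernel_def' by (simp add: ring_on_def)
qed

text \<open>
  Read \<open>Zvar i k\<close> as the chord from i to k of a convex polygon with vertices 0, ..., n and
  infinity, and \<open>Xvar j ^ a j\<close> as the chord from j to infinity. Standard monomials are those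
  without crossing chords.
\<close>

definition standard :: "(cox_var \<Rightarrow>\<^sub>0 nat) \<Rightarrow> bool" where
  "standard m \<longleftrightarrow>
     (\<forall>i j k. i < j \<longrightarrow> j < k \<longrightarrow> 0 < lookup m (Zvar i k) \<longrightarrow> lookup m (Xvar j) < a j) \<and>
     (\<forall>i j k l. i < j \<longrightarrow> j < k \<longrightarrow> k < l \<longrightarrow> 0 < lookup m (Zvar i k) \<longrightarrow> lookup m (Zvar j l) = 0)"

definition reducible :: "(cox_var, complex) mpoly set" where
  "reducible = {q \<in> cox_polys. \<exists>s\<in>cox_polys. (\<forall>m\<in>keys s. standard m) \<and> q - s \<in> cox_ideal n a}"

lemma reducible_ideal:
  assumes "p \<in> cox_ideal n a"
  shows "p \<in> reducible"
  unfolding reducible_def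
  by (intro CollectI conjI bexI[of _ 0]) (use assms cox_ideal_subset in \<open>auto simp: mpoly_carrier_0\<close>)

lemma reducible_add:
  assumes "p \<in> reducible" "q \<in> reducible"
  shows "p + q \<in> reducible"
proof -
  obtain s t where st: "s \<in> cox_polys" "\<forall>m\<in>keys s. standard m" "p - s \<in> cox_ideal n a"
    "t \<in> cox_polys" "\<forall>m\<in>keys t. standard m" "q - t \<in> cox_ideal n a"
    using assms unfolding reducible_def by blast
  have "p + q - (s + t) \<in> cox_ideal n a"
    using cox_ideal_add[OF st(3,6)] by (simp add: algebra_simps)
  moreover have "\<forall>m\<in>keys (s + t). standard m"
    using st keys_add[of s t] by blast
  ultimately show ?thesis
    using assms st unfolding reducible_def
    by (intro CollectI conjI bexI[of _ "s + t"]) (auto intro: mpoly_carrier_add)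
qed

lemma reducible_scale:
  assumes "p \<in> reducible"
  shows "mconst c * p \<in> reducible"
proof -
  obtain s where s: "s \<in> cox_polys" "\<forall>m\<in>keys s. standard m" "p - s \<in> cox_ideal n a"
    using assms unfolding reducible_def by blast
  have "mconst c * p - mconst c * s \<in> cox_ideal n a"
    using cox_ideal_mult[OF s(3) mpoly_carrier_mconst[of c]] by (simp add: algebra_simps)
  moreover have "\<forall>m\<in>keys (mconst c * s). standard m"
    using s keys_mult[of "mconst c" s] by (force simp: mconst_def split: if_splits)
  moreover have "mconst c * p \<in> cox_polys" "mconst c * s \<in> cox_polys"
    using assms s by (auto simp: reducible_def intro: mpoly_carrier_intros)
  ultimately show ?thesis
    unfolding reducible_def by (intro CollectI conjI bexI[of _ "mconst c * s"])
qed

text \<open>In terms of the length \<open>l\<close> this is \<open>l * (2 * n + 2 - l)\<close>. The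
  constant makes it increasing on all lengths up to n, which the linear relations require: there a
  chord is replaced by a shorter one, and chords to infinity weigh 0.\<close>

definition chord_weight :: "cox_var \<Rightarrow> int" where
  "chord_weight v = (case v of Xvar i \<Rightarrow> 0
     | Zvar i k \<Rightarrow> (int k - int i) * (2 * int n + 2 - (int k - int i)))"

lemma chord_weight_nonneg:
  assumes "keys m \<subseteq> cox_vars n"
  shows "wdeg chord_weight m \<ge> 0"
proof -
  have "chord_weight v \<ge> 0" if "v \<in> cox_vars n" for v
    using that by (auto simp: cox_vars_def chord_weight_def)
  thus ?thesis
    using assms unfolding wdeg_def by (intro sum_nonneg) auto
qed

text \<open>The weight of a chord is strictly concave in its length, so that uncrossing decreases the total weight.\<close>

lemma chord_weight_less:
  assumes "i < j" "j < k" "k \<le> n"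
  shows "chord_weight (Zvar i j) < chord_weight (Zvar i k)"
    and "chord_weight (Zvar j k) < chord_weight (Zvar i k)"
proof -
  have less: "p * (2 * int n + 2 - p) < (p + q) * (2 * int n + 2 - (p + q))"
    if "0 < p" "0 < q" "p + q \<le> int n" for p q :: int
  proof -
    have "0 < q * (2 * int n + 2 - 2 * p - q)"
      using that by (intro mult_pos_pos) auto
    thus ?thesis
      by (simp add: algebra_simps)
  qed
  show "chord_weight (Zvar i j) < chord_weight (Zvar i k)" "chord_weight (Zvar j k) < chord_weight (Zvar i k)"
    using less[of "int j - int i" "int k - int j"] less[of "int k - int j" "int j - int i"] assms
    by (auto simp: chord_weight_def)
qed

text \<open>Both pairs have the same total length, so only the squares of the lengths matter; they
  differ by \<open>2 * (j - i) * (l - k)\<close>.\<close>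

lemma chord_weight_cross:
  assumes "i < j" "j < k" "k < l" "l \<le> n"
  shows "chord_weight (Zvar i l) + chord_weight (Zvar j k) < chord_weight (Zvar i k) + chord_weight (Zvar j l)"
proof -
  have "0 < 2 * (int j - int i) * (int l - int k)"
    using assms by (intro mult_pos_pos) auto
  thus ?thesis
    by (simp add: chord_weight_def algebra_simps)
qed

text \<open>Here \<open>u\<close> is the crossing monomial of a relation, \<open>b\<close> and
  \<open>c\<close> are the two that replace it, and \<open>m0\<close> is the remaining factor of the
  monomial to be rewritten.\<close>

lemma single_reducible_step:
  assumes m0: "keys m0 \<subseteq> cox_vars n"
    and keys: "keys b \<subseteq> cox_vars n" "keys c \<subseteq> cox_vars n"
    and rel: "single u 1 - (single b e + single c e') \<in> cox_ideal n a"
    and red: "single (m0 + b) 1 \<in> reducible" "single (m0 + c) 1 \<in> reducible"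
  shows "single (m0 + u) 1 \<in> reducible"
proof -
  have "single m0 1 * (single u 1 - (single b e + single c e')) \<in> cox_ideal n a"
    using m0 by (intro cox_ideal_mult[OF rel]) (simp add: mpoly_carrier_iff_keys)
  moreover have "mconst e * single (m0 + b) 1 + mconst e' * single (m0 + c) 1 \<in> reducible"
    by (intro reducible_add reducible_scale red)
  ultimately have "single m0 1 * (single u 1 - (single b e + single c e'))
      + (mconst e * single (m0 + b) 1 + mconst e' * single (m0 + c) 1) \<in> reducible"
    by (rule reducible_add[OF reducible_ideal])
  moreover have "single m0 1 * (single u 1 - (single b e + single c e'))
      + (mconst e * single (m0 + b) 1 + mconst e' * single (m0 + c) 1)
      = single (m0 + u) (1 :: complex)"
    by (simp add: right_diff_distrib distrib_left mult_single mconst_def)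
  ultimately show ?thesis
    by simp
qed

lemma keys_add_nat: "keys (m + m') = keys m \<union> keys (m' :: 'b \<Rightarrow>\<^sub>0 nat)"
  by (auto simp: in_keys_iff lookup_add)

text \<open>A monomial that is not standard contains two crossing chords, one of them possibly a
  full power \<open>a j\<close> of \<open>Xvar j\<close>. The matching relation replaces them by
  pairs of smaller total weight.\<close>

lemma single_reducible:
  assumes "keys m \<subseteq> cox_vars n"
  shows "single m 1 \<in> reducible"
  using assms
proof (induction "nat (wdeg chord_weight m)" arbitrary: m rule: less_induct)
  case less
  note keys = less.prems
  have IH: "single m' 1 \<in> reducible"
    if "keys m' \<subseteq> cox_vars n" "wdeg chord_weight m' < wdeg chord_weight m" for m'
    using less.hyps[OF _ that(1)] chord_weight_nonneg[OF that(1)] that(2) by simp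
  consider (std) "standard m"
    | (x) i j k where "i < j" "j < k" "0 < lookup m (Zvar i k)" "a j \<le> lookup m (Xvar j)"
    | (z) i j k l where "i < j" "j < k" "k < l" "0 < lookup m (Zvar i k)" "0 < lookup m (Zvar j l)"
    unfolding standard_def by (meson not_gr_zero not_less)
  thus ?case
  proof cases
    case std
    have "single m 1 - single m 1 \<in> cox_ideal n a"
      by (simp add: cox_ideal_0)
    thus ?thesis
      using std keys unfolding reducible_def
      by (intro CollectI conjI bexI[of _ "single m 1"]) (auto simp: mpoly_carrier_iff_keys)
  next
    case (x i j k)
    hence "Zvar i k \<in> cox_vars n"
      using keys by (auto simp: in_keys_iff)
    hence k: "k \<le> n"
      by (simp add: cox_vars_iff)
    define u where "u = single (Xvar j) (a j) + single (Zvar i k) 1"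
    define b where "b = single (Xvar k) (a k) + single (Zvar i j) (1::nat)"
    define c where "c = single (Xvar i) (a i) + single (Zvar j k) (1::nat)"
    define m0 where "m0 = m - u"
    have mu: "m = m0 + u"
      using x by (intro poly_mapping_eqI)
        (auto simp: m0_def u_def lookup_add lookup_minus lookup_single when_def)
    have "XX j ^ a j * ZZ i k - XX k ^ a k * ZZ i j - XX i ^ a i * ZZ j k \<in> cox_ideal n a"
      using linear_relation[OF x(1,2) k] cox_relations_ideal by (rule subsetD[rotated])
    moreover have "XX j ^ a j * ZZ i k - XX k ^ a k * ZZ i j - XX i ^ a i * ZZ j k
        = single u 1 - (single b 1 + single c 1)"
      unfolding mvar_power by (simp add: mvar_def u_def b_def c_def mult_single diff_diff_eq)
    ultimately have rel: "single u 1 - (single b 1 + single c 1) \<in> cox_ideal n a"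
      by simp
    have m0: "keys m0 \<subseteq> cox_vars n"
      using keys by (auto simp: mu keys_add_nat)
    have bc: "keys b \<subseteq> cox_vars n" "keys c \<subseteq> cox_vars n"
      using x k by (auto simp: b_def c_def keys_add_nat cox_vars_iff split: if_splits)
    have "single (m0 + u) 1 \<in> reducible"
    proof (rule single_reducible_step[OF m0 bc rel])
      show "single (m0 + b) 1 \<in> reducible" "single (m0 + c) 1 \<in> reducible"
        using m0 bc chord_weight_less[OF x(1,2) k]
        by (auto intro!: IH simp: keys_add_nat mu wdeg_add u_def b_def c_def chord_weight_def)
    qed
    thus ?thesis
      by (simp add: mu)
  next
    case (z i j k l)
    hence "Zvar j l \<in> cox_vars n"
      using keys by (auto simp: in_keys_iff)
    hence l: "l \<le> n"
      by (simp add: cox_vars_iff)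
    define u where "u = single (Zvar i k) 1 + single (Zvar j l) (1::nat)"
    define b where "b = single (Zvar i j) 1 + single (Zvar k l) (1::nat)"
    define c where "c = single (Zvar i l) 1 + single (Zvar j k) (1::nat)"
    define m0 where "m0 = m - u"
    have mu: "m = m0 + u"
      using z by (intro poly_mapping_eqI)
        (auto simp: m0_def u_def lookup_add lookup_minus lookup_single when_def)
    have "ZZ i j * ZZ k l - ZZ i k * ZZ j l + ZZ i l * ZZ j k \<in> cox_ideal n a"
      using pluecker_relation[OF z(1-3) l] cox_relations_ideal by (rule subsetD[rotated])
    \<comment> \<open>The crossing product occurs with a negative sign in the Plucker relation;
      \<open>single_reducible_step\<close> expects it with coefficient 1.\<close>
    hence "mconst (- 1) * (ZZ i j * ZZ k l - ZZ i k * ZZ j l + ZZ i l * ZZ j k) \<in> cox_ideal n a"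
      by (rule cox_ideal_mult) (rule mpoly_carrier_mconst)
    moreover have "mconst (- 1) * (ZZ i j * ZZ k l - ZZ i k * ZZ j l + ZZ i l * ZZ j k)
        = single u 1 - (single b 1 + single c 1)"
      by (simp add: mvar_def u_def b_def c_def mult_single mconst_def single_uminus algebra_simps)
    ultimately have rel: "single u 1 - (single b 1 + single c 1) \<in> cox_ideal n a"
      by simp
    have m0: "keys m0 \<subseteq> cox_vars n"
      using keys by (auto simp: mu keys_add_nat)
    have bc: "keys b \<subseteq> cox_vars n" "keys c \<subseteq> cox_vars n"
      using z l by (auto simp: b_def c_def keys_add_nat cox_vars_iff split: if_splits)
    have "single (m0 + u) 1 \<in> reducible"
    proof (rule single_reducible_step[OF m0 bc rel])
      show "single (m0 + b) 1 \<in> reducible" "single (m0 + c) 1 \<in> reducible"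
        using m0 bc chord_weight_less[of i j k] chord_weight_less[of j k l] chord_weight_cross[OF z(1-3) l] z(1-3) l
        by (auto intro!: IH simp: keys_add_nat mu wdeg_add u_def b_def c_def)
    qed
    thus ?thesis
      by (simp add: mu)
  qed
qed

lemma straightening:
  assumes "q \<in> cox_polys"
  obtains s where "s \<in> cox_polys" "\<And>m. m \<in> keys s \<Longrightarrow> standard m" "q - s \<in> cox_ideal n a"
proof -
  have "(\<Sum>m\<in>I. single m (lookup q m)) \<in> reducible"
    if "finite I" "I \<subseteq> keys q" for I
    using that
  proof (induction I rule: finite_induct)
    case empty
    show ?case
      by (simp add: reducible_ideal cox_ideal_0)
  next
    case (insert m I)
    have "mconst (lookup q m) * single m 1 \<in> reducible"
      using assms insert.prems by (intro reducible_scale single_reducible) (auto simp: mpoly_carrier_def)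
    hence "single m (lookup q m) \<in> reducible"
      by (simp add: mconst_def mult_single)
    thus ?case
      using insert by (simp add: reducible_add)
  qed
  from this[of "keys q"] have "q \<in> reducible"
    by (simp add: poly_mapping_sum_single)
  thus ?thesis
    using that unfolding reducible_def by blast
qed

section \<open>Linear independence of the standard monomials\<close>

lemma present_var_simps: "present_var (Xvar i) = x i" "present_var (Zvar j k) = minor j k"
  by (simp_all add: present_var_def)

text \<open>Restricting to the hyperplane of index \<open>l\<close> and moving chords leads from
  \<open>vars_from l\<close> to \<open>vars_from (Suc l)\<close>, so independence is shown by
  downward induction on \<open>l\<close>.\<close>

definition vars_from :: "nat \<Rightarrow> cox_var set" where
  "vars_from l = {Xvar i | i. l \<le> i \<and> i \<le> n} \<union> {Zvar j k | j k. l \<le> j \<and> j < k \<and> k \<le> n}"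

lemma vars_from_iff:
  "Xvar i \<in> vars_from l \<longleftrightarrow> l \<le> i \<and> i \<le> n" "Zvar j k \<in> vars_from l \<longleftrightarrow> l \<le> j \<and> j < k \<and> k \<le> n"
  by (auto simp: vars_from_def)

lemma vars_from_0: "vars_from 0 = cox_vars n"
  by (auto simp: vars_from_def cox_vars_def)

definition standard_independent :: "nat \<Rightarrow> bool" where
  "standard_independent l \<longleftrightarrow> (\<forall>p\<in>mpoly_carrier (vars_from l).
     (\<forall>m\<in>keys p. standard m) \<longrightarrow> present p = 0 \<longrightarrow> p = 0)"

definition drop_x :: "nat \<Rightarrow> nat \<Rightarrow> (nat, complex) mpoly" where
  "drop_x l v = (if v = l then 0 else mvar v)"

text \<open>
  On the hyperplane \<open>x\<^sub>l = 0\<close> the variable \<open>Zvar l k\<close> becomes \<open>- y\<^sub>l x\<^sub>k^a\<^sub>k\<close>; the chord from l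
  to k is moved to the chord from k to infinity, which preserves standardness.
\<close>

definition move :: "nat \<Rightarrow> (cox_var \<Rightarrow>\<^sub>0 nat) \<Rightarrow> cox_var \<Rightarrow>\<^sub>0 nat" where
  "move l m = Abs_poly_mapping (\<lambda>v. case v of
      Xvar k \<Rightarrow> lookup m (Xvar k) + a k * lookup m (Zvar l k)
    | Zvar j k \<Rightarrow> if j = l then 0 else lookup m (Zvar j k))"

text \<open>Every moved chord leaves a factor \<open>- y l\<close>; their number is the information
  that \<open>move\<close> itself forgets.\<close>

definition moved :: "nat \<Rightarrow> (cox_var \<Rightarrow>\<^sub>0 nat) \<Rightarrow> nat" where
  "moved l m = (\<Sum>k\<le>n. lookup m (Zvar l k))"

lemma lookup_move:
  "lookup (move l m) v = (case v of
      Xvar k \<Rightarrow> lookup m (Xvar k) + a k * lookup m (Zvar l k)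
    | Zvar j k \<Rightarrow> if j = l then 0 else lookup m (Zvar j k))" (is "_ = ?f v")
proof -
  have "finite (keys m \<union> Xvar ` (Zvar l -` keys m))"
    by (intro finite_UnI finite_imageI finite_vimageI) (auto intro: injI)
  moreover have "{v. ?f v \<noteq> 0} \<subseteq> keys m \<union> Xvar ` (Zvar l -` keys m)"
  proof
    fix v assume "v \<in> {v. ?f v \<noteq> 0}"
    thus "v \<in> keys m \<union> Xvar ` (Zvar l -` keys m)"
      by (cases v) (auto simp: in_keys_iff split: if_splits)
  qed
  ultimately have "finite {v. ?f v \<noteq> 0}"
    by (rule finite_subset[rotated])
  thus ?thesis
    unfolding move_def by simp
qed

lemma move_0: "move l 0 = 0"
  by (rule poly_mapping_eqI) (simp add: lookup_move split: cox_var.splits)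

lemma move_add: "move l (m + m') = move l m + move l m'"
  by (rule poly_mapping_eqI) (simp add: lookup_move lookup_add algebra_simps split: cox_var.splits)

lemma moved_0: "moved l 0 = 0"
  by (simp add: moved_def)

lemma moved_add: "moved l (m + m') = moved l m + moved l m'"
  by (simp add: moved_def lookup_add sum.distrib)

lemma move_single:
  assumes "v \<in> vars_from l - {Xvar l}" "l \<le> n"
  shows "subst (drop_x l) (present_var v)
    = (- y l) ^ moved l (single v 1) * mon_eval present_var (move l (single v 1))"
proof (cases v)
  case (Xvar i)
  hence i: "l < i" "i \<le> n"
    using assms by (auto simp: vars_from_iff)
  have "move l (single v 1) = single (Xvar i) 1"
    using Xvar by (intro poly_mapping_eqI)
      (auto simp: lookup_move lookup_single when_def split: cox_var.splits)
  moreover have "moved l (single v 1) = 0"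
    using Xvar by (simp add: moved_def lookup_single)
  ultimately show ?thesis
    using i Xvar by (simp add: present_var_simps mon_eval_single subst_simps drop_x_def)
next
  case (Zvar j k)
  hence jk: "l \<le> j" "j < k" "k \<le> n"
    using assms by (auto simp: vars_from_iff)
  show ?thesis
  proof (cases "j = l")
    case True
    have "move l (single v 1) = single (Xvar k) (a k)"
      using Zvar True by (intro poly_mapping_eqI)
        (auto simp: lookup_move lookup_single when_def split: cox_var.splits)
    moreover have "moved l (single v 1) = 1"
      using Zvar True jk by (simp add: moved_def lookup_single when_def)
    \<comment> \<open>Positivity of \<open>a l\<close> is what makes the term with
      \<open>x l ^ a l\<close> vanish.\<close>
    moreover have "subst (drop_x l) (minor l k) = - y l * x k ^ a k"
      using jk True a_pos[of l] by (simp add: minor_def subst_simps drop_x_def zero_power)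
    ultimately show ?thesis
      using Zvar True by (simp add: present_var_simps mon_eval_single)
  next
    case False
    have "move l (single v 1) = single (Zvar j k) 1"
      using Zvar False by (intro poly_mapping_eqI)
        (auto simp: lookup_move lookup_single when_def split: cox_var.splits)
    moreover have "moved l (single v 1) = 0"
      using Zvar False by (simp add: moved_def lookup_single when_def)
    moreover have "subst (drop_x l) (minor j k) = minor j k"
      using jk False assms(2) by (simp add: minor_def subst_simps drop_x_def)
    ultimately show ?thesis
      using Zvar by (simp add: present_var_simps mon_eval_single)
  qed
qed

lemma drop_x_present_mon:
  assumes "keys m \<subseteq> vars_from l - {Xvar l}" "l \<le> n"
  shows "subst (drop_x l) (mon_eval present_var m) = (- y l) ^ moved l m * mon_eval present_var (move l m)"
  using assms(1)
proof (induction rule: mon_induct)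
  case zero
  thus ?case
    by (simp add: mon_eval_0 move_0 moved_0 subst_simps)
next
  case (add m v)
  show ?case
    using add.IH move_single[OF add.hyps(2) assms(2)]
    by (simp add: mon_eval_add move_add moved_add mon_eval_single subst_simps power_add)
qed

text \<open>A new chord from \<open>j\<close> to infinity comes from a chord from \<open>l\<close>
  to \<open>j\<close>. If it crossed a chord from \<open>i\<close> to \<open>k\<close> with l < i <
  j < k, the old chord would already have crossed it.\<close>

lemma standard_move:
  assumes m: "standard m" "keys m \<subseteq> vars_from l - {Xvar l}"
  shows "standard (move l m)" "keys (move l m) \<subseteq> vars_from (Suc l)"
proof -
  have from_l: "l \<le> j \<and> j < k \<and> k \<le> n" if "0 < lookup m (Zvar j k)" for j k
  proof -
    have "Zvar j k \<in> vars_from l"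
      using that subsetD[OF m(2), of "Zvar j k"] by (simp add: in_keys_iff)
    thus ?thesis
      by (simp add: vars_from_iff)
  qed
  have from_lX: "l < i \<and> i \<le> n" if "0 < lookup m (Xvar i)" for i
  proof -
    have "Xvar i \<in> vars_from l" "i \<noteq> l"
      using that subsetD[OF m(2), of "Xvar i"] by (auto simp: in_keys_iff)
    thus ?thesis
      by (simp add: vars_from_iff)
  qed
  show "keys (move l m) \<subseteq> vars_from (Suc l)"
  proof
    fix v assume "v \<in> keys (move l m)"
    hence pos: "0 < lookup (move l m) v"
      by (simp add: in_keys_iff)
    show "v \<in> vars_from (Suc l)"
    proof (cases v)
      case (Xvar i)
      hence "0 < lookup m (Xvar i) \<or> 0 < lookup m (Zvar l i)"
        using pos by (auto simp: lookup_move)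
      thus ?thesis
        using from_l[of l i] from_lX[of i] Xvar by (auto simp: vars_from_iff)
    next
      case (Zvar j k)
      hence "j \<noteq> l" "0 < lookup m (Zvar j k)"
        using pos by (auto simp: lookup_move split: if_splits)
      thus ?thesis
        using from_l[of j k] Zvar by (auto simp: vars_from_iff)
    qed
  qed
  show "standard (move l m)"
    unfolding standard_def
  proof (intro conjI allI impI)
    fix i j k assume ijk: "i < j" "j < k" "0 < lookup (move l m) (Zvar i k)"
    hence i: "i \<noteq> l" "0 < lookup m (Zvar i k)"
      by (auto simp: lookup_move split: if_splits)
    hence "l < i"
      using from_l[OF i(2)] by simp
    \<comment> \<open>So the exponent of \<open>Xvar j\<close> is unchanged under
      \<open>move\<close> and stays below \<open>a j\<close>.\<close>
    hence "lookup m (Zvar l j) = 0"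
      using m(1) ijk(1,2) i(2) unfolding standard_def by (metis gr0I)
    moreover have "lookup m (Xvar j) < a j"
      using m(1) ijk(1,2) i(2) unfolding standard_def by blast
    ultimately show "lookup (move l m) (Xvar j) < a j"
      by (simp add: lookup_move)
  next
    fix i j k l' assume *: "i < j" "j < k" "k < l'" "0 < lookup (move l m) (Zvar i k)"
    hence "0 < lookup m (Zvar i k)"
      by (auto simp: lookup_move split: if_splits)
    hence "lookup m (Zvar j l') = 0"
      using m(1) *(1-3) unfolding standard_def by blast
    thus "lookup (move l m) (Zvar j l') = 0"
      by (simp add: lookup_move)
  qed
qed

text \<open>At the first \<open>k\<close> where the exponents of \<open>Zvar l k\<close> differ, the
  monomial with the smaller one must contain a full power \<open>a k\<close> of
  \<open>Xvar k\<close> to have the same image. Standardness then forbids it all longer chords from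
  \<open>l\<close>, so fewer chords are moved in it.\<close>

lemma move_inj:
  assumes m: "standard m" "keys m \<subseteq> vars_from l - {Xvar l}"
    and m': "standard m'" "keys m' \<subseteq> vars_from l - {Xvar l}"
    and eq: "move l m = move l m'" "moved l m = moved l m'"
  shows "m = m'"
proof -
  have absurd: False
    if st: "standard m" "keys m \<subseteq> vars_from l - {Xvar l}" "keys m' \<subseteq> vars_from l - {Xvar l}"
      and eq: "move l m = move l m'" "moved l m = moved l m'"
      and k: "\<And>i. i < k \<Longrightarrow> lookup m (Zvar l i) = lookup m' (Zvar l i)"
        "lookup m (Zvar l k) < lookup m' (Zvar l k)" for m m' k
  proof -
    have "Zvar l k \<in> keys m'"
      using k(2) by (simp add: in_keys_iff)
    hence "Zvar l k \<in> vars_from l"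
      using st(3) by auto
    hence lk: "l < k" "k \<le> n"
      by (simp_all add: vars_from_iff)
    have "lookup m (Xvar k) + a k * lookup m (Zvar l k)
        = lookup m' (Xvar k) + a k * lookup m' (Zvar l k)"
      using arg_cong[OF eq(1), of "\<lambda>b. lookup b (Xvar k)"] by (simp add: lookup_move)
    \<comment> \<open>One chord less is made up for by at least \<open>a k\<close> in the exponent
      of \<open>Xvar k\<close>.\<close>
    moreover have "a k * Suc (lookup m (Zvar l k)) \<le> a k * lookup m' (Zvar l k)"
      using k(2) by (intro mult_le_mono) auto
    ultimately have "a k \<le> lookup m (Xvar k)"
      by simp
    hence zero: "lookup m (Zvar l i) = 0" if "k < i" for i
      using st(1) lk(1) that unfolding standard_def by (metis gr0I not_less)
    have "moved l m < moved l m'"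
      unfolding moved_def
    proof (rule sum_strict_mono_ex1)
      show "\<forall>i\<in>{..n}. lookup m (Zvar l i) \<le> lookup m' (Zvar l i)"
      proof
        fix i show "lookup m (Zvar l i) \<le> lookup m' (Zvar l i)"
          using k zero[of i] by (cases i k rule: linorder_cases) auto
      qed
      show "\<exists>i\<in>{..n}. lookup m (Zvar l i) < lookup m' (Zvar l i)"
        using k(2) lk(2) by blast
    qed simp
    thus False
      using eq(2) by simp
  qed
  have z: "lookup m (Zvar l k) = lookup m' (Zvar l k)" for k
  proof (induction k rule: less_induct)
    case (less k)
    show ?case
      using absurd[OF m m'(2) eq, of k] absurd[OF m' m(2) eq[symmetric], of k] less
      by (metis linorder_neqE_nat)
  qed
  show ?thesis
  proof (rule poly_mapping_eqI)
    fix v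
    have *: "lookup (move l m) v = lookup (move l m') v"
      by (simp add: eq)
    show "lookup m v = lookup m' v"
      using * z by (cases v) (auto simp: lookup_move split: if_splits)
  qed
qed

text \<open>The restriction splits according to the degree in \<open>y l\<close>. Each part is a
  power of \<open>- y l\<close> times the image of a standard combination from
  \<open>vars_from (Suc l)\<close>, so it vanishes only with that combination; by
  \<open>move_inj\<close> no two terms of \<open>p\<close> have merged there.\<close>

lemma standard_drop_x:
  assumes "l \<le> n" "standard_independent (Suc l)"
    and p: "p \<in> mpoly_carrier (vars_from l)" "\<And>m. m \<in> keys p \<Longrightarrow> standard m"
      "\<And>m. m \<in> keys p \<Longrightarrow> lookup m (Xvar l) = 0"
    and 0: "subst (drop_x l) (present p) = 0"
  shows "p = 0"
proof (rule ccontr)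
  assume "p \<noteq> 0"
  let ?K = "keys p"
  let ?c = "lookup p"
  have keys: "keys m \<subseteq> vars_from l - {Xvar l}" if "m \<in> ?K" for m
    using p(1) p(3)[OF that] that by (auto simp: mpoly_carrier_def in_keys_iff)
  \<comment> \<open>The terms that contribute the factor \<open>(- y l) ^ r\<close>, with their
    chords from \<open>l\<close> already moved.\<close>
  define q where "q r = (\<Sum>m\<in>{m\<in>?K. moved l m = r}. single (move l m) (?c m))" for r
  have q_keys: "\<exists>m'\<in>?K. m = move l m'" if "m \<in> keys (q r)" for m r
    using that keys_sum[of "\<lambda>m. single (move l m) (?c m)" "{m\<in>?K. moved l m = r}"]
    unfolding q_def by (fastforce split: if_splits)
  have q: "q r \<in> mpoly_carrier (vars_from (Suc l))" "\<forall>m\<in>keys (q r). standard m" for r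
    using q_keys[of _ r] standard_move[OF p(2) keys] by (fastforce simp: mpoly_carrier_def)+
  have "subst (drop_x l) (present p) = (\<Sum>m\<in>?K. mconst (?c m) * subst (drop_x l) (mon_eval present_var m))"
    by (simp add: mpoly_eval_def[of mconst present_var] pm_eval_def is_hom_sum[OF is_hom_subst] subst_simps)
  also have "\<dots> = (\<Sum>m\<in>?K. (- y l) ^ moved l m * present (single (move l m) (?c m)))"
    by (intro sum.cong refl) (simp add: drop_x_present_mon[OF keys assms(1)] subst_single algebra_simps)
  also have "\<dots> = (\<Sum>r\<in>moved l ` ?K. \<Sum>m\<in>{m\<in>?K. moved l m = r}.
      (- y l) ^ moved l m * present (single (move l m) (?c m)))"
    by (rule sum.image_gen) simp
  also have "\<dots> = (\<Sum>r\<in>moved l ` ?K. (- y l) ^ r * present (q r))"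
    by (intro sum.cong refl) (simp add: q_def is_hom_sum[OF is_hom_subst] sum_distrib_left)
  finally have sum0: "(\<Sum>r\<in>moved l ` ?K. (- y l) ^ r * present (q r)) = 0"
    using 0 by simp
  \<comment> \<open>The degree in \<open>y l\<close>. No variable of
    \<open>vars_from (Suc l)\<close> has an image involving \<open>y l\<close>, so the exponent of
    \<open>- y l\<close> is the whole degree.\<close>
  let ?w = "\<lambda>u. if u = n + 1 + l then 1 else 0 :: int"
  have "present (q r) \<in> mpoly_carrier (- {n + 1 + l})" for r
  proof (rule mpoly_carrier_subst[OF q(1)])
    fix v assume "v \<in> vars_from (Suc l)"
    thus "present_var v \<in> mpoly_carrier (- {n + 1 + l})"
      by (cases v) (auto simp: present_var_def minor_def vars_from_iff intro!: mpoly_carrier_intros)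
  qed
  hence "whom ?w 0 (present (q r))" for r
    by (auto simp: mpoly_carrier_iff_whom)
  moreover have "whom ?w (int r * 1) ((- y l) ^ r)" for r
    by (intro whom_power whom_uminus whom_mvar) simp
  ultimately have w: "whom ?w (int r) ((- y l) ^ r * present (q r))" for r
    using whom_mult[of ?w "int r * 1" "(- y l) ^ r" 0 "present (q r)"] by simp
  obtain m where m: "m \<in> ?K"
    using \<open>p \<noteq> 0\<close> by (metis all_not_in_conv keys_eq_empty)
  have "(- y l) ^ moved l m * present (q (moved l m)) = 0"
  proof (rule homogeneous_sum_eq_0[OF _ _ _ sum0])
    show "inj_on int (moved l ` ?K)"
      by simp
    show "wdeg ?w m' = int r" if "m' \<in> keys ((- y l) ^ r * present (q r))" for r m'
      using w[of r] that by (auto simp: whom_def)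
  qed (use m in auto)
  hence "present (q (moved l m)) = 0"
    by (simp add: mvar_neq_0)
  hence "q (moved l m) = 0"
    using assms(2) q unfolding standard_independent_def by blast
  hence "0 = lookup (q (moved l m)) (move l m)"
    by simp
  \<comment> \<open>Injectivity for a fixed number of moved chords leaves a single term.\<close>
  also have "\<dots> = (\<Sum>m'\<in>{m'\<in>?K. moved l m' = moved l m}. if m' = m then ?c m else 0)"
    unfolding q_def lookup_sum
    by (intro sum.cong refl)
      (use move_inj[OF p(2) keys p(2) keys] m in \<open>auto simp: lookup_single when_def\<close>)
  also have "\<dots> = ?c m"
    using m by simp
  finally show False
    using m by (simp add: in_keys_iff)
qed

lemma split_x:
  fixes p :: "(cox_var, complex) mpoly"
  obtains p0 p1 where "p = p0 + XX l * p1"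
    "\<And>m. m \<in> keys p0 \<Longrightarrow> m \<in> keys p \<and> lookup m (Xvar l) = 0"
    "\<And>m. m \<in> keys p1 \<Longrightarrow> m + single (Xvar l) 1 \<in> keys p"
proof
  let ?K = "keys p"
  let ?c = "lookup p"
  let ?e = "single (Xvar l) (1::nat)"
  let ?Zs = "{m\<in>?K. lookup m (Xvar l) = 0}"
  let ?Ps = "{m\<in>?K. lookup m (Xvar l) \<noteq> 0}"
  define p0 where "p0 = (\<Sum>m\<in>?Zs. single m (?c m))"
  define p1 where "p1 = (\<Sum>m\<in>?Ps. single (m - ?e) (?c m))"
  have e: "m - ?e + ?e = m" if "m \<in> ?Ps" for m
    using that by (intro poly_mapping_eqI) (auto simp: lookup_add lookup_minus lookup_single when_def)
  have "p = (\<Sum>m\<in>?K. single m (?c m))"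
    by (rule poly_mapping_sum_single[symmetric])
  also have "\<dots> = (\<Sum>m\<in>?Zs \<union> ?Ps. single m (?c m))"
    by (rule sum.cong) auto
  also have "\<dots> = p0 + (\<Sum>m\<in>?Ps. single m (?c m))"
    unfolding p0_def by (rule sum.union_disjoint) auto
  also have "(\<Sum>m\<in>?Ps. single m (?c m)) = (\<Sum>m\<in>?Ps. XX l * single (m - ?e) (?c m))"
  proof (rule sum.cong[OF refl])
    fix m assume "m \<in> ?Ps"
    from e[OF this] show "single m (?c m) = XX l * single (m - ?e) (?c m)"
      by (simp add: mvar_def mult_single add.commute)
  qed
  finally show "p = p0 + XX l * p1"
    by (simp add: p1_def sum_distrib_left)
  show "m \<in> ?K \<and> lookup m (Xvar l) = 0" if "m \<in> keys p0" for m
    using that keys_sum[of "\<lambda>m. single m (?c m)" ?Zs]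
    unfolding p0_def by (fastforce split: if_splits)
  show "m + ?e \<in> ?K" if m: "m \<in> keys p1" for m
  proof -
    obtain m' where m': "m' \<in> ?Ps" "m \<in> keys (single (m' - ?e) (?c m'))"
      using m keys_sum[of "\<lambda>m. single (m - ?e) (?c m)" ?Ps] unfolding p1_def by blast
    hence "m = m' - ?e"
      by (simp split: if_splits)
    thus ?thesis
      using e[OF m'(1)] m'(1) by simp
  qed
qed

lemma standard_sub:
  assumes "standard (m + m')"
  shows "standard m"
proof -
  have le: "lookup m v \<le> lookup (m + m') v" for v
    by (simp add: lookup_add)
  show ?thesis
    unfolding standard_def
  proof (intro conjI allI impI)
    fix i j k assume *: "i < j" "j < k" "0 < lookup m (Zvar i k)"
    hence "lookup (m + m') (Xvar j) < a j"
      using assms less_le_trans[OF *(3) le] unfolding standard_def by blast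
    thus "lookup m (Xvar j) < a j"
      by (rule le_less_trans[OF le])
  next
    fix i j k l assume *: "i < j" "j < k" "k < l" "0 < lookup m (Zvar i k)"
    hence "lookup (m + m') (Zvar j l) = 0"
      using assms less_le_trans[OF *(4) le] unfolding standard_def by blast
    thus "lookup m (Zvar j l) = 0"
      using le[of "Zvar j l"] by simp
  qed
qed

text \<open>The part of \<open>p\<close> free of \<open>Xvar l\<close> has the same restriction as
  \<open>p\<close>, hence is 0. Divisibility of the image by \<open>x l\<close> is thus visible on
  the formal standard combination; both independence and saturation rest on this.\<close>

lemma standard_split:
  assumes l: "l \<le> n" "standard_independent (Suc l)"
    and p: "p \<in> mpoly_carrier (vars_from l)" "\<And>m. m \<in> keys p \<Longrightarrow> standard m"
    and 0: "subst (drop_x l) (present p) = 0"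
  obtains p1 where "p = XX l * p1" "p1 \<in> mpoly_carrier (vars_from l)"
    "\<And>m. m \<in> keys p1 \<Longrightarrow> standard m"
    "\<And>m. m \<in> keys p1 \<Longrightarrow> m + single (Xvar l) 1 \<in> keys p"
proof -
  obtain p0 p1 where s: "p = p0 + XX l * p1"
    "\<And>m. m \<in> keys p0 \<Longrightarrow> m \<in> keys p \<and> lookup m (Xvar l) = 0"
    "\<And>m. m \<in> keys p1 \<Longrightarrow> m + single (Xvar l) 1 \<in> keys p"
    using split_x by blast
  have p0: "p0 \<in> mpoly_carrier (vars_from l)"
    using p(1) s(2) by (fastforce simp: mpoly_carrier_def)
  have "subst (drop_x l) (present p0) = 0"
    using 0 unfolding s(1) by (simp add: subst_simps present_var_simps drop_x_def)
  hence "p0 = 0"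
    using standard_drop_x[OF l p0] p(2) s(2) by blast
  moreover have "p1 \<in> mpoly_carrier (vars_from l)"
    unfolding mpoly_carrier_def
  proof (intro CollectI ballI)
    fix m assume "m \<in> keys p1"
    hence "keys (m + single (Xvar l) 1) \<subseteq> vars_from l"
      using p(1) s(3) unfolding mpoly_carrier_def by blast
    thus "keys m \<subseteq> vars_from l"
      by (simp add: keys_add_nat)
  qed
  moreover have "standard m" if "m \<in> keys p1" for m
    using standard_sub[OF p(2)[OF s(3)[OF that]]] .
  ultimately show ?thesis
    using that s(1,3) by simp
qed

text \<open>A relation restricts to 0 on the hyperplane, so \<open>XX l\<close> can be cancelled
  from it; a bound on the exponents of \<open>Xvar l\<close> ends the process.\<close>

lemma standard_independent_step:
  assumes "l \<le> n" "standard_independent (Suc l)"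
  shows "standard_independent l"
  unfolding standard_independent_def
proof (intro ballI impI)
  fix p assume p: "p \<in> mpoly_carrier (vars_from l)" "\<forall>m\<in>keys p. standard m" "present p = 0"
  obtain N where "\<forall>m\<in>keys p. lookup m (Xvar l) < N"
    using finite_nat_set_iff_bounded[of "(\<lambda>m. lookup m (Xvar l)) ` keys p"] by auto
  thus "p = 0"
    using p
  proof (induction N arbitrary: p)
    case 0
    hence "keys p = {}"
      by auto
    thus ?case
      by simp
  next
    case (Suc N)
    have 0: "subst (drop_x l) (present p) = 0"
      using Suc.prems(4) by (simp add: subst_simps)
    obtain p1 where p1: "p = XX l * p1" "p1 \<in> mpoly_carrier (vars_from l)"
      "\<And>m. m \<in> keys p1 \<Longrightarrow> standard m"
      "\<And>m. m \<in> keys p1 \<Longrightarrow> m + single (Xvar l) 1 \<in> keys p"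
      using standard_split[OF assms Suc.prems(2) _ 0] Suc.prems(3) by blast
    have "x l * present p1 = 0"
      using Suc.prems(4) unfolding p1(1) by (simp add: subst_simps present_var_simps)
    hence "present p1 = 0"
      by (simp add: mvar_neq_0)
    moreover have "\<forall>m\<in>keys p1. lookup m (Xvar l) < N"
      using Suc.prems(1) p1(4) by (fastforce simp: lookup_add)
    ultimately have "p1 = 0"
      using Suc.IH p1 by blast
    thus ?case
      using p1(1) by simp
  qed
qed

lemma standard_independent:
  assumes "l \<le> Suc n"
  shows "standard_independent l"
  using assms
proof (induction rule: inc_induct)
  case base
  have empty: "vars_from (Suc n) = {}"
    by (auto simp: vars_from_def)
  show ?case
    unfolding standard_independent_def
  proof (intro ballI impI)
    fix p assume p: "p \<in> mpoly_carrier (vars_from (Suc n))" "present p = 0"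
    have c: "p = mconst (lookup p 0)"
    proof (rule poly_mapping_eqI)
      fix m
      have "m = 0" if "m \<in> keys p"
        using p(1) that by (auto simp: mpoly_carrier_def empty)
      thus "lookup p m = lookup (mconst (lookup p 0)) m"
        by (auto simp: mconst_def lookup_single when_def in_keys_iff)
    qed
    have "mconst (lookup p 0) = (0 :: (nat, complex) mpoly)"
      using p(2) by (subst (asm) c) (simp add: subst_mconst)
    hence "lookup p 0 = 0"
      by (metis mconst_def lookup_single_eq lookup_zero)
    thus "p = 0"
      using c by (simp add: mconst_def)
  qed
next
  case (step l)
  thus ?case
    using standard_independent_step by simp
qed

text \<open>Straightening changes \<open>q\<close> only by the ideal, and a standard remainder with
  image 0 vanishes by independence at \<open>l = 0\<close>.\<close>

theorem present_eq_0_iff: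
  assumes "q \<in> cox_polys"
  shows "present q = 0 \<longleftrightarrow> q \<in> cox_ideal n a"
proof
  assume 0: "present q = 0"
  obtain s where s: "s \<in> cox_polys" "\<And>m. m \<in> keys s \<Longrightarrow> standard m" "q - s \<in> cox_ideal n a"
    using straightening[OF assms] by blast
  have "present s = 0"
    using 0 present_cox_ideal[OF s(3)] by (simp add: subst_simps)
  hence "s = 0"
    using standard_independent[of 0] s(1,2) unfolding standard_independent_def vars_from_0 by blast
  thus "q \<in> cox_ideal n a"
    using s(3) by simp
qed (rule present_cox_ideal)

section \<open>The presented subring contains every homogeneous invariant\<close>

definition presented :: "(nat, complex) mpoly set" where
  "presented = present ` cox_polys"

text \<open>The standard preimage of \<open>x 0 * F\<close> restricts to 0 on the hyperplane, so it
  is formally divisible by \<open>XX 0\<close>; the quotient presents \<open>F\<close>.\<close>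

lemma presented_saturated:
  assumes "x 0 * F \<in> presented"
  shows "F \<in> presented"
proof -
  obtain q where q: "q \<in> cox_polys" "present q = x 0 * F"
    using assms unfolding presented_def by force
  obtain s where s: "s \<in> cox_polys" "\<And>m. m \<in> keys s \<Longrightarrow> standard m" "q - s \<in> cox_ideal n a"
    using straightening[OF q(1)] by blast
  have ps: "present s = x 0 * F"
    using q(2) present_cox_ideal[OF s(3)] by (simp add: subst_simps)
  have 0: "subst (drop_x 0) (present s) = 0"
    unfolding ps by (simp add: subst_simps drop_x_def)
  obtain p1 where p1: "s = XX 0 * p1" "p1 \<in> mpoly_carrier (vars_from 0)"
    using standard_split[OF _ _ _ s(2) 0] standard_independent[of 1] s(1) vars_from_0 by auto
  have "x 0 * present p1 = x 0 * F"
    using ps unfolding p1(1) by (simp add: subst_simps present_var_simps)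
  hence "F = present p1"
    by (simp add: mvar_neq_0)
  thus ?thesis
    using p1(2) unfolding presented_def vars_from_0 by blast
qed

lemma presented_minors: "F \<in> xy_polys \<Longrightarrow> subst (minors 0) F \<in> presented"
proof (rule mpoly_eval_closed)
  have "present 0 \<in> presented" "present 1 \<in> presented"
    unfolding presented_def by (auto intro: mpoly_carrier_intros)
  thus "0 \<in> presented" "1 \<in> presented"
    by (simp_all add: subst_simps)
  show "p + q \<in> presented" "p * q \<in> presented" if "p \<in> presented" "q \<in> presented" for p q
  proof -
    obtain p' q' where *: "p = present p'" "q = present q'" "p' \<in> cox_polys" "q' \<in> cox_polys"
      using \<open>p \<in> presented\<close> \<open>q \<in> presented\<close> unfolding presented_def by blast
    hence "p + q = present (p' + q')" "p * q = present (p' * q')"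
      by (simp_all add: subst_simps)
    thus "p + q \<in> presented" "p * q \<in> presented"
      unfolding presented_def using * mpoly_carrier_add mpoly_carrier_mult by blast+
  qed
  show "mconst c \<in> presented" for c
  proof -
    have "present (mconst c) \<in> presented"
      unfolding presented_def by (intro imageI mpoly_carrier_mconst)
    thus ?thesis
      by (simp add: subst_mconst)
  qed
  fix v assume v: "v \<in> {..2 * n + 1}"
  show "minors 0 v \<in> presented"
  proof (cases "is_y v \<and> v - n - 1 \<noteq> 0")
    case True
    have "present (ZZ 0 (v - n - 1)) \<in> presented"
      unfolding presented_def using True by (intro imageI mpoly_carrier_mvar) (auto simp: cox_vars_iff)
    thus ?thesis
      using True by (simp add: minors_def subst_simps present_var_simps)
  next
    case False
    have "present (XX v) \<in> presented" if "v \<le> n"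
      unfolding presented_def using that by (intro imageI mpoly_carrier_mvar) (auto simp: cox_vars_iff)
    thus ?thesis
      using False v \<open>0 \<in> presented\<close> by (auto simp: minors_def subst_simps present_var_simps minor_self)
  qed
qed

theorem sections_presented:
  assumes "F \<in> sections d k"
  shows "\<exists>q\<in>cox_polys. present q = F"
proof -
  have "F \<in> presented"
  proof (cases "F = 0")
    case True
    thus ?thesis
      using presented_minors[OF mpoly_carrier_0] by (simp add: subst_simps)
  next
    case False
    hence "k = int (nat k)"
      using sections_nonneg[OF assms] by simp
    hence "F \<in> sections d (int (nat k))"
      using assms by simp
    hence "x 0 ^ (a 0 * nat k) * F = subst (minors 0) F"
      by (rule sections_minors) simp
    moreover have "F \<in> xy_polys"
      using assms by (simp add: sections_def invariants_def)
    ultimately have "x 0 ^ (a 0 * nat k) * F \<in> presented"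
      using presented_minors by simp
    moreover have "F \<in> presented" if "x 0 ^ e * F \<in> presented" for e
      using that by (induction e) (auto simp: mult.assoc intro: presented_saturated)
    ultimately show ?thesis
      by blast
  qed
  thus ?thesis
    unfolding presented_def by blast
qed

end

section \<open>Homogeneous fractions\<close>

text \<open>A divisor of \<open>mvar u\<close> involves no other variable. Setting \<open>v\<close>
  to 1 therefore keeps \<open>p\<close> and turns \<open>mvar v\<close> into 1, making
  \<open>p\<close> a unit.\<close>

lemma prime_dvd_two_vars:
  fixes p :: "(nat, 'a::field) mpoly"
  assumes "prime_elem p" "p dvd mvar u" "p dvd mvar v"
  shows "u = v"
proof (rule ccontr)
  assume "u \<noteq> v"
  obtain q r where q: "mvar u = p * q" and r: "mvar v = p * r"
    using assms(2,3) by (auto elim!: dvdE)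
  have "p * q \<in> mpoly_carrier {u}"
    unfolding q[symmetric] by (simp add: mpoly_carrier_mvar)
  moreover have "p \<noteq> 0" "q \<noteq> 0"
    using q mvar_neq_0[of u] by force+
  ultimately have "p \<in> mpoly_carrier {u}"
    by (rule mpoly_carrier_factor)
  hence "subst (\<lambda>w. if w = v then 1 else mvar w) p = p"
    by (rule subst_fix) (use \<open>u \<noteq> v\<close> in auto)
  hence "1 = p * subst (\<lambda>w. if w = v then 1 else mvar w) r"
    using arg_cong[OF r, of "subst (\<lambda>w. if w = v then 1 else mvar w)"] by (simp add: subst_simps)
  hence "p dvd 1"
    by (rule dvdI)
  thus False
    using prime_elem_not_unit[OF assms(1)] by blast
qed

context dual_bundle
begin

definition hprime :: "(nat, complex) mpoly \<Rightarrow> bool" where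
  "hprime p \<longleftrightarrow> prime_elem p \<and> (\<exists>d k. p \<in> sections d k)"

text \<open>The homogeneous localisation of the ring of invariants in bidegree (d, k); bidegree (0,
  0) gives the function field of the bundle.\<close>

definition hfracs :: "int \<Rightarrow> int \<Rightarrow> ambient set" where
  "hfracs d k = {emb F / emb G | F G. G \<noteq> 0 \<and> (\<exists>e l. F \<in> sections (e + d) (l + k) \<and> G \<in> sections e l)}"

lemma hfracsI:
  "F \<in> sections d' k' \<Longrightarrow> G \<in> sections e l \<Longrightarrow> G \<noteq> 0 \<Longrightarrow> d' - e = d \<Longrightarrow> k' - l = k \<Longrightarrow> emb F / emb G \<in> hfracs d k"
  unfolding hfracs_def by (intro CollectI exI[of _ F] exI[of _ G] conjI exI[of _ e] exI[of _ l]) auto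

lemma hfracsE:
  assumes "f \<in> hfracs d k"
  obtains F G e l where "f = emb F / emb G" "G \<noteq> 0" "F \<in> sections (e + d) (l + k)" "G \<in> sections e l"
  using assms unfolding hfracs_def by blast

lemma hfracs_section: "F \<in> sections d k \<Longrightarrow> emb F \<in> hfracs d k"
  using hfracsI[OF _ sections_1, of F d k d k] by (simp add: emb_1)

lemma hfracs_0: "0 \<in> hfracs d k"
  using hfracs_section[OF sections_0] by (simp add: emb_0)

lemma hfracs_1: "1 \<in> hfracs 0 0"
  using hfracs_section[OF sections_1] by (simp add: emb_1)

lemma hfracs_mult:
  assumes "f \<in> hfracs d k" "g \<in> hfracs d' k'"
  shows "f * g \<in> hfracs (d + d') (k + k')"
proof -
  obtain F G e l where f: "f = emb F / emb G" "G \<noteq> 0" "F \<in> sections (e + d) (l + k)" "G \<in> sections e l"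
    using assms(1) by (rule hfracsE)
  obtain F' G' e' l' where g: "g = emb F' / emb G'" "G' \<noteq> 0" "F' \<in> sections (e' + d') (l' + k')" "G' \<in> sections e' l'"
    using assms(2) by (rule hfracsE)
  have "emb (F * F') / emb (G * G') \<in> hfracs (d + d') (k + k')"
    by (rule hfracsI[OF sections_mult[OF f(3) g(3) refl refl] sections_mult[OF f(4) g(4) refl refl]])
      (use f g in auto)
  thus ?thesis
    by (simp add: f g emb_simps)
qed

lemma hfracs_inverse:
  assumes "f \<in> hfracs d k"
  shows "inverse f \<in> hfracs (- d) (- k)"
proof (cases "f = 0")
  case False
  obtain F G e l where f: "f = emb F / emb G" "G \<noteq> 0" "F \<in> sections (e + d) (l + k)" "G \<in> sections e l"
    using assms(1) by (rule hfracsE)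
  have "F \<noteq> 0"
    using False f by (auto simp: emb_0)
  have "emb G / emb F \<in> hfracs (- d) (- k)"
    by (rule hfracsI[OF f(4,3) \<open>F \<noteq> 0\<close>]) auto
  thus ?thesis
    by (simp add: f(1))
qed (simp add: hfracs_0)

lemma hfracs_divide: "f \<in> hfracs d k \<Longrightarrow> g \<in> hfracs d' k' \<Longrightarrow> f / g \<in> hfracs (d - d') (k - k')"
  using hfracs_mult[OF _ hfracs_inverse, of f d k g d' k'] by (simp add: divide_inverse)

lemma hfracs_power: "f \<in> hfracs d k \<Longrightarrow> f ^ N \<in> hfracs (int N * d) (int N * k)"
proof (induction N)
  case (Suc N)
  thus ?case
    using hfracs_mult[OF Suc.prems Suc.IH[OF Suc.prems]] by (simp add: algebra_simps)
qed (simp add: hfracs_1)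

lemma hfracs_power_int:
  assumes "f \<in> hfracs d k"
  shows "f powi N \<in> hfracs (N * d) (N * k)"
proof (cases "N \<ge> 0")
  case True
  thus ?thesis
    using hfracs_power[OF assms, of "nat N"] by (simp add: power_int_def)
next
  case False
  thus ?thesis
    using hfracs_power[OF hfracs_inverse[OF assms], of "nat (- N)"] by (simp add: power_int_def)
qed

lemma sections_degree_unique:
  assumes "F \<in> sections d k" "F \<in> sections d' k'" "F \<noteq> 0"
  shows "d = d'" "k = k'"
  using assms whom_unique[OF assms(3)] unfolding sections_def by blast+

lemma hfracs_degree_unique:
  assumes "f \<in> hfracs d k" "f \<in> hfracs d' k'" "f \<noteq> 0"
  shows "d = d'" "k = k'"
proof -
  obtain F G e l where f: "f = emb F / emb G" "G \<noteq> 0" "F \<in> sections (e + d) (l + k)" "G \<in> sections e l"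
    using assms(1) by (rule hfracsE)
  obtain F' G' e' l' where g: "f = emb F' / emb G'" "G' \<noteq> 0" "F' \<in> sections (e' + d') (l' + k')" "G' \<in> sections e' l'"
    using assms(2) by (rule hfracsE)
  have "F * G' = F' * G"
    using f(1,2) g(1,2) frac_eq_iff by metis
  moreover have "F * G' \<noteq> 0"
    using assms(3) f(1) g(2) by (auto simp: emb_0)
  moreover have "F * G' \<in> sections (e + d + e') (l + k + l')" "F' * G \<in> sections (e' + d' + e) (l' + k' + l)"
    using sections_mult[OF f(3) g(4)] sections_mult[OF g(3) f(4)] by blast+
  ultimately have "e + d + e' = e' + d' + e" "l + k + l' = l' + k' + l"
    using sections_degree_unique by metis+
  thus "d = d'" "k = k'"
    by auto
qed

lemma minor_neq_0:
  assumes "i \<le> n" "j \<le> n" "i \<noteq> j"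
  shows "minor i j \<noteq> 0"
proof
  assume "minor i j = 0"
  hence "subst (\<lambda>v. if v = n + 1 + j \<or> v = i then 1 else 0) (minor i j) = 0"
    by (simp add: subst_simps)
  thus False
    using assms by (simp add: minor_def subst_simps zero_power a_pos)
qed

text \<open>Dividing the minor of \<open>j\<close> and \<open>m\<close>, the prime is free of
  \<open>x l\<close> and \<open>y l\<close>. These can then be specialised in the other minor, to
  (0, 1) and to (1, 0), so that \<open>p\<close> divides both \<open>x j\<close> and
  \<open>y j\<close>.\<close>

lemma prime_dvd_two_minors:
  assumes p: "prime_elem p" "p dvd minor j l" "p dvd minor j m"
    and "j \<le> n" "l \<le> n" "m \<le> n" "j \<noteq> l" "j \<noteq> m"
  shows "l = m"
proof (rule ccontr)
  assume "l \<noteq> m"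
  have free: "p \<in> mpoly_carrier {j, l, n + 1 + j, n + 1 + l}"
    if dv: "p dvd minor j l" "l \<le> n" "j \<noteq> l" for l
  proof -
    obtain q where q: "minor j l = p * q"
      using dv(1) by (auto elim: dvdE)
    have "p \<noteq> 0" "q \<noteq> 0"
      using minor_neq_0[of j l] q assms(4) dv by auto
    moreover have "minor j l \<in> mpoly_carrier {j, l, n + 1 + j, n + 1 + l}"
      unfolding minor_def by (intro mpoly_carrier_intros) auto
    ultimately show ?thesis
      unfolding q using mpoly_carrier_factor[of p q] by blast
  qed
  have pc: "p \<in> mpoly_carrier (- {l, n + 1 + l})"
  proof -
    have "{j, m, n + 1 + j, n + 1 + m} \<subseteq> - {l, n + 1 + l}"
      using assms \<open>l \<noteq> m\<close> by auto
    thus ?thesis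
      using free[OF p(3) assms(6,8)] mpoly_carrier_mono by blast
  qed
  have dvd: "p dvd subst \<sigma> (minor j l)" if "\<And>v. v \<notin> {l, n + 1 + l} \<Longrightarrow> \<sigma> v = mvar v" for \<sigma>
  proof -
    have "subst \<sigma> p = p"
      by (rule subst_fix[OF pc]) (use that in auto)
    moreover obtain q where "minor j l = p * q"
      using p(2) by (auto elim: dvdE)
    ultimately show ?thesis
      by (simp add: subst_simps)
  qed
  have "p dvd x j ^ a j"
    using dvd[of "\<lambda>v. if v = l then 0 else if v = n + 1 + l then 1 else mvar v"] assms
    by (simp add: minor_def subst_simps zero_power a_pos)
  hence "p dvd x j"
    using p(1) prime_elem_dvd_power by blast
  moreover have "p dvd y j"
    using dvd[of "\<lambda>v. if v = l then 1 else if v = n + 1 + l then 0 else mvar v"] assms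
    by (simp add: minor_def subst_simps)
  ultimately have "j = n + 1 + j"
    by (rule prime_dvd_two_vars[OF p(1)])
  thus False
    by simp
qed

text \<open>Three coordinates are available as n \<ge> 2, and each of the two primes rules out at
  most one of them.\<close>

lemma avoid_x:
  assumes "prime_elem p" "prime_elem q"
  obtains i where "i \<le> n" "\<not> p dvd x i" "\<not> q dvd x i"
proof -
  have n: "0 \<le> n" "1 \<le> n" "2 \<le> n"
    using n2 by auto
  have two: "\<not> (p dvd x 0 \<and> p dvd x 1) \<and> \<not> (p dvd x 0 \<and> p dvd x 2) \<and> \<not> (p dvd x 1 \<and> p dvd x 2)"
    if "prime_elem p" for p
    using prime_dvd_two_vars[OF that, of 0 1] prime_dvd_two_vars[OF that, of 0 2]
      prime_dvd_two_vars[OF that, of 1 2] by auto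
  show ?thesis
    using two[OF assms(1)] two[OF assms(2)] that[of 0] that[of 1] that[of 2] n by auto
qed

text \<open>Any two of the minors on the indices 0, 1, 2 share an index, so again each prime rules
  out at most one of the three.\<close>

lemma avoid_minor:
  assumes "prime_elem p" "prime_elem q"
  obtains i j where "i \<le> n" "j \<le> n" "i \<noteq> j" "\<not> p dvd minor i j" "\<not> q dvd minor i j"
proof -
  have n: "0 \<le> n" "1 \<le> n" "2 \<le> n"
    using n2 by auto
  have two: "\<not> (p dvd minor 0 1 \<and> p dvd minor 0 2) \<and> \<not> (p dvd minor 0 1 \<and> p dvd minor 1 2) \<and>
      \<not> (p dvd minor 0 2 \<and> p dvd minor 1 2)" if "prime_elem p" for p
    using prime_dvd_two_minors[OF that, of 0 1 2] prime_dvd_two_minors[OF that, of 1 0 2]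
      prime_dvd_two_minors[OF that, of 2 0 1] n minor_swap[of 1 0] minor_swap[of 2 0] minor_swap[of 2 1]
    by auto
  show ?thesis
    using two[OF assms(1)] two[OF assms(2)] that[of 0 1] that[of 0 2] that[of 1 2] n by auto
qed

lemma avoid_minor_at:
  assumes "prime_elem p" "i \<le> n"
  obtains j where "j \<le> n" "j \<noteq> i" "\<not> p dvd minor i j"
proof -
  obtain j l where "j \<le> n" "l \<le> n" "j \<noteq> i" "l \<noteq> i" "j \<noteq> l"
  proof -
    have "\<exists>j l. j \<le> 2 \<and> l \<le> 2 \<and> j \<noteq> i \<and> l \<noteq> i \<and> j \<noteq> (l::nat)"
      by presburger
    thus ?thesis
      using that n2 by (meson le_trans)
  qed
  thus ?thesis
    using that prime_dvd_two_minors[OF assms(1), of i j l] assms(2) by metis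
qed

text \<open>Multiplying a prime by a fraction prime to it (and to q) brings it into degree (0, 0).\<close>

lemma hprime_uniformiser:
  assumes "hprime p" "hprime q"
  obtains t where "t \<in> hfracs 0 0" "t \<noteq> 0" "pord p t = 1" "pord q t = int (pval q p)"
proof -
  have p: "prime_elem p" and q: "prime_elem q"
    using assms by (auto simp: hprime_def)
  obtain d k where dk: "p \<in> sections d k"
    using assms(1) by (auto simp: hprime_def)
  have p0: "p \<noteq> 0"
    using p by auto
  have "d \<ge> 0" "k \<ge> 0"
    using sections_nonneg[OF dk p0] by auto
  then obtain D K where DK: "d = int D" "k = int K"
    using nonneg_int_cases by metis
  obtain i where i: "i \<le> n" "\<not> p dvd x i" "\<not> q dvd x i"
    using avoid_x[OF p q] .
  obtain j l where jl: "j \<le> n" "l \<le> n" "j \<noteq> l" "\<not> p dvd minor j l" "\<not> q dvd minor j l"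
    using avoid_minor[OF p q] .
  \<comment> \<open>With \<open>p\<close> of bidegree (D, K), the factor
    \<open>minor j l ^ K\<close> matches the second degree and adds \<open>K * (a j + a l)\<close>
    to the first; the two powers of \<open>x i\<close> balance this excess and
    \<open>D\<close>.\<close>
  define F where "F = p * x i ^ (K * (a j + a l))"
  define G where "G = minor j l ^ K * x i ^ D"
  have nz: "minor j l \<noteq> 0" "F \<noteq> 0" "G \<noteq> 0"
    using minor_neq_0[OF jl(1-3)] p0 by (auto simp: F_def G_def mvar_neq_0)
  have F: "F \<in> sections (d + int (K * (a j + a l)) * 1) (k + int (K * (a j + a l)) * 0)"
    unfolding F_def by (intro sections_mult[OF dk sections_power[OF sections_x]] i) auto
  have G: "G \<in> sections (int K * (int (a j) + int (a l)) + int D * 1) (int K * 1 + int D * 0)"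
    unfolding G_def by (intro sections_mult[OF sections_power[OF sections_minor] sections_power[OF sections_x]] i jl) auto
  have "emb F / emb G \<in> hfracs 0 0"
    by (rule hfracsI[OF F G nz(3)]) (auto simp: DK algebra_simps)
  moreover have "emb F / emb G \<noteq> 0"
    using nz by (simp add: emb_eq_0_iff)
  moreover have "pval r F = pval r p \<and> pval r G = 0" if r: "prime_elem r" "\<not> r dvd x i" "\<not> r dvd minor j l" for r
  proof -
    have nd: "\<not> r dvd x i ^ N" "\<not> r dvd minor j l ^ N" for N
      using r prime_elem_dvd_power by blast+
    have "\<not> r dvd G"
      unfolding G_def using nd prime_elem_dvd_multD[OF r(1)] by blast
    moreover have "pval r F = pval r p + pval r (x i ^ (K * (a j + a l)))"
      unfolding F_def by (rule pval_mult[OF r(1) p0]) (simp add: mvar_neq_0)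
    ultimately show ?thesis
      using pval_not_dvd[OF r(1)] nd by simp
  qed
  from this[OF p i(2) jl(4)] this[OF q i(3) jl(5)]
  have "pord p (emb F / emb G) = 1" "pord q (emb F / emb G) = int (pval q p)"
    using pord_frac[OF p nz(2,3)] pord_frac[OF q nz(2,3)] pval_self[OF p] by auto
  ultimately show ?thesis
    using that by blast
qed

section \<open>Prime divisors\<close>

definition divisor_ring :: "(nat, complex) mpoly \<Rightarrow> ambient set" where
  "divisor_ring p = {f \<in> hfracs 0 0. f = 0 \<or> 0 \<le> pord p f}"

abbreviation PE :: "ambient set set" where
  "PE \<equiv> proj_dual_bundle n a"

lemma bundle_iff:
  "V \<in> PE \<longleftrightarrow> (\<exists>i\<le>n. \<exists>P. proj_point (chart_sections i) P \<and> V = homogeneous_localisation (chart_sections i) P)"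
proof -
  have "sym_dual n a i = chart_sections i" if "i \<le> n" for i
    using sym_dual_eq[OF that] by (intro ext) simp
  thus ?thesis
    unfolding proj_dual_bundle_def proj_def by auto
qed

lemma proj_pointD:
  assumes "proj_point T P"
  shows "P k \<subseteq> T k" "0 \<in> P k" "f \<in> P k \<Longrightarrow> g \<in> P k \<Longrightarrow> f + g \<in> P k"
    "h \<in> T j \<Longrightarrow> f \<in> P k \<Longrightarrow> h * f \<in> P (j + k)"
    "h \<in> T j \<Longrightarrow> h' \<in> T k \<Longrightarrow> h * h' \<in> P (j + k) \<Longrightarrow> h \<in> P j \<or> h' \<in> P k"
    "\<exists>k>0. P k \<noteq> T k"
  using assms unfolding proj_point_def by blast+

lemma localisation_hfracs:
  assumes "i \<le> n"
  shows "homogeneous_localisation (chart_sections i) P \<subseteq> hfracs 0 0"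
proof
  fix h assume "h \<in> homogeneous_localisation (chart_sections i) P"
  then obtain f g k where h: "h = f / g" "f \<in> chart_sections i k" "g \<in> chart_sections i k"
    unfolding homogeneous_localisation_def by blast
  have "f \<in> hfracs 0 (int k)" if "f \<in> chart_sections i k" for f
  proof -
    obtain F N where F: "f = emb F / emb (x i) ^ N" "F \<in> sections (int N) (int k)"
      using \<open>f \<in> chart_sections i k\<close> unfolding chart_sections_def by blast
    have "emb F / emb (x i ^ N) \<in> hfracs 0 (int k)"
      by (rule hfracsI[OF F(2) sections_x_power[OF assms, of N]]) (auto simp: mvar_neq_0)
    thus ?thesis
      by (simp add: F(1) emb_power)
  qed
  hence "f / g \<in> hfracs (0 - 0) (int k - int k)"
    using h by (intro hfracs_divide)
  thus "h \<in> hfracs 0 0"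
    by (simp add: h)
qed

lemma localisation_mult:
  assumes P: "proj_point (chart_sections i) P"
    and "f \<in> homogeneous_localisation (chart_sections i) P" "g \<in> homogeneous_localisation (chart_sections i) P"
  shows "f * g \<in> homogeneous_localisation (chart_sections i) P"
proof -
  obtain f1 f2 k where f: "f = f1 / f2" "f1 \<in> chart_sections i k" "f2 \<in> chart_sections i k - P k"
    using assms(2) unfolding homogeneous_localisation_def by blast
  obtain g1 g2 l where g: "g = g1 / g2" "g1 \<in> chart_sections i l" "g2 \<in> chart_sections i l - P l"
    using assms(3) unfolding homogeneous_localisation_def by blast
  have "f2 * g2 \<in> chart_sections i (k + l) - P (k + l)"
    using f(3) g(3) proj_pointD(5)[OF P] chart_sections_mult by blast
  moreover have "f1 * g1 \<in> chart_sections i (k + l)"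
    using f g chart_sections_mult by blast
  ultimately show ?thesis
    unfolding homogeneous_localisation_def f(1) g(1)
    by (intro CollectI exI[of _ "f1 * g1"] exI[of _ "f2 * g2"]) auto
qed

lemma chart_sections_pord:
  assumes "prime_elem p" "\<not> p dvd x i" "F \<noteq> 0"
  shows "pord p (emb F / emb (x i) ^ N) = int (pval p F)"
proof -
  have "\<not> p dvd x i ^ N"
    using assms prime_elem_dvd_power by blast
  thus ?thesis
    using pord_frac[OF assms(1,3), of "x i ^ N"] pval_not_dvd[OF assms(1)]
    by (simp add: mvar_neq_0 emb_power)
qed

lemma chart_sections_pord_nonneg:
  assumes "prime_elem p" "\<not> p dvd x i" "f \<in> chart_sections i k" "f \<noteq> 0"
  shows "0 \<le> pord p f"
proof -
  obtain F N where F: "f = emb F / emb (x i) ^ N"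
    using assms(3) unfolding chart_sections_def by blast
  hence "F \<noteq> 0"
    using assms(4) by (auto simp: emb_0)
  thus ?thesis
    using chart_sections_pord[OF assms(1,2)] F by simp
qed

lemma minor_chart: "i \<le> n \<Longrightarrow> j \<le> n \<Longrightarrow> emb (minor i j) / emb (x i) ^ (a i + a j) \<in> chart_sections i 1"
  using chart_sectionsI[of "minor i j" "a i + a j" 1 i] sections_minor[of i j] by simp

lemma localisation_zero_point:
  assumes "i \<le> n"
  shows "homogeneous_localisation (chart_sections i) (\<lambda>_. {0}) = hfracs 0 0"
proof (intro equalityI subsetI)
  fix f assume "f \<in> hfracs 0 0"
  then obtain F G e l where f: "f = emb F / emb G" "G \<noteq> 0" "F \<in> sections e l" "G \<in> sections e l"
    by (elim hfracsE) auto
  obtain N k where Nk: "e = int N" "l = int k"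
    using sections_nonneg[OF f(4,2)] nonneg_int_cases by metis
  have "emb F / emb (x i) ^ N \<in> chart_sections i k" "emb G / emb (x i) ^ N \<in> chart_sections i k - {0}"
    using f Nk by (auto intro: chart_sectionsI simp: emb_eq_0_iff mvar_neq_0)
  moreover have "f = (emb F / emb (x i) ^ N) / (emb G / emb (x i) ^ N)"
    using f(1) by (simp add: emb_eq_0_iff mvar_neq_0)
  ultimately show "f \<in> homogeneous_localisation (chart_sections i) (\<lambda>_. {0})"
    unfolding homogeneous_localisation_def by blast
qed (use localisation_hfracs[OF assms] in blast)

lemma generic_point: "hfracs 0 0 \<in> PE"
proof -
  let ?T = "chart_sections 0"
  have P: "proj_point ?T (\<lambda>_. {0})"
    unfolding proj_point_def
  proof (intro conjI allI ballI impI)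
    have "emb (minor 0 1) / emb (x 0) ^ (a 0 + a 1) \<noteq> 0"
      using minor_neq_0[of 0 1] n2 by (simp add: emb_eq_0_iff mvar_neq_0)
    moreover have "emb (minor 0 1) / emb (x 0) ^ (a 0 + a 1) \<in> ?T 1"
      by (rule minor_chart) (use n2 in auto)
    ultimately have "{0} \<noteq> ?T 1"
      by blast
    thus "\<exists>k>0. {0} \<noteq> ?T k"
      using zero_less_one by blast
  qed (auto simp: chart_sections_0)
  thus ?thesis
    unfolding bundle_iff using localisation_zero_point[of 0] by blast
qed

lemma function_field_bundle: "function_field PE = hfracs 0 0"
proof -
  have "V \<subseteq> hfracs 0 0" if "V \<in> PE" for V
    using that localisation_hfracs unfolding bundle_iff by auto
  thus ?thesis
    using generic_point unfolding function_field_def by blast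
qed

text \<open>On a chart with \<open>x i\<close> prime to \<open>p\<close>, the sections of positive
  order form a homogeneous prime ideal; a minor prime to \<open>p\<close> shows that it does not
  contain the irrelevant ideal. The localisation there is the valuation ring.\<close>

lemma divisor_ring_bundle:
  assumes "hprime p"
  shows "divisor_ring p \<in> PE"
proof -
  have p: "prime_elem p"
    using assms by (simp add: hprime_def)
  have p0: "p \<noteq> 0"
    using p by auto
  obtain i where i: "i \<le> n" "\<not> p dvd x i"
    using avoid_x[OF p p] by blast
  obtain j where j: "j \<le> n" "j \<noteq> i" "\<not> p dvd minor i j"
    using avoid_minor_at[OF p i(1)] by blast
  let ?T = "chart_sections i"
  define P where "P k = {f \<in> ?T k. f = 0 \<or> 0 < pord p f}" for k
  note nonneg = chart_sections_pord_nonneg[OF p i(2)]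
  have P: "proj_point ?T P"
    unfolding proj_point_def
  proof (intro conjI allI ballI impI)
    fix k show "P k \<subseteq> ?T k" "0 \<in> P k"
      by (auto simp: P_def chart_sections_0)
    fix f g assume fg: "f \<in> P k" "g \<in> P k"
    have "0 < pord p (f + g)" if "f \<noteq> 0" "g \<noteq> 0" "f + g \<noteq> 0"
      using pord_add[OF p that] fg that by (auto simp: P_def)
    hence "f + g = 0 \<or> 0 < pord p (f + g)"
      using fg by (cases "f = 0"; cases "g = 0") (auto simp: P_def)
    thus "f + g \<in> P k"
      using fg chart_sections_add[OF i(1), of f k g] by (simp add: P_def)
  next
    fix j k f g assume fg: "f \<in> ?T j" "g \<in> P k"
    thus "f * g \<in> P (j + k)"
      using nonneg[OF fg(1)] pord_mult[OF p, of f g]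
      by (cases "f = 0 \<or> g = 0") (auto simp: P_def chart_sections_mult chart_sections_0)
  next
    fix j k f g assume fg: "f \<in> ?T j" "g \<in> ?T k" "f * g \<in> P (j + k)"
    thus "f \<in> P j \<or> g \<in> P k"
      using pord_mult[OF p, of f g] nonneg[OF fg(1)] nonneg[OF fg(2)]
      by (cases "f = 0 \<or> g = 0") (auto simp: P_def)
  next
    define m where "m = emb (minor i j) / emb (x i) ^ (a i + a j)"
    have m0: "minor i j \<noteq> 0"
      using minor_neq_0 i j by auto
    hence "m \<noteq> 0" "pord p m = 0"
      using chart_sections_pord[OF p i(2) m0] pval_not_dvd[OF p j(3)]
      by (auto simp: m_def emb_eq_0_iff mvar_neq_0)
    hence "m \<notin> P 1" "m \<in> ?T 1"
      using minor_chart[OF i(1) j(1)] by (auto simp: P_def m_def)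
    hence "P 1 \<noteq> ?T 1"
      by blast
    thus "\<exists>k>0. P k \<noteq> ?T k"
      using zero_less_one by blast
  qed
  have "homogeneous_localisation ?T P = divisor_ring p"
  proof (intro equalityI subsetI)
    fix h assume h: "h \<in> homogeneous_localisation ?T P"
    then obtain f g k where fg: "h = f / g" "f \<in> ?T k" "g \<in> ?T k" "g \<notin> P k"
      unfolding homogeneous_localisation_def by blast
    hence "g \<noteq> 0" "pord p g = 0"
      using nonneg[OF fg(3)] by (force simp: P_def)+
    hence "h = 0 \<or> 0 \<le> pord p h"
      using fg nonneg[OF fg(2)] pord_divide[OF p, of f g] by (cases "f = 0") auto
    thus "h \<in> divisor_ring p"
      using h localisation_hfracs[OF i(1)] by (auto simp: divisor_ring_def)
  next
    fix h assume h: "h \<in> divisor_ring p"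
    then obtain F G e l where fg: "h = emb F / emb G" "G \<noteq> 0" "F \<in> sections e l" "G \<in> sections e l"
      unfolding divisor_ring_def by (elim CollectE conjE hfracsE) auto
    \<comment> \<open>The power of \<open>p\<close> in the denominator also divides the numerator.
      Since \<open>p\<close> is homogeneous and invariant, cancelling it leaves sections of equal
      bidegree whose denominator has order 0.\<close>
    obtain G' where G': "G = p ^ pval p G * G'" "\<not> p dvd G'"
      using pval_decomp[OF p fg(2)] by blast
    have "\<exists>F'. F = p ^ pval p G * F'"
    proof (cases "F = 0")
      case False
      hence "0 \<le> pord p h"
        using h fg by (auto simp: divisor_ring_def emb_eq_0_iff)
      hence "pval p G \<le> pval p F"
        using pord_frac[OF p False fg(2)] fg(1) by simp
      thus ?thesis
        using pval_ge_iff[OF p False] by (auto elim: dvdE)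
    qed simp
    then obtain F' where F': "F = p ^ pval p G * F'"
      by blast
    obtain d k where "p \<in> sections d k"
      using assms by (auto simp: hprime_def)
    hence pp: "p ^ pval p G \<in> sections (int (pval p G) * d) (int (pval p G) * k)" "p ^ pval p G \<noteq> 0"
      using sections_power p0 by auto
    define e' l' where "e' = e - int (pval p G) * d" and "l' = l - int (pval p G) * k"
    have FG': "F' \<in> sections e' l'" "G' \<in> sections e' l'"
      using sections_cofactor[OF _ pp, of F'] sections_cofactor[OF _ pp, of G'] fg(3,4) F' G'(1)
      by (auto simp: e'_def l'_def)
    have G'0: "G' \<noteq> 0"
      using G' by auto
    obtain N K where NK: "e' = int N" "l' = int K"
      using sections_nonneg[OF FG'(2) G'0] nonneg_int_cases by metis
    have "emb G' / emb (x i) ^ N \<notin> P K"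
      using chart_sections_pord[OF p i(2) G'0] pval_not_dvd[OF p G'(2)] G'0
      by (auto simp: P_def emb_eq_0_iff mvar_neq_0)
    moreover have "emb F' / emb (x i) ^ N \<in> ?T K" "emb G' / emb (x i) ^ N \<in> ?T K"
      using FG' NK by (auto intro: chart_sectionsI)
    moreover have "h = emb F' / emb G'"
      unfolding fg(1) using F' G'(1) pp(2) by (metis emb_eq_0_iff emb_mult mult_divide_mult_cancel_left)
    hence "h = (emb F' / emb (x i) ^ N) / (emb G' / emb (x i) ^ N)"
      by (simp add: emb_eq_0_iff mvar_neq_0)
    ultimately show "h \<in> homogeneous_localisation ?T P"
      unfolding homogeneous_localisation_def by blast
  qed
  thus ?thesis
    unfolding bundle_iff using P i(1) by blast
qed

lemma divisor_ring_proper: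
  assumes "hprime p"
  shows "divisor_ring p \<noteq> hfracs 0 0"
proof -
  have p: "prime_elem p"
    using assms by (simp add: hprime_def)
  obtain t where t: "t \<in> hfracs 0 0" "t \<noteq> 0" "pord p t = 1"
    using hprime_uniformiser[OF assms assms] by blast
  have "inverse t \<in> hfracs 0 0"
    using hfracs_inverse[OF t(1)] by simp
  moreover have "inverse t \<notin> divisor_ring p"
    using t pord_inverse[OF p t(2)] by (simp add: divisor_ring_def)
  ultimately show ?thesis
    by blast
qed

text \<open>A discrete valuation ring is a maximal proper subring: an element \<open>w\<close> of
  negative order can absorb any pole, because \<open>f * inverse w ^ N\<close> has nonnegative order
  for large \<open>N\<close>.\<close>

lemma divisor_ring_maximal:
  assumes "hprime p" "W \<in> PE" "divisor_ring p \<subseteq> W"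
  shows "W = divisor_ring p \<or> W = hfracs 0 0"
proof (rule disjCI)
  assume "W \<noteq> hfracs 0 0"
  have p: "prime_elem p"
    using assms by (simp add: hprime_def)
  obtain i P where W: "i \<le> n" "proj_point (chart_sections i) P" "W = homogeneous_localisation (chart_sections i) P"
    using assms(2) unfolding bundle_iff by blast
  have sub: "W \<subseteq> hfracs 0 0"
    using localisation_hfracs W by blast
  have mult: "f * g \<in> W" if "f \<in> W" "g \<in> W" for f g
    using localisation_mult[OF W(2)] that unfolding W(3) by blast
  have "W \<subseteq> divisor_ring p"
  proof (rule ccontr)
    assume "\<not> W \<subseteq> divisor_ring p"
    then obtain w where w: "w \<in> W" "w \<notin> divisor_ring p"
      by blast
    hence w': "w \<in> hfracs 0 0" "w \<noteq> 0" "pord p w < 0"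
      using sub by (auto simp: divisor_ring_def)
    have pow: "w ^ Suc N \<in> W" for N
      by (induction N) (use w mult in auto)
    have "hfracs 0 0 \<subseteq> W"
    proof
      fix f assume f: "f \<in> hfracs 0 0"
      show "f \<in> W"
      proof (cases "f = 0")
        case True
        thus ?thesis
          using assms(3) by (auto simp: divisor_ring_def hfracs_0)
      next
        case False
        \<comment> \<open>As \<open>w\<close> has order at most -1, this many factors suffice; the
          successor keeps the exponent positive, as \<open>pow\<close> requires.\<close>
        define N where "N = Suc (nat \<bar>pord p f\<bar>)"
        define g where "g = f * inverse w ^ N"
        have "inverse w ^ N \<in> hfracs 0 0"
          using hfracs_power[OF hfracs_inverse[OF w'(1)], of N] by simp
        hence g: "g \<in> hfracs 0 0"
          using hfracs_mult[OF f] by (simp add: g_def)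
        have "pord p g = pord p f - int N * pord p w"
          using False w' by (simp add: g_def pord_mult[OF p] pord_power[OF p] pord_inverse[OF p])
        moreover have "int N \<le> int N * (- pord p w)"
          using mult_left_mono[of 1 "- pord p w" "int N"] w'(3) by simp
        ultimately have "0 \<le> pord p g"
          by (simp add: N_def)
        hence "g \<in> W"
          using g assms(3) by (auto simp: divisor_ring_def)
        moreover have "f = g * w ^ N"
          using w'(2) by (simp add: g_def power_inverse)
        ultimately show ?thesis
          using mult[OF _ pow[of "nat \<bar>pord p f\<bar>"], of g] by (simp add: N_def)
      qed
    qed
    thus False
      using sub \<open>W \<noteq> hfracs 0 0\<close> by blast
  qed
  thus "W = divisor_ring p"
    using assms(3) by blast
qed

text \<open>A prime factor taken in the full polynomial ring is automatically invariant and
  homogeneous, so descents can stay among sections.\<close>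

lemma section_prime_factor:
  assumes "F \<in> sections d k" "F \<noteq> 0" "\<not> F dvd 1"
  obtains p F' d1 k1 d2 k2 where "F = p * F'" "hprime p" "p \<in> sections d1 k1" "F' \<in> sections d2 k2" "F' \<noteq> 0"
    "d1 + d2 = d" "k1 + k2 = k" "tdeg F' < tdeg F"
proof -
  obtain p where p: "prime_elem p" "p dvd F"
    using mpoly_prime_factor[OF assms(2,3)] by blast
  then obtain F' where F': "F = p * F'"
    by (auto elim: dvdE)
  have nz: "p \<noteq> 0" "F' \<noteq> 0"
    using F' assms(2) by auto
  obtain d1 k1 d2 k2 where *: "p \<in> sections d1 k1" "F' \<in> sections d2 k2" "d1 + d2 = d" "k1 + k2 = k"
    using sections_factor[of p F' d k] assms(1) F' nz by blast
  moreover have "hprime p"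
    using p * by (auto simp: hprime_def)
  moreover have "tdeg F' < tdeg F"
    using tdeg_mult[OF nz] tdeg_pos[OF nz(1) prime_elem_not_unit[OF p(1)]] F' by simp
  ultimately show ?thesis
    using that F' nz by blast
qed

section \<open>Points of the charts and the homogeneous primes they contain\<close>

definition dehom :: "nat \<Rightarrow> (nat, complex) mpoly \<Rightarrow> int \<Rightarrow> ambient" where
  "dehom i F d = emb F / emb (x i) ^ nat d"

lemma dehom_chart: "F \<in> sections d k \<Longrightarrow> F \<noteq> 0 \<Longrightarrow> dehom i F d \<in> chart_sections i (nat k)"
  using sections_nonneg[of F d k] chart_sectionsI[of F "nat d" "nat k" i] by (simp add: dehom_def)

lemma dehom_mult:
  assumes "F \<in> sections d k" "G \<in> sections e l" "F \<noteq> 0" "G \<noteq> 0"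
  shows "dehom i (F * G) (d + e) = dehom i F d * dehom i G e" "nat (k + l) = nat k + nat l"
  using sections_nonneg[OF assms(1,3)] sections_nonneg[OF assms(2,4)]
  by (simp_all add: dehom_def emb_simps nat_add_distrib power_add)

lemma one_not_in_point:
  assumes P: "proj_point (chart_sections i) P"
  shows "1 \<notin> P 0"
proof
  assume 1: "1 \<in> P 0"
  have "chart_sections i k \<subseteq> P k" for k
    using proj_pointD(4)[OF P _ 1] by fastforce
  thus False
    using proj_pointD(1,6)[OF P] by blast
qed

text \<open>Primeness of the point hands membership down to a factor, and a constant cannot be
  reached because 1 is not in \<open>P 0\<close>.\<close>

lemma point_prime_factor:
  assumes P: "proj_point (chart_sections i) P"
    and "F \<in> sections d k" "F \<noteq> 0" "dehom i F d \<in> P (nat k)"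
  shows "\<exists>p d' k'. hprime p \<and> p \<in> sections d' k' \<and> dehom i p d' \<in> P (nat k')"
  using assms(2-4)
proof (induction "tdeg F" arbitrary: F d k rule: less_induct)
  case less
  show ?case
  proof (cases "F dvd 1")
    case True
    then obtain c where c: "c \<noteq> 0" "F = mconst c"
      using unit_mconst by blast
    hence "F \<in> sections 0 0"
      using sections_mconst by simp
    hence dk: "d = 0" "k = 0"
      using whom_unique[OF less.prems(2)] less.prems(1) unfolding sections_def by blast+
    have "emb (mconst (inverse c)) \<in> chart_sections i 0"
      using chart_sectionsI[of "mconst (inverse c)" 0 0 i] sections_mconst by simp
    hence "emb (mconst (inverse c)) * dehom i F d \<in> P (0 + 0)"
      using proj_pointD(4)[OF P] less.prems(3) dk by fastforce
    moreover have "emb (mconst (inverse c)) * dehom i F d = emb (mconst (inverse c * c))"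
      using dk by (simp add: dehom_def c(2) is_hom_mult[OF is_hom_mconst] emb_mult)
    ultimately have "1 \<in> P 0"
      using c(1) by (simp add: mconst_1 emb_1)
    thus ?thesis
      using one_not_in_point[OF P] by blast
  next
    case False
    obtain p F' d1 k1 d2 k2 where *: "F = p * F'" "hprime p" "p \<in> sections d1 k1" "F' \<in> sections d2 k2" "F' \<noteq> 0"
      "d1 + d2 = d" "k1 + k2 = k" "tdeg F' < tdeg F"
      using section_prime_factor[OF less.prems(1,2) False] .
    have p0: "p \<noteq> 0"
      using *(1) less.prems(2) by auto
    have "dehom i p d1 * dehom i F' d2 \<in> P (nat k1 + nat k2)"
      using less.prems(3) dehom_mult[OF *(3,4) p0 *(5)] *(1,6,7) by simp
    hence "dehom i p d1 \<in> P (nat k1) \<or> dehom i F' d2 \<in> P (nat k2)"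
      using proj_pointD(5)[OF P dehom_chart[OF *(3) p0] dehom_chart[OF *(4,5)]] by blast
    thus ?thesis
      using *(2,3) less.hyps[OF *(8,4,5)] by blast
  qed
qed

text \<open>For the inclusion from left to right, a nonzero ideal \<open>P\<close> contains some
  homogeneous prime \<open>p\<close> and all its multiples. Denominators outside \<open>P\<close>
  are then prime to \<open>p\<close>, so the local ring lies in \<open>divisor_ring p\<close>, and
  codimension one forces equality.\<close>

lemma prime_divisors_bundle: "prime_divisors PE = divisor_ring ` Collect hprime"
proof (intro equalityI subsetI)
  fix V assume "V \<in> divisor_ring ` Collect hprime"
  thus "V \<in> prime_divisors PE"
    using divisor_ring_bundle divisor_ring_proper divisor_ring_maximal
    unfolding prime_divisors_def function_field_bundle by auto
next
  fix V assume "V \<in> prime_divisors PE"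
  hence V: "V \<in> PE" "V \<noteq> hfracs 0 0" "\<And>W. W \<in> PE \<Longrightarrow> V \<subseteq> W \<Longrightarrow> W = V \<or> W = hfracs 0 0"
    unfolding prime_divisors_def function_field_bundle by auto
  obtain i P where i: "i \<le> n" and P: "proj_point (chart_sections i) P"
    and VP: "V = homogeneous_localisation (chart_sections i) P"
    using V(1) unfolding bundle_iff by blast
  \<comment> \<open>The zero ideal would give the generic point, which is excluded.\<close>
  have "\<exists>k. \<exists>f\<in>P k. f \<noteq> 0"
  proof (rule ccontr)
    assume "\<not> ?thesis"
    hence P0: "P = (\<lambda>_. {0})"
      using proj_pointD(2)[OF P] by (intro ext) blast
    thus False
      using V(2) VP localisation_zero_point[OF i] by simp
  qed
  then obtain k f where f: "f \<in> P k" "f \<noteq> 0"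
    by blast
  then obtain F N where F: "f = emb F / emb (x i) ^ N" "F \<in> sections (int N) (int k)"
    using proj_pointD(1)[OF P] unfolding chart_sections_def by blast
  have "F \<noteq> 0"
    using F(1) f(2) by (auto simp: emb_0)
  moreover have "dehom i F (int N) \<in> P (nat (int k))"
    using f F(1) by (simp add: dehom_def)
  ultimately obtain p d' k' where p: "hprime p" "p \<in> sections d' k'" "dehom i p d' \<in> P (nat k')"
    using point_prime_factor[OF P F(2)] by blast
  have pe: "prime_elem p" and p0: "p \<noteq> 0"
    using p(1) by (auto simp: hprime_def)
  have multiple: "dehom i G e \<in> P (nat l)" if "G \<in> sections e l" "G \<noteq> 0" "p dvd G" for G e l
  proof -
    obtain G' where G': "G = p * G'"
      using \<open>p dvd G\<close> by (auto elim: dvdE)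
    have G'0: "G' \<noteq> 0"
      using G' that(2) by auto
    have s: "G' \<in> sections (e - d') (l - k')"
      using sections_cofactor[OF _ p(2) p0] that(1) G' by simp
    have "dehom i G' (e - d') * dehom i p d' \<in> P (nat (l - k') + nat k')"
      using proj_pointD(4)[OF P dehom_chart[OF s G'0] p(3)] .
    thus ?thesis
      using dehom_mult(1)[OF s p(2) G'0 p0, of i] dehom_mult(2)[OF s p(2) G'0 p0] by (simp add: G' mult.commute)
  qed
  \<comment> \<open>On its own chart \<open>x i\<close> dehomogenises to 1, which lies in no
    point.\<close>
  have "\<not> p dvd x i"
  proof
    assume "p dvd x i"
    hence "dehom i (x i) 1 \<in> P (nat 0)"
      using multiple[OF sections_x[OF i] mvar_neq_0] by simp
    thus False
      using one_not_in_point[OF P] by (simp add: dehom_def emb_eq_0_iff mvar_neq_0)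
  qed
  have "V \<subseteq> divisor_ring p"
  proof
    fix h assume h: "h \<in> V"
    then obtain f g k where fg: "h = f / g" "f \<in> chart_sections i k" "g \<in> chart_sections i k" "g \<notin> P k"
      unfolding VP homogeneous_localisation_def by blast
    obtain G N where G: "g = emb G / emb (x i) ^ N" "G \<in> sections (int N) (int k)"
      using fg(3) unfolding chart_sections_def by blast
    have "g \<noteq> 0"
      using fg(4) proj_pointD(2)[OF P] by auto
    hence "G \<noteq> 0"
      using G(1) by (auto simp: emb_0)
    hence "\<not> p dvd G"
      using multiple[OF G(2)] fg(4) G(1) by (auto simp: dehom_def)
    hence "pord p g = 0"
      using chart_sections_pord[OF pe \<open>\<not> p dvd x i\<close> \<open>G \<noteq> 0\<close>] pval_not_dvd[OF pe] G(1) by simp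
    hence "h = 0 \<or> 0 \<le> pord p h"
      using fg(1) \<open>g \<noteq> 0\<close> chart_sections_pord_nonneg[OF pe \<open>\<not> p dvd x i\<close> fg(2)] pord_divide[OF pe, of f g]
      by (cases "f = 0") auto
    thus "h \<in> divisor_ring p"
      using h localisation_hfracs[OF i] VP by (auto simp: divisor_ring_def)
  qed
  hence "divisor_ring p = V"
    using V(3)[OF divisor_ring_bundle[OF p(1)]] divisor_ring_proper[OF p(1)] by blast
  thus "V \<in> divisor_ring ` Collect hprime"
    using p(1) by blast
qed

section \<open>The valuations attached to the prime divisors\<close>

lemma normalised_valuation_pord:
  assumes "hprime p"
  shows "normalised_valuation (hfracs 0 0) (divisor_ring p) (pord p)"
proof -
  have p: "prime_elem p"
    using assms by (simp add: hprime_def)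
  obtain t where "t \<in> hfracs 0 0" "t \<noteq> 0" "pord p t = 1"
    using hprime_uniformiser[OF assms assms] by blast
  thus ?thesis
    unfolding normalised_valuation_def
    using pord_mult[OF p] pord_add[OF p] by (auto simp: divisor_ring_def)
qed

text \<open>Up to a power of the uniformiser \<open>t\<close>, every nonzero \<open>f\<close> is a
  unit of the ring, on which \<open>v\<close> vanishes. So \<open>v\<close> is \<open>v t\<close>
  times \<open>pord p\<close>, and normalisation forces \<open>v t = 1\<close>.\<close>

lemma normalised_valuation_unique:
  assumes "hprime p" and v: "normalised_valuation (hfracs 0 0) (divisor_ring p) v"
    and f: "f \<in> hfracs 0 0" "f \<noteq> 0"
  shows "v f = pord p f"
proof -
  have p: "prime_elem p"
    using assms by (simp add: hprime_def)
  let ?K = "hfracs 0 0"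
  have mult: "v (f * g) = v f + v g" if "f \<in> ?K" "g \<in> ?K" "f \<noteq> 0" "g \<noteq> 0" for f g
    using v that unfolding normalised_valuation_def by auto
  have K: "f * g \<in> ?K" "inverse f \<in> ?K" "f powi N \<in> ?K" if "f \<in> ?K" "g \<in> ?K" for f g N
    using hfracs_mult[OF that] hfracs_inverse[OF that(1)] hfracs_power_int[OF that(1), of N] by auto
  have ring: "f \<in> divisor_ring p \<longleftrightarrow> 0 \<le> v f" if "f \<in> ?K" "f \<noteq> 0" for f
    using v that unfolding normalised_valuation_def by auto
  have v1: "v 1 = 0"
    using mult[of 1 1] hfracs_1 by simp
  have inv: "v (inverse f) = - v f" if "f \<in> ?K" "f \<noteq> 0" for f
    using mult[of f "inverse f"] K(2)[OF that(1) that(1)] that v1 by simp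
  have pow: "v (f ^ N) = int N * v f" if "f \<in> ?K" "f \<noteq> 0" for f N
  proof (induction N)
    case (Suc N)
    have "f ^ N \<in> ?K"
      using hfracs_power[OF that(1), of N] by simp
    thus ?case
      using mult[of f "f ^ N"] that Suc by (simp add: algebra_simps)
  qed (simp add: v1)
  have powi: "v (f powi N) = N * v f" if "f \<in> ?K" "f \<noteq> 0" for f N
    using pow[OF that] pow[OF K(2)[OF that(1) that(1)]] inv[OF that] that(2)
    by (cases "N \<ge> 0") (auto simp: power_int_def)
  obtain t where t: "t \<in> ?K" "t \<noteq> 0" "pord p t = 1"
    using hprime_uniformiser[OF assms(1) assms(1)] by blast
  have *: "v f = pord p f * v t" if f: "f \<in> ?K" "f \<noteq> 0" for f
  proof -
    define u where "u = f * t powi (- pord p f)"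
    have u: "u \<in> ?K" "u \<noteq> 0"
      unfolding u_def using K f t by (auto simp: power_int_eq_0_iff)
    have "pord p u = 0"
      unfolding u_def using f t by (simp add: pord_mult[OF p] pord_power_int[OF p] power_int_eq_0_iff)
    hence "u \<in> divisor_ring p" "inverse u \<in> divisor_ring p"
      using u K(2)[OF u(1) u(1)] by (auto simp: divisor_ring_def pord_inverse[OF p])
    hence "v u = 0"
      using ring u K(2)[OF u(1) u(1)] inv[OF u] by fastforce
    moreover have "v u = v f + - pord p f * v t"
      unfolding u_def using mult[of f "t powi (- pord p f)"] powi[OF t(1,2)] K(3)[OF t(1) t(1)] f t(2)
      by (simp add: power_int_eq_0_iff)
    ultimately show ?thesis
      by simp
  qed
  \<comment> \<open>Some value of \<open>v\<close> is 1, so \<open>v t\<close> divides 1; it is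
    nonnegative because \<open>t\<close> lies in the ring.\<close>
  obtain g where "g \<in> ?K" "g \<noteq> 0" "v g = 1"
    using v unfolding normalised_valuation_def by blast
  hence "pord p g * v t = 1"
    using * by simp
  moreover have "v t \<ge> 0"
    using ring[OF t(1,2)] t by (simp add: divisor_ring_def)
  ultimately have "v t = 1"
    using zmult_eq_1_iff[of "pord p g" "v t"] by linarith
  thus ?thesis
    using * f by simp
qed

lemma ord_along_bundle:
  assumes "hprime p" "f \<in> hfracs 0 0" "f \<noteq> 0"
  shows "ord_along PE (divisor_ring p) f = pord p f"
  unfolding ord_along_def function_field_bundle
proof (rule the_equality)
  show "\<exists>v. normalised_valuation (hfracs 0 0) (divisor_ring p) v \<and> v f = pord p f"
    using normalised_valuation_pord[OF assms(1)] by blast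
  fix m assume "\<exists>v. normalised_valuation (hfracs 0 0) (divisor_ring p) v \<and> v f = m"
  then obtain v where "normalised_valuation (hfracs 0 0) (divisor_ring p) v" "v f = m"
    by blast
  thus "m = pord p f"
    using normalised_valuation_unique[OF assms(1) _ assms(2,3)] by metis
qed

text \<open>This is why the uniformiser is controlled at two primes: \<open>inverse t\<close> is
  outside the ring of \<open>p\<close>, hence outside that of \<open>q\<close>, and the order of
  \<open>t\<close> at \<open>q\<close> is \<open>pval q p\<close>.\<close>

lemma divisor_ring_dvd:
  assumes "hprime p" "hprime q" "divisor_ring p = divisor_ring q"
  shows "q dvd p"
proof -
  have p: "prime_elem p" and q: "prime_elem q"
    using assms by (auto simp: hprime_def)
  obtain t where t: "t \<in> hfracs 0 0" "t \<noteq> 0" "pord p t = 1" "pord q t = int (pval q p)"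
    using hprime_uniformiser[OF assms(1,2)] .
  have "inverse t \<notin> divisor_ring q"
    unfolding assms(3)[symmetric] using t pord_inverse[OF p t(2)] by (simp add: divisor_ring_def)
  moreover have "inverse t \<in> hfracs 0 0"
    using hfracs_inverse[OF t(1)] by simp
  ultimately have "0 < pval q p"
    using t pord_inverse[OF q t(2)] by (simp add: divisor_ring_def)
  thus ?thesis
    using pval_pos_iff[OF q] p by auto
qed

lemma pord_associated:
  assumes "prime_elem p" "prime_elem q" "p dvd q" "q dvd p" "g \<noteq> 0"
  shows "pord p g = pord q g"
proof -
  have "pval p F = pval q F" if "F \<noteq> 0" for F
  proof -
    have "p ^ k dvd F \<longleftrightarrow> q ^ k dvd F" for k
      using assms(3,4) dvd_power_same dvd_trans by metis
    hence "k \<le> pval p F \<longleftrightarrow> k \<le> pval q F" for k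
      using pval_ge_iff[OF assms(1) that] pval_ge_iff[OF assms(2) that] by simp
    thus ?thesis
      using order_antisym by blast
  qed
  moreover obtain F G where "F \<noteq> 0" "G \<noteq> 0" "g = emb F / emb G"
    using nonzero_frac[OF assms(1,5)] .
  ultimately show ?thesis
    using pord_frac[OF assms(1)] pord_frac[OF assms(2)] by simp
qed

lemma divisor_ring_pord:
  assumes "hprime p" "hprime q" "divisor_ring p = divisor_ring q" "g \<noteq> 0"
  shows "pord p g = pord q g"
  using assms divisor_ring_dvd[of p q] divisor_ring_dvd[of q p]
  by (intro pord_associated) (auto simp: hprime_def)

end

section \<open>The divisor class group\<close>

text \<open>Lets \<open>degree_of\<close> replace the map to cosets when testing whether
  \<open>L\<close> maps bijectively onto the class group.\<close>

lemma same_fibres: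
  assumes eq: "\<And>x y. x \<in> A \<Longrightarrow> y \<in> A \<Longrightarrow> f x = f y \<longleftrightarrow> g x = g y" and "L \<subseteq> A"
  shows "inj_on f L \<longleftrightarrow> inj_on g L" and "f ` L = f ` A \<longleftrightarrow> g ` L = g ` A"
proof -
  show "inj_on f L \<longleftrightarrow> inj_on g L"
    using assms unfolding inj_on_def by blast
  have "f ` L = f ` A \<longleftrightarrow> (\<forall>x\<in>A. \<exists>y\<in>L. f x = f y)"
    using \<open>L \<subseteq> A\<close> by (auto simp: image_iff set_eq_iff) ((metis subsetD)+)?
  also have "\<dots> \<longleftrightarrow> (\<forall>x\<in>A. \<exists>y\<in>L. g x = g y)"
    using assms by (meson subsetD)
  also have "\<dots> \<longleftrightarrow> g ` L = g ` A"
    using \<open>L \<subseteq> A\<close> by (auto simp: image_iff set_eq_iff) ((metis subsetD)+)?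
  finally show "f ` L = f ` A \<longleftrightarrow> g ` L = g ` A" .
qed

context dual_bundle
begin

lemma pord_emb_hprime:
  assumes "hprime p" "hprime q"
  shows "pord q (emb p) = (if divisor_ring p = divisor_ring q then 1 else 0)"
proof -
  have p: "prime_elem p" and q: "prime_elem q"
    using assms by (auto simp: hprime_def)
  have p0: "p \<noteq> 0" "emb p \<noteq> 0"
    using p by (auto simp: emb_eq_0_iff)
  show ?thesis
  proof (cases "divisor_ring p = divisor_ring q")
    case True
    hence "pord q (emb p) = pord p (emb p)"
      using divisor_ring_pord[OF assms True p0(2)] by simp
    thus ?thesis
      using True pord_emb[OF p p0(1)] pval_self[OF p] by simp
  next
    case False
    have "\<not> q dvd p"
    proof
      assume qp: "q dvd p"
      then obtain r where r: "p = q * r"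
        by (auto elim: dvdE)
      have "p dvd q"
      proof (rule ccontr)
        assume "\<not> p dvd q"
        hence "p dvd r"
          using prime_elem_dvd_multD[OF p, of q r] r by simp
        then obtain s where "r = p * s"
          by (auto elim: dvdE)
        hence "p * 1 = p * (q * s)"
          using r by (simp add: mult.left_commute)
        hence "1 = q * s"
          using p0(1) by (simp only: mult_cancel_left) simp
        hence "q dvd 1"
          by (rule dvdI)
        thus False
          using prime_elem_not_unit[OF q] by blast
      qed
      hence "pord p g = pord q g" if "g \<noteq> 0" for g
        using pord_associated[OF p q _ qp that] by blast
      hence "divisor_ring p = divisor_ring q"
        unfolding divisor_ring_def by (intro Collect_cong) metis
      thus False
        using False by blast
    qed
    thus ?thesis
      using False pord_emb[OF q p0(1)] pval_not_dvd[OF q] by simp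
  qed
qed

definition divisors :: "(ambient set \<Rightarrow>\<^sub>0 int) set" where
  "divisors = {D. keys D \<subseteq> prime_divisors PE}"

lemma carrier_divisor_group: "carrier (divisor_group PE) = divisors"
  by (simp add: divisor_group_def divisors_def)

lemma divisors_0: "0 \<in> divisors"
  by (simp add: divisors_def)

lemma divisors_add: "D \<in> divisors \<Longrightarrow> E \<in> divisors \<Longrightarrow> D + E \<in> divisors"
  using keys_add[of D E] by (auto simp: divisors_def)

lemma divisors_uminus: "D \<in> divisors \<Longrightarrow> - D \<in> divisors"
  by (simp add: divisors_def)

lemma divisors_cmul: "D \<in> divisors \<Longrightarrow> frag_cmul m D \<in> divisors"
  using keys_cmul[of m D] by (auto simp: divisors_def)

lemma divisors_prime: "hprime p \<Longrightarrow> frag_of (divisor_ring p) \<in> divisors"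
  by (simp add: divisors_def prime_divisors_bundle)

text \<open>The element \<open>g\<close> may be a homogeneous fraction of any bidegree, so
  coordinates and minors have divisors too; principal divisors are the case of bidegree (0,
  0).\<close>

definition is_div :: "(ambient set \<Rightarrow>\<^sub>0 int) \<Rightarrow> ambient \<Rightarrow> bool" where
  "is_div D g \<longleftrightarrow> D \<in> divisors \<and> (\<forall>p. hprime p \<longrightarrow> lookup D (divisor_ring p) = pord p g)"

lemma is_div_0: "is_div 0 1"
  by (auto simp: is_div_def divisors_0 hprime_def pord_1)

lemma is_div_add:
  "is_div D g \<Longrightarrow> is_div E h \<Longrightarrow> g \<noteq> 0 \<Longrightarrow> h \<noteq> 0 \<Longrightarrow> is_div (D + E) (g * h)"
  by (auto simp: is_div_def divisors_add lookup_add hprime_def pord_mult)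

lemma is_div_uminus: "is_div D g \<Longrightarrow> g \<noteq> 0 \<Longrightarrow> is_div (- D) (inverse g)"
  by (auto simp: is_div_def divisors_uminus hprime_def pord_inverse)

lemma is_div_cmul: "is_div D g \<Longrightarrow> g \<noteq> 0 \<Longrightarrow> is_div (frag_cmul m D) (g powi m)"
  by (auto simp: is_div_def divisors_cmul hprime_def pord_power_int)

lemma is_div_diff:
  "is_div D g \<Longrightarrow> is_div E h \<Longrightarrow> g \<noteq> 0 \<Longrightarrow> h \<noteq> 0 \<Longrightarrow> is_div (D - E) (g / h)"
  using is_div_add[OF _ is_div_uminus, of D g E h] by (simp add: divide_inverse)

lemma is_div_prime: "hprime p \<Longrightarrow> is_div (frag_of (divisor_ring p)) (emb p)"
  by (auto simp: is_div_def divisors_prime pord_emb_hprime)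

lemma section_is_div:
  assumes "F \<in> sections d k" "F \<noteq> 0"
  shows "\<exists>D. is_div D (emb F)"
  using assms
proof (induction "tdeg F" arbitrary: F d k rule: less_induct)
  case less
  show ?case
  proof (cases "F dvd 1")
    case True
    have "is_div 0 (emb F)"
      unfolding is_div_def
    proof (intro conjI allI impI divisors_0)
      fix p assume "hprime p"
      hence p: "prime_elem p"
        by (simp add: hprime_def)
      have "\<not> p dvd F"
        using True prime_elem_not_unit[OF p] dvd_trans by blast
      thus "lookup 0 (divisor_ring p) = pord p (emb F)"
        using pord_emb[OF p less.prems(2)] pval_not_dvd[OF p] by simp
    qed
    thus ?thesis ..
  next
    case False
    obtain p F' d1 k1 d2 k2 where *: "F = p * F'" "hprime p" "p \<in> sections d1 k1" "F' \<in> sections d2 k2" "F' \<noteq> 0"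
      "d1 + d2 = d" "k1 + k2 = k" "tdeg F' < tdeg F"
      using section_prime_factor[OF less.prems False] .
    obtain D where "is_div D (emb F')"
      using less.hyps[OF *(8,4,5)] by blast
    hence "is_div (frag_of (divisor_ring p) + D) (emb p * emb F')"
      using *(1,5) less.prems(2) by (intro is_div_add is_div_prime *(2)) (auto simp: emb_eq_0_iff)
    thus ?thesis
      unfolding *(1) emb_mult by blast
  qed
qed

text \<open>Without poles, every prime factor of the denominator also divides the numerator.
  Cancelling lowers the degree of the denominator until it is a constant.\<close>

lemma effective_section:
  assumes "h \<in> hfracs d k" "h \<noteq> 0" "\<And>p. hprime p \<Longrightarrow> 0 \<le> pord p h"
  shows "\<exists>F\<in>sections d k. h = emb F"
proof -
  obtain F G e l where f: "h = emb F / emb G" "G \<noteq> 0" "F \<in> sections (e + d) (l + k)" "G \<in> sections e l"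
    using assms(1) by (rule hfracsE)
  have "\<exists>F\<in>sections d k. h = emb F"
    if "h = emb F / emb G" "G \<noteq> 0" "F \<in> sections (e + d) (l + k)" "G \<in> sections e l" for F G e l
    using that
  proof (induction "tdeg G" arbitrary: F G e l rule: less_induct)
    case less
    have F0: "F \<noteq> 0"
      using less.prems(1) assms(2) by (auto simp: emb_0)
    show ?case
    proof (cases "G dvd 1")
      case True
      then obtain c where c: "c \<noteq> 0" "G = mconst c"
        using unit_mconst by blast
      have "G \<in> sections 0 0"
        unfolding c by (rule sections_mconst)
      hence el: "e = 0" "l = 0"
        using sections_degree_unique[OF less.prems(4) _ less.prems(2)] by blast+
      have "mconst (inverse c) * F \<in> sections d k"
        by (rule sections_mult[OF sections_mconst less.prems(3)]) (auto simp: el)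
      moreover have "mconst (inverse c) * G = 1"
        using c by (simp add: is_hom_mult[OF is_hom_mconst, symmetric] mconst_1)
      hence "emb F = emb (mconst (inverse c) * F) * emb G"
        unfolding emb_mult[symmetric] by (simp add: mult.commute mult.left_commute)
      hence "h = emb (mconst (inverse c) * F)"
        using less.prems(1,2) by (simp add: emb_eq_0_iff)
      ultimately show ?thesis
        by blast
    next
      case False
      obtain p G' d1 k1 d2 k2 where *: "G = p * G'" "hprime p" "p \<in> sections d1 k1" "G' \<in> sections d2 k2" "G' \<noteq> 0"
        "d1 + d2 = e" "k1 + k2 = l" "tdeg G' < tdeg G"
        using section_prime_factor[OF less.prems(4,2) False] .
      have p: "prime_elem p" and p0: "p \<noteq> 0"
        using *(2) by (auto simp: hprime_def)
      have "pval p G \<le> pval p F"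
        using assms(3)[OF *(2)] pord_frac[OF p F0 less.prems(2)] less.prems(1) by simp
      moreover have "0 < pval p G"
        using pval_pos_iff[OF p less.prems(2)] *(1) by simp
      ultimately have "p dvd F"
        using pval_pos_iff[OF p F0] by simp
      then obtain F' where F': "F = p * F'"
        by (auto elim: dvdE)
      have "F' \<in> sections (e + d - d1) (l + k - k1)"
        using sections_cofactor[OF _ *(3) p0] less.prems(3) F' by simp
      moreover have "e + d - d1 = d2 + d" "l + k - k1 = k2 + k"
        using *(6,7) by auto
      ultimately have "F' \<in> sections (d2 + d) (k2 + k)"
        by simp
      moreover have "h = emb F' / emb G'"
        using less.prems(1) p0 by (simp add: F' *(1) emb_mult emb_eq_0_iff)
      ultimately show ?thesis
        using less.hyps[OF *(8) _ *(5) _ *(4)] by blast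
    qed
  qed
  thus ?thesis
    using f by blast
qed

text \<open>The quotient of two fractions with the same divisor has order 0 everywhere, so it is a
  nonzero polynomial section and its degrees are nonnegative; exchanging the two gives
  equality.\<close>

lemma is_div_degree:
  assumes "is_div D g" "is_div D h" "g \<in> hfracs d k" "h \<in> hfracs e l" "g \<noteq> 0" "h \<noteq> 0"
  shows "(d, k) = (e, l)"
proof -
  have le: "0 \<le> d - e \<and> 0 \<le> k - l"
    if gh: "is_div D g" "is_div D h" "g \<in> hfracs d k" "h \<in> hfracs e l" "g \<noteq> 0" "h \<noteq> 0" for g h d k e l
  proof -
    have "is_div (D - D) (g / h)"
      using gh by (intro is_div_diff)
    hence "0 \<le> pord p (g / h)" if "hprime p" for p
      using that unfolding is_div_def by auto
    then obtain F where F: "F \<in> sections (d - e) (k - l)" "g / h = emb F"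
      using effective_section[OF hfracs_divide[OF gh(3,4)]] gh(5,6) by auto
    have "F \<noteq> 0"
      using F(2) gh(5,6) by (auto simp: emb_0)
    thus ?thesis
      using sections_nonneg[OF F(1)] by simp
  qed
  show ?thesis
    using le[OF assms] le[OF assms(2,1,4,3,6,5)] by simp
qed

text \<open>The generators of the prime divisors split the divisor map on homogeneous fractions.\<close>

definition generator :: "ambient set \<Rightarrow> (nat, complex) mpoly" where
  "generator V = (if V \<in> prime_divisors PE then SOME p. hprime p \<and> divisor_ring p = V else 1)"

text \<open>For a divisor \<open>D\<close>, a homogeneous fraction with divisor \<open>D\<close>,
  chosen multiplicatively. The default 1 of \<open>generator\<close> makes the product rule
  \<open>gen_frac_add\<close> hold for every \<open>D\<close>.\<close>

definition gen_frac :: "(ambient set \<Rightarrow>\<^sub>0 int) \<Rightarrow> ambient" where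
  "gen_frac D = (\<Prod>V\<in>keys D. emb (generator V) powi lookup D V)"

lemma generator:
  assumes "V \<in> prime_divisors PE"
  shows "hprime (generator V)" "divisor_ring (generator V) = V"
proof -
  have "\<exists>p. hprime p \<and> divisor_ring p = V"
    using assms unfolding prime_divisors_bundle by blast
  from someI_ex[OF this] show "hprime (generator V)" "divisor_ring (generator V) = V"
    using assms by (auto simp: generator_def)
qed

lemma generator_neq_0: "emb (generator V) \<noteq> 0"
proof (cases "V \<in> prime_divisors PE")
  case True
  thus ?thesis
    using generator[OF True] by (auto simp: hprime_def emb_eq_0_iff)
qed (simp add: generator_def emb_1)

lemma gen_frac_superset:
  assumes "finite A" "keys D \<subseteq> A"
  shows "gen_frac D = (\<Prod>V\<in>A. emb (generator V) powi lookup D V)"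
  unfolding gen_frac_def
  by (rule prod.mono_neutral_left) (use assms in \<open>auto simp: in_keys_iff\<close>)

lemma gen_frac_0: "gen_frac 0 = 1"
  by (simp add: gen_frac_def)

lemma gen_frac_add: "gen_frac (D + E) = gen_frac D * gen_frac E"
proof -
  let ?A = "keys D \<union> keys E"
  have *: "keys D \<subseteq> ?A" "keys E \<subseteq> ?A" "keys (D + E) \<subseteq> ?A"
    using keys_add[of D E] by auto
  show ?thesis
    unfolding gen_frac_superset[OF _ *(1), simplified] gen_frac_superset[OF _ *(2), simplified]
      gen_frac_superset[OF _ *(3), simplified]
    by (simp add: lookup_add power_int_add generator_neq_0 prod.distrib)
qed

lemma gen_frac_neq_0: "gen_frac D \<noteq> 0"
  by (simp add: gen_frac_def generator_neq_0 power_int_eq_0_iff)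

lemma gen_frac_uminus: "gen_frac (- D) = inverse (gen_frac D)"
  using gen_frac_add[of D "- D"] gen_frac_neq_0[of D] by (simp add: gen_frac_0 inverse_unique)

lemma gen_frac_diff: "gen_frac (D - E) = gen_frac D / gen_frac E"
  using gen_frac_add[of D "- E"] by (simp add: gen_frac_uminus divide_inverse)

lemma gen_frac_prime: "V \<in> prime_divisors PE \<Longrightarrow> gen_frac (frag_of V) = emb (generator V)"
  by (simp add: gen_frac_def)

lemma gen_frac_is_div:
  assumes "D \<in> divisors"
  shows "is_div D (gen_frac D) \<and> (\<exists>d k. gen_frac D \<in> hfracs d k)"
proof -
  have "keys D \<subseteq> prime_divisors PE"
    using assms by (simp add: divisors_def)
  thus ?thesis
  proof (induction rule: frag_induction)
    case zero
    show ?case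
      using is_div_0 hfracs_1 by (auto simp: gen_frac_0)
  next
    case (one V)
    have V: "hprime (generator V)" "divisor_ring (generator V) = V"
      using generator[OF one] .
    then obtain d k where "generator V \<in> sections d k"
      by (auto simp: hprime_def)
    hence "gen_frac (frag_of V) \<in> hfracs d k"
      unfolding gen_frac_prime[OF one] by (rule hfracs_section)
    moreover have "is_div (frag_of V) (gen_frac (frag_of V))"
      unfolding gen_frac_prime[OF one] using is_div_prime[OF V(1)] V(2) by simp
    ultimately show ?case
      by blast
  next
    case (diff D E)
    thus ?case
      using is_div_diff[OF _ _ gen_frac_neq_0 gen_frac_neq_0] hfracs_divide
      unfolding gen_frac_diff by blast
  qed
qed

definition degree_of :: "(ambient set \<Rightarrow>\<^sub>0 int) \<Rightarrow> int \<times> int" where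
  "degree_of D = (THE dk. gen_frac D \<in> hfracs (fst dk) (snd dk))"

lemma degree_ofI:
  assumes "is_div D g" "g \<in> hfracs d k" "g \<noteq> 0"
  shows "degree_of D = (d, k)"
proof -
  have D: "D \<in> divisors"
    using assms(1) by (simp add: is_div_def)
  obtain d' k' where *: "is_div D (gen_frac D)" "gen_frac D \<in> hfracs d' k'"
    using gen_frac_is_div[OF D] by blast
  have "(d, k) = (d', k')"
    by (rule is_div_degree[OF assms(1) *(1) assms(2) *(2) assms(3) gen_frac_neq_0])
  hence "gen_frac D \<in> hfracs d k"
    using *(2) by simp
  thus ?thesis
    unfolding degree_of_def
    using hfracs_degree_unique[OF _ _ gen_frac_neq_0, of D] by (intro the_equality) (auto simp: prod_eq_iff)
qed

lemma gen_frac_degree: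
  assumes "D \<in> divisors"
  shows "is_div D (gen_frac D)" "gen_frac D \<in> hfracs (fst (degree_of D)) (snd (degree_of D))"
  using gen_frac_is_div[OF assms] degree_ofI[OF _ _ gen_frac_neq_0, of D D] by auto

lemma degree_of_0: "degree_of 0 = (0, 0)"
  by (rule degree_ofI[OF is_div_0 hfracs_1]) simp

lemma degree_of_add:
  assumes "D \<in> divisors" "E \<in> divisors"
  shows "degree_of (D + E) = degree_of D + degree_of E"
  using degree_ofI[OF is_div_add[OF gen_frac_degree(1)[OF assms(1)] gen_frac_degree(1)[OF assms(2)] gen_frac_neq_0 gen_frac_neq_0]
      hfracs_mult[OF gen_frac_degree(2)[OF assms(1)] gen_frac_degree(2)[OF assms(2)]]]
    gen_frac_neq_0
  by (simp add: prod_eq_iff)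

lemma degree_of_uminus:
  assumes "D \<in> divisors"
  shows "degree_of (- D) = - degree_of D"
  using degree_of_add[OF assms divisors_uminus[OF assms]] degree_of_0
  by (simp add: prod_eq_iff)

lemma degree_of_cmul:
  assumes "D \<in> divisors"
  shows "degree_of (frag_cmul m D) = (m * fst (degree_of D), m * snd (degree_of D))"
  using degree_ofI[OF is_div_cmul[OF gen_frac_degree(1)[OF assms] gen_frac_neq_0]
      hfracs_power_int[OF gen_frac_degree(2)[OF assms]]] gen_frac_neq_0
  by (simp add: power_int_eq_0_iff)

lemma degree_of_surj: "\<exists>D\<in>divisors. degree_of D = (d, k)"
proof -
  \<comment> \<open>Of bidegree (0, 1), while \<open>x 0\<close> has bidegree (1, 0); powers of
    these two reach every bidegree.\<close>
  define z where "z = emb (minor 0 1) / emb (x 0 ^ (a 0 + a 1))"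
  have n: "0 \<le> n" "1 \<le> n"
    using n2 by auto
  have m0: "minor 0 1 \<noteq> 0"
    by (rule minor_neq_0) (use n in auto)
  have x0: "x 0 \<noteq> 0" "x 0 ^ (a 0 + a 1) \<noteq> 0"
    by (simp_all add: mvar_neq_0)
  have z: "z \<in> hfracs 0 1" "z \<noteq> 0"
    unfolding z_def
    using hfracsI[OF sections_minor[OF n] sections_x_power[OF n(1), of "a 0 + a 1"] x0(2), of 0 1] m0 x0(2)
    by (auto simp: emb_eq_0_iff simp del: power_eq_0_iff)
  obtain A where A: "is_div A (emb (x 0))"
    using section_is_div[OF sections_x[OF n(1)] x0(1)] by blast
  obtain B1 B2 where "is_div B1 (emb (minor 0 1))" "is_div B2 (emb (x 0 ^ (a 0 + a 1)))"
    using section_is_div[OF sections_minor[OF n] m0] section_is_div[OF sections_x_power[OF n(1)] x0(2)] by blast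
  hence B: "is_div (B1 - B2) z"
    unfolding z_def using m0 x0(2) by (intro is_div_diff) (auto simp: emb_eq_0_iff simp del: power_eq_0_iff)
  have "is_div (frag_cmul d A + frag_cmul k (B1 - B2)) (emb (x 0) powi d * z powi k)"
    using x0(1) z(2) by (intro is_div_add is_div_cmul A B) (auto simp: emb_eq_0_iff power_int_eq_0_iff)
  moreover have "emb (x 0) powi d * z powi k \<in> hfracs (d * 1 + k * 0) (d * 0 + k * 1)"
    by (intro hfracs_mult hfracs_power_int z(1) hfracs_section sections_x n)
  ultimately have "degree_of (frag_cmul d A + frag_cmul k (B1 - B2)) = (d, k)"
    using degree_ofI x0(1) z(2) by (fastforce simp: emb_eq_0_iff power_int_eq_0_iff)
  moreover have "frag_cmul d A + frag_cmul k (B1 - B2) \<in> divisors"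
    using A B unfolding is_div_def by (intro divisors_add divisors_cmul) auto
  ultimately show ?thesis
    by blast
qed

text \<open>A divisor of bidegree (0, 0) is the divisor of \<open>gen_frac D\<close>, which then is
  a rational function on the bundle.\<close>

lemma principal_divisors_eq: "principal_divisors PE = {D \<in> divisors. degree_of D = (0, 0)}"
proof (intro equalityI subsetI)
  fix D assume "D \<in> principal_divisors PE"
  then obtain f where f: "D \<in> divisors" "f \<in> hfracs 0 0" "f \<noteq> 0"
    "\<And>V. V \<in> prime_divisors PE \<Longrightarrow> lookup D V = ord_along PE V f"
    unfolding principal_divisors_def carrier_divisor_group function_field_bundle by blast
  have "is_div D f"
    unfolding is_div_def using f ord_along_bundle[OF _ f(2,3)] by (auto simp: prime_divisors_bundle)
  thus "D \<in> {D \<in> divisors. degree_of D = (0, 0)}"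
    using degree_ofI[OF _ f(2,3)] f(1) by simp
next
  fix D assume D: "D \<in> {D \<in> divisors. degree_of D = (0, 0)}"
  hence g: "is_div D (gen_frac D)" "gen_frac D \<in> hfracs 0 0"
    using gen_frac_degree[of D] by auto
  have "lookup D V = ord_along PE V (gen_frac D)" if "V \<in> prime_divisors PE" for V
    using that g ord_along_bundle[OF _ g(2) gen_frac_neq_0] unfolding prime_divisors_bundle is_div_def by auto
  thus "D \<in> principal_divisors PE"
    unfolding principal_divisors_def carrier_divisor_group function_field_bundle
    using D g(2) gen_frac_neq_0 by (intro CollectI conjI bexI[of _ "gen_frac D"]) auto
qed

lemma principal_coset:
  assumes "D \<in> divisors"
  shows "principal_divisors PE #>\<^bsub>divisor_group PE\<^esub> D = {E \<in> divisors. degree_of E = degree_of D}"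
proof (intro equalityI subsetI)
  fix E assume "E \<in> principal_divisors PE #>\<^bsub>divisor_group PE\<^esub> D"
  then obtain P where P: "E = P + D" "P \<in> divisors" "degree_of P = (0, 0)"
    unfolding r_coset_def principal_divisors_eq by (auto simp: divisor_group_def)
  thus "E \<in> {E \<in> divisors. degree_of E = degree_of D}"
    using assms degree_of_add[of P D] by (simp add: divisors_add flip: zero_prod_def)
next
  fix E assume E: "E \<in> {E \<in> divisors. degree_of E = degree_of D}"
  hence "E - D \<in> divisors" "degree_of (E - D) = (0, 0)"
    using degree_of_add[OF _ divisors_uminus[OF assms], of E] degree_of_uminus[OF assms]
      divisors_add[OF _ divisors_uminus[OF assms], of E] by (auto simp: zero_prod_def)
  hence "E - D \<in> principal_divisors PE"
    unfolding principal_divisors_eq by simp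
  moreover have "E = (E - D) \<otimes>\<^bsub>divisor_group PE\<^esub> D"
    by (simp add: divisor_group_def)
  ultimately show "E \<in> principal_divisors PE #>\<^bsub>divisor_group PE\<^esub> D"
    unfolding r_coset_def by blast
qed

text \<open>Linear equivalence is equality of bidegrees, and all bidegrees occur: the class group is
  free of rank two.\<close>

lemma class_group_lift_iff:
  "class_group_lift PE L \<longleftrightarrow> subgroup L (divisor_group PE) \<and> bij_betw degree_of L UNIV"
proof (cases "L \<subseteq> divisors")
  case False
  hence "\<not> subgroup L (divisor_group PE)"
    using subgroup.subset[of L "divisor_group PE"] by (auto simp: carrier_divisor_group)
  thus ?thesis
    unfolding class_group_lift_def by blast
next
  case True
  let ?c = "\<lambda>D. principal_divisors PE #>\<^bsub>divisor_group PE\<^esub> D"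
  have c: "?c D = ?c E \<longleftrightarrow> degree_of D = degree_of E" if "D \<in> divisors" "E \<in> divisors" for D E
    using that principal_coset[OF that(1)] principal_coset[OF that(2)] by auto
  have carr: "carrier (class_group PE) = ?c ` divisors"
    unfolding class_group_def FactGroup_def RCOSETS_def carrier_divisor_group by auto
  have "degree_of ` divisors = UNIV"
    using degree_of_surj by (auto simp: image_iff) (metis)
  thus ?thesis
    unfolding class_group_lift_def bij_betw_def carr
    using same_fibres[OF c True] by simp
qed

lemma divisor_group_simps:
  "D \<otimes>\<^bsub>divisor_group PE\<^esub> E = D + E" "\<one>\<^bsub>divisor_group PE\<^esub> = 0"
  by (simp_all add: divisor_group_def)

lemma group_divisor_group: "group (divisor_group PE)"
proof (rule groupI)
  fix D assume "D \<in> carrier (divisor_group PE)"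
  thus "\<exists>E\<in>carrier (divisor_group PE). E \<otimes>\<^bsub>divisor_group PE\<^esub> D = \<one>\<^bsub>divisor_group PE\<^esub>"
    by (intro bexI[of _ "- D"]) (auto simp: divisor_group_simps carrier_divisor_group divisors_uminus)
qed (auto simp: divisor_group_simps carrier_divisor_group divisors_add divisors_0 add.assoc)

lemma inv_divisor_group: "D \<in> divisors \<Longrightarrow> inv\<^bsub>divisor_group PE\<^esub> D = - D"
  by (rule group.inv_equality[OF group_divisor_group])
    (auto simp: divisor_group_simps carrier_divisor_group divisors_uminus)

lemma class_group_lift_exists: "\<exists>L. class_group_lift PE L"
proof -
  obtain A where A: "A \<in> divisors" "degree_of A = (1, 0)"
    using degree_of_surj by blast
  obtain B where B: "B \<in> divisors" "degree_of B = (0, 1)"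
    using degree_of_surj by blast
  define D where "D dk = frag_cmul (fst dk) A + frag_cmul (snd dk) B" for dk :: "int \<times> int"
  have Dd: "D dk \<in> divisors" for dk
    unfolding D_def by (intro divisors_add divisors_cmul A B)
  have add: "D dk + D el = D (dk + el)" for dk el
    by (simp add: D_def frag_cmul_distrib algebra_simps)
  have minus: "- D dk = D (- dk)" for dk
    by (simp add: D_def)
  have deg: "degree_of (D dk) = dk" for dk
    unfolding D_def
    using degree_of_add[OF divisors_cmul[OF A(1)] divisors_cmul[OF B(1)]] A(2) B(2)
      degree_of_cmul[OF A(1)] degree_of_cmul[OF B(1)]
    by (simp add: prod_eq_iff)
  have "subgroup (range D) (divisor_group PE)"
  proof (rule subgroup.intro)
    show "range D \<subseteq> carrier (divisor_group PE)"
      using Dd by (auto simp: carrier_divisor_group)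
    show "\<one>\<^bsub>divisor_group PE\<^esub> \<in> range D"
      by (auto simp: divisor_group_simps D_def intro!: image_eqI[of _ _ "(0, 0)"])
  qed (use add minus inv_divisor_group Dd in \<open>auto simp: divisor_group_simps\<close>)
  moreover have "bij_betw degree_of (range D) UNIV"
    using deg by (intro bij_betw_byWitness[where f' = D]) auto
  ultimately show ?thesis
    unfolding class_group_lift_iff by blast
qed

end

section \<open>The Cox ring\<close>

locale class_lift = dual_bundle +
  fixes L :: "(ambient set \<Rightarrow>\<^sub>0 int) set"
  assumes lift: "class_group_lift (proj_dual_bundle n a) L"
begin

lemma lift_subgroup: "subgroup L (divisor_group PE)" and lift_bij: "bij_betw degree_of L UNIV"
  using lift unfolding class_group_lift_iff by auto

lemma lift_divisors: "D \<in> L \<Longrightarrow> D \<in> divisors"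
  using subgroup.subset[OF lift_subgroup] by (auto simp: carrier_divisor_group)

lemma lift_0: "0 \<in> L"
  using subgroup.one_closed[OF lift_subgroup] by (simp add: divisor_group_simps)

lemma lift_add: "D \<in> L \<Longrightarrow> E \<in> L \<Longrightarrow> D + E \<in> L"
  using subgroup.m_closed[OF lift_subgroup, of D E] by (simp add: divisor_group_simps)

definition lift_of :: "int \<Rightarrow> int \<Rightarrow> ambient set \<Rightarrow>\<^sub>0 int" where
  "lift_of d k = inv_into L degree_of (d, k)"

lemma lift_of: "lift_of d k \<in> L" "degree_of (lift_of d k) = (d, k)"
  using lift_bij inv_into_into[of "(d, k)" degree_of L] f_inv_into_f[of "(d, k)" degree_of L]
  by (auto simp: lift_of_def bij_betw_def)

text \<open>Multiplication by \<open>gen_frac D\<close> shifts the order along each prime divisor by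
  the coefficient of \<open>D\<close>. The condition on \<open>f\<close> becomes that the product
  has no poles, which is \<open>effective_section\<close>.\<close>

lemma H0_iff:
  assumes "D \<in> divisors" "degree_of D = (d, k)"
  shows "f \<in> H0 PE D \<longleftrightarrow> (\<exists>F\<in>sections d k. f * gen_frac D = emb F)"
proof
  note g = gen_frac_degree[OF assms(1), unfolded assms(2) fst_conv snd_conv]
  assume f: "f \<in> H0 PE D"
  show "\<exists>F\<in>sections d k. f * gen_frac D = emb F"
  proof (cases "f = 0")
    case True
    thus ?thesis
      using sections_0 by (auto simp: emb_0 intro!: bexI[of _ 0])
  next
    case False
    have fK: "f \<in> hfracs 0 0" and ord: "\<And>V. V \<in> prime_divisors PE \<Longrightarrow> 0 \<le> ord_along PE V f + lookup D V"
      using f False unfolding H0_def function_field_bundle by auto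
    have "f * gen_frac D \<in> hfracs d k"
      using hfracs_mult[OF fK g(2)] by simp
    moreover have "f * gen_frac D \<noteq> 0"
      using False gen_frac_neq_0 by simp
    moreover have "0 \<le> pord p (f * gen_frac D)" if p: "hprime p" for p
    proof -
      have "divisor_ring p \<in> prime_divisors PE"
        using p by (simp add: prime_divisors_bundle)
      hence "0 \<le> pord p f + lookup D (divisor_ring p)"
        using ord ord_along_bundle[OF p fK False] by metis
      also have "\<dots> = pord p (f * gen_frac D)"
        using g(1) p False gen_frac_neq_0 by (simp add: is_div_def hprime_def pord_mult)
      finally show ?thesis .
    qed
    ultimately show ?thesis
      using effective_section by metis
  qed
next
  note g = gen_frac_degree[OF assms(1), unfolded assms(2) fst_conv snd_conv]
  assume "\<exists>F\<in>sections d k. f * gen_frac D = emb F"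
  then obtain F where F: "F \<in> sections d k" "f * gen_frac D = emb F"
    by blast
  have f: "f = emb F / gen_frac D"
    using F(2) gen_frac_neq_0 by (simp add: eq_divide_eq)
  have fK: "f \<in> hfracs 0 0"
    using hfracs_divide[OF hfracs_section[OF F(1)] g(2)] unfolding f by simp
  have "0 \<le> ord_along PE V f + lookup D V" if f0: "f \<noteq> 0" and V: "V \<in> prime_divisors PE" for V
  proof -
    obtain p where p: "hprime p" "V = divisor_ring p"
      using V unfolding prime_divisors_bundle by blast
    have pe: "prime_elem p"
      using p(1) by (simp add: hprime_def)
    have F0: "F \<noteq> 0"
      using f0 f by (auto simp: emb_0)
    have "ord_along PE V f + lookup D V = pord p f + pord p (gen_frac D)"
      using ord_along_bundle[OF p(1) fK f0] g(1) p by (simp add: is_div_def)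
    also have "\<dots> = pord p (emb F)"
      using pord_mult[OF pe f0 gen_frac_neq_0] F(2) by metis
    finally show ?thesis
      using pord_emb[OF pe F0] by simp
  qed
  thus "f \<in> H0 PE D"
    unfolding H0_def function_field_bundle using fK by blast
qed

abbreviation cox_elements :: "((ambient set \<Rightarrow>\<^sub>0 int) \<Rightarrow>\<^sub>0 ambient) set" where
  "cox_elements \<equiv> {s. keys s \<subseteq> L \<and> (\<forall>D\<in>L. lookup s D \<in> H0 PE D)}"

lemma H0_lift_iff:
  "D \<in> L \<Longrightarrow> f \<in> H0 PE D \<longleftrightarrow> (\<exists>F\<in>sections (fst (degree_of D)) (snd (degree_of D)). f * gen_frac D = emb F)"
  by (rule H0_iff[OF lift_divisors]) auto

lemma H0_0: "D \<in> L \<Longrightarrow> 0 \<in> H0 PE D"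
  unfolding H0_lift_iff by (rule bexI[of _ 0]) (simp_all add: sections_0 emb_0)

lemma H0_add:
  assumes "D \<in> L" "f \<in> H0 PE D" "g \<in> H0 PE D"
  shows "f + g \<in> H0 PE D"
proof -
  obtain F G where "F \<in> sections (fst (degree_of D)) (snd (degree_of D))" "f * gen_frac D = emb F"
    "G \<in> sections (fst (degree_of D)) (snd (degree_of D))" "g * gen_frac D = emb G"
    using assms(2,3) unfolding H0_lift_iff[OF assms(1)] by blast
  thus ?thesis
    unfolding H0_lift_iff[OF assms(1)]
    by (intro bexI[of _ "F + G"] sections_add) (simp_all add: distrib_right emb_add)
qed

lemma H0_uminus:
  assumes "D \<in> L" "f \<in> H0 PE D"
  shows "- f \<in> H0 PE D"
proof -
  obtain F where "F \<in> sections (fst (degree_of D)) (snd (degree_of D))" "f * gen_frac D = emb F"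
    using assms(2) unfolding H0_lift_iff[OF assms(1)] by blast
  thus ?thesis
    unfolding H0_lift_iff[OF assms(1)]
    by (intro bexI[of _ "- F"] sections_uminus) (simp_all add: emb_uminus)
qed

lemma H0_mult:
  assumes "D \<in> L" "E \<in> L" "f \<in> H0 PE D" "g \<in> H0 PE E"
  shows "f * g \<in> H0 PE (D + E)"
proof -
  obtain F where F: "F \<in> sections (fst (degree_of D)) (snd (degree_of D))" "f * gen_frac D = emb F"
    using assms(3) unfolding H0_lift_iff[OF assms(1)] by blast
  obtain G where G: "G \<in> sections (fst (degree_of E)) (snd (degree_of E))" "g * gen_frac E = emb G"
    using assms(4) unfolding H0_lift_iff[OF assms(2)] by blast
  have "F * G \<in> sections (fst (degree_of (D + E))) (snd (degree_of (D + E)))"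
    unfolding degree_of_add[OF lift_divisors[OF assms(1)] lift_divisors[OF assms(2)]]
    by (rule sections_mult[OF F(1) G(1)]) auto
  moreover have "f * g * gen_frac (D + E) = emb (F * G)"
    unfolding emb_mult F(2)[symmetric] G(2)[symmetric] gen_frac_add by (simp add: mult_ac)
  ultimately show ?thesis
    unfolding H0_lift_iff[OF lift_add[OF assms(1,2)]] by blast
qed

lemma cox_elements_single:
  assumes "D \<in> L" "f \<in> H0 PE D"
  shows "single D f \<in> cox_elements"
  using assms H0_0 by (auto simp: lookup_single when_def)

lemma cox_elements_section:
  assumes "F \<in> sections d k"
  shows "single (lift_of d k) (emb F / gen_frac (lift_of d k)) \<in> cox_elements"
  using lift_of[of d k] assms gen_frac_neq_0
  by (intro cox_elements_single) (auto simp: H0_lift_iff)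

lemma cox_elements_0: "0 \<in> cox_elements"
  using H0_0 by simp

lemma cox_elements_add:
  assumes "s \<in> cox_elements" "t \<in> cox_elements"
  shows "s + t \<in> cox_elements"
  using assms keys_add[of s t] by (auto simp: lookup_add intro: H0_add)

lemma cox_elements_uminus:
  assumes "s \<in> cox_elements"
  shows "- s \<in> cox_elements"
proof -
  have "keys (- s) = keys s"
    by (auto simp: in_keys_iff)
  thus ?thesis
    using assms by (auto intro: H0_uminus)
qed

lemma cox_elements_sum: "(\<And>i. i \<in> I \<Longrightarrow> f i \<in> cox_elements) \<Longrightarrow> (\<Sum>i\<in>I. f i) \<in> cox_elements"
proof (induction I rule: infinite_finite_induct)
  case (insert i I)
  thus ?case
    using cox_elements_add[of "f i" "\<Sum>i\<in>I. f i"] by simp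
qed (use cox_elements_0 in simp_all)

lemma cox_elements_mult:
  assumes "s \<in> cox_elements" "t \<in> cox_elements"
  shows "s * t \<in> cox_elements"
  unfolding poly_mapping_mult_eq
  by (intro cox_elements_sum cox_elements_single lift_add H0_mult) (use assms in auto)

lemma cox_elements_const: "single 0 (emb (mconst c)) \<in> cox_elements"
proof (rule cox_elements_single[OF lift_0])
  show "emb (mconst c) \<in> H0 PE 0"
    unfolding H0_lift_iff[OF lift_0] degree_of_0 gen_frac_0 using sections_mconst by auto
qed

lemma cox_elements_1: "1 \<in> cox_elements"
  using cox_elements_const[of 1] by (simp add: mconst_1 emb_1)

lemma cring_cox_ring: "cring (cox_ring PE L)"
  unfolding cox_ring_def
  by (intro cring_ring_on cox_elements_0 cox_elements_1 cox_elements_add cox_elements_uminus cox_elements_mult)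

text \<open>
  Multiplying by the generators turns sections, which are rational functions on the bundle, into
  the homogeneous invariant polynomials that they represent.
\<close>

definition total :: "((ambient set \<Rightarrow>\<^sub>0 int) \<Rightarrow>\<^sub>0 ambient) \<Rightarrow> ambient" where
  "total = pm_eval (\<lambda>f. f) gen_frac"

lemma is_hom_total: "is_hom total"
  unfolding is_hom_def total_def
proof (intro conjI allI)
  show "pm_eval (\<lambda>f. f) gen_frac 0 = 0"
    by (rule pm_eval_0)
  show "pm_eval (\<lambda>f. f) gen_frac 1 = 1"
    using pm_eval_single[OF is_hom_id, of gen_frac 0 1] by (simp add: gen_frac_0)
  fix s t :: "(ambient set \<Rightarrow>\<^sub>0 int) \<Rightarrow>\<^sub>0 ambient"
  show "pm_eval (\<lambda>f. f) gen_frac (s + t) = pm_eval (\<lambda>f. f) gen_frac s + pm_eval (\<lambda>f. f) gen_frac t"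
    by (rule pm_eval_add[OF is_hom_id])
  show "pm_eval (\<lambda>f. f) gen_frac (s * t) = pm_eval (\<lambda>f. f) gen_frac s * pm_eval (\<lambda>f. f) gen_frac t"
    by (rule pm_eval_mult[OF is_hom_id, where L = UNIV]) (simp_all add: gen_frac_add)
qed

lemma total_single: "total (single D f) = f * gen_frac D"
  unfolding total_def by (rule pm_eval_single[OF is_hom_id])

text \<open>Distinct elements of \<open>L\<close> have distinct bidegrees, so the polynomials
  belonging to different components of \<open>s\<close> have no monomial in common and cannot
  cancel.\<close>

lemma total_eq_0:
  assumes "s \<in> cox_elements" "total s = 0"
  shows "s = 0"
proof (rule ccontr)
  assume "s \<noteq> 0"
  let ?K = "keys s"
  have "\<exists>F. F \<in> sections (fst (degree_of D)) (snd (degree_of D)) \<and> lookup s D * gen_frac D = emb F"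
    if "D \<in> ?K" for D
  proof -
    have "D \<in> L" "lookup s D \<in> H0 PE D"
      using assms(1) that by auto
    thus ?thesis
      unfolding H0_lift_iff[OF \<open>D \<in> L\<close>] by blast
  qed
  then obtain F where F: "\<And>D. D \<in> ?K \<Longrightarrow> F D \<in> sections (fst (degree_of D)) (snd (degree_of D))"
    "\<And>D. D \<in> ?K \<Longrightarrow> lookup s D * gen_frac D = emb (F D)"
    by metis
  have "total s = emb (\<Sum>D\<in>?K. F D)"
    unfolding total_def pm_eval_def emb_sum by (intro sum.cong refl F(2))
  hence sum: "(\<Sum>D\<in>?K. F D) = 0"
    using assms(2) by (simp add: emb_eq_0_iff)
  obtain D where D: "D \<in> ?K"
    using \<open>s \<noteq> 0\<close> by (metis all_not_in_conv keys_eq_empty)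
  have "F D = 0"
  proof (rule homogeneous_sum_eq_0[OF _ _ _ sum D])
    show "inj_on degree_of ?K"
      using lift_bij assms(1) by (auto simp: bij_betw_def intro: inj_on_subset)
    show "(wdeg xwt m, wdeg ywt m) = degree_of D"
      if "D \<in> ?K" "m \<in> keys (F D)" for D m
      using F(1)[OF that(1)] that(2) by (auto simp: sections_def whom_def prod_eq_iff)
  qed simp
  hence "lookup s D * gen_frac D = 0"
    using F(2)[OF D] by (simp add: emb_0)
  thus False
    using D gen_frac_neq_0 by (simp add: in_keys_iff)
qed

text \<open>Dividing by \<open>gen_frac\<close> turns a coordinate or a minor into a section of the
  divisor in \<open>L\<close> of the same bidegree; \<open>total\<close> reverses this.\<close>

definition cox_gen :: "cox_var \<Rightarrow> (ambient set \<Rightarrow>\<^sub>0 int) \<Rightarrow>\<^sub>0 ambient" where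
  "cox_gen v = (case v of
      Xvar i \<Rightarrow> single (lift_of 1 0) (emb (x i) / gen_frac (lift_of 1 0))
    | Zvar j k \<Rightarrow> (let D = lift_of (int (a j) + int (a k)) 1 in single D (emb (minor j k) / gen_frac D)))"

definition cox_map :: "(cox_var, complex) mpoly \<Rightarrow> (ambient set \<Rightarrow>\<^sub>0 int) \<Rightarrow>\<^sub>0 ambient" where
  "cox_map = mpoly_eval (\<lambda>c. single 0 (emb (mconst c))) cox_gen"

lemma is_hom_cox_const: "is_hom (\<lambda>c. single 0 (emb (mconst c)) :: (ambient set \<Rightarrow>\<^sub>0 int) \<Rightarrow>\<^sub>0 ambient)"
  unfolding is_hom_def
  by (simp add: is_hom_simps[OF is_hom_mconst] emb_simps single_add mult_single)

lemma is_hom_cox_map: "is_hom cox_map"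
  unfolding cox_map_def by (rule is_hom_mpoly_eval[OF is_hom_cox_const])

lemma cox_map_const: "cox_map (mconst c) = single 0 (emb (mconst c))"
  unfolding cox_map_def by (rule mpoly_eval_mconst[OF is_hom_cox_const])

lemma cox_map_elements:
  assumes "q \<in> cox_polys"
  shows "cox_map q \<in> cox_elements"
  unfolding cox_map_def
proof (rule mpoly_eval_closed[OF assms cox_elements_0 cox_elements_1])
  show "s + t \<in> cox_elements" if "s \<in> cox_elements" "t \<in> cox_elements" for s t
    using that by (rule cox_elements_add)
  show "s * t \<in> cox_elements" if "s \<in> cox_elements" "t \<in> cox_elements" for s t
    using that by (rule cox_elements_mult)
  show "single 0 (emb (mconst c)) \<in> cox_elements" for c
    by (rule cox_elements_const)
  fix v assume v: "v \<in> cox_vars n"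
  show "cox_gen v \<in> cox_elements"
  proof (cases v)
    case (Xvar i)
    thus ?thesis
      using cox_elements_section[OF sections_x, of i] v by (simp add: cox_gen_def cox_vars_iff)
  next
    case (Zvar j k)
    thus ?thesis
      using cox_elements_section[OF sections_minor, of j k] v by (simp add: cox_gen_def cox_vars_iff Let_def)
  qed
qed

text \<open>As \<open>total\<close> is injective on \<open>cox_elements\<close>, this triangle
  reduces kernel and image of \<open>cox_map\<close> to those of \<open>present\<close>.\<close>

lemma total_cox_map: "total (cox_map q) = emb (present q)"
proof -
  have gen: "total (cox_gen v) = emb (present_var v)" for v
    by (cases v) (simp_all add: cox_gen_def Let_def total_single gen_frac_neq_0 present_var_simps)
  have const: "total (single 0 (emb (mconst c))) = emb (mconst c)" for c
    by (simp add: total_single gen_frac_0)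
  show ?thesis
    unfolding cox_map_def hom_mpoly_eval[OF is_hom_total] hom_mpoly_eval[OF is_hom_emb] gen const ..
qed

text \<open>For one component, a preimage under \<open>present\<close> of the corresponding
  polynomial works, because \<open>total\<close> annihilates the difference. The components are then
  added up.\<close>

lemma cox_map_surj:
  assumes "s \<in> cox_elements"
  shows "\<exists>q\<in>cox_polys. cox_map q = s"
proof -
  have single: "\<exists>q\<in>cox_polys. cox_map q = single D f" if D: "D \<in> L" "f \<in> H0 PE D" for D f
  proof -
    obtain F where F: "F \<in> sections (fst (degree_of D)) (snd (degree_of D))" "f * gen_frac D = emb F"
      using D unfolding H0_lift_iff[OF D(1)] by blast
    obtain q where q: "q \<in> cox_polys" "present q = F"
      using sections_presented[OF F(1)] by blast
    have "cox_map q - single D f \<in> cox_elements"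
      using cox_elements_add[OF cox_map_elements[OF q(1)] cox_elements_uminus[OF cox_elements_single[OF D]]] by simp
    moreover have "total (cox_map q - single D f) = 0"
      by (simp add: is_hom_diff[OF is_hom_total] total_cox_map q(2) total_single F(2))
    ultimately have "cox_map q - single D f = 0"
      by (rule total_eq_0)
    thus ?thesis
      using q(1) by (intro bexI[of _ q]) simp_all
  qed
  have "\<exists>q\<in>cox_polys. cox_map q = (\<Sum>D\<in>I. single D (lookup s D))"
    if "finite I" "I \<subseteq> keys s" for I
    using that
  proof (induction I rule: finite_induct)
    case empty
    show ?case
      by (rule bexI[of _ 0]) (simp_all add: is_hom_0[OF is_hom_cox_map] mpoly_carrier_0)
  next
    case (insert D I)
    obtain q where q: "q \<in> cox_polys" "cox_map q = (\<Sum>D\<in>I. single D (lookup s D))"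
      using insert by blast
    have "D \<in> L" "lookup s D \<in> H0 PE D"
      using assms insert.prems by auto
    then obtain r where r: "r \<in> cox_polys" "cox_map r = single D (lookup s D)"
      using single by blast
    have "cox_map (r + q) = (\<Sum>D\<in>insert D I. single D (lookup s D))"
      using insert.hyps q(2) r(2) by (simp add: is_hom_add[OF is_hom_cox_map])
    thus ?case
      using mpoly_carrier_add[OF r(1) q(1)] by blast
  qed
  from this[of "keys s"] show ?thesis
    by (simp add: poly_mapping_sum_single)
qed

lemma cox_map_eq_0_iff:
  assumes "q \<in> cox_polys"
  shows "cox_map q = 0 \<longleftrightarrow> q \<in> cox_ideal n a"
proof -
  have "cox_map q = 0 \<longleftrightarrow> total (cox_map q) = 0"
    using total_eq_0[OF cox_map_elements[OF assms]] is_hom_0[OF is_hom_total] by auto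
  thus ?thesis
    by (simp add: total_cox_map emb_eq_0_iff present_eq_0_iff[OF assms])
qed

theorem cox_ring_presentation:
  "\<exists>h \<in> ring_iso (cox_poly_ring n Quot cox_ideal n a) (cox_ring PE L).
     \<forall>c. h (cox_ideal n a +>\<^bsub>cox_poly_ring n\<^esub> mconst c) = single 0 (ambient_const c)"
proof -
  let ?R = "cox_poly_ring n" and ?S = "cox_ring PE L"
  have carrier: "carrier ?S = cox_elements"
    by (simp add: cox_ring_def ring_on_def)
  interpret ring_hom_ring ?R ?S cox_map
  proof (rule ring_hom_ringI2)
    show "ring ?R" "ring ?S"
      using cring_cox_poly_ring cring_cox_ring by (auto intro: cring.axioms(1))
    show "cox_map \<in> ring_hom ?R ?S"
    proof (rule ring_hom_memI)
      show "cox_map q \<in> carrier ?S" if "q \<in> carrier ?R" for q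
        using that cox_map_elements unfolding carrier carrier_cox_poly_ring by blast
    qed (simp_all add: cox_poly_ring_def cox_ring_def ring_on_def is_hom_simps[OF is_hom_cox_map])
  qed
  have kernel: "a_kernel ?R ?S cox_map = cox_ideal n a"
  proof (intro equalityI subsetI)
    fix q assume "q \<in> a_kernel ?R ?S cox_map"
    hence "q \<in> cox_polys" "cox_map q = 0"
      unfolding a_kernel_def' by (simp_all add: carrier_cox_poly_ring cox_ring_def ring_on_def)
    thus "q \<in> cox_ideal n a"
      by (simp add: cox_map_eq_0_iff)
  next
    fix q assume "q \<in> cox_ideal n a"
    moreover from this have "q \<in> cox_polys"
      using cox_ideal_subset by blast
    ultimately have "q \<in> cox_polys" "cox_map q = 0"
      by (simp_all add: cox_map_eq_0_iff)
    thus "q \<in> a_kernel ?R ?S cox_map"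
      unfolding a_kernel_def' by (simp add: carrier_cox_poly_ring cox_ring_def ring_on_def)
  qed
  have "cox_map ` carrier ?R = carrier ?S"
    unfolding carrier carrier_cox_poly_ring using cox_map_elements cox_map_surj by blast
  hence "(\<lambda>X. the_elem (cox_map ` X)) \<in> ring_iso (?R Quot cox_ideal n a) ?S"
    using FactRing_iso_set unfolding kernel by blast
  \<comment> \<open>The constants correspond, so the isomorphism is one of algebras over the complex
    numbers.\<close>
  moreover have "the_elem (cox_map ` (cox_ideal n a +>\<^bsub>?R\<^esub> mconst c)) = single 0 (ambient_const c)" for c
    using the_elem_simp[of "mconst c"] unfolding kernel
    by (simp add: carrier_cox_poly_ring mpoly_carrier_mconst cox_map_const ambient_const_def)
  ultimately show ?thesis
    by (intro bexI[of _ "\<lambda>X. the_elem (cox_map ` X)"]) auto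
qed

end

text \<open>The first conjunct keeps the second from being vacuous; the second holds for every
  choice of representatives of the divisor classes, and its clause on constants makes the ring
  isomorphism complex linear.\<close>

theorem proposition3p7:
  fixes n :: nat and a :: "nat \<Rightarrow> nat"
  assumes "n \<ge> 2" and "\<forall>i\<le>n. a i > 0"
  shows "(\<exists>L. class_group_lift (proj_dual_bundle n a) L) \<and>
    (\<forall>L. class_group_lift (proj_dual_bundle n a) L \<longrightarrow>
       (\<exists>h \<in> ring_iso (cox_poly_ring n Quot cox_ideal n a) (cox_ring (proj_dual_bundle n a) L).
          \<forall>c. h (cox_ideal n a +>\<^bsub>cox_poly_ring n\<^esub> mconst c) =
              Poly_Mapping.single 0 (ambient_const c)))"
proof -
  interpret dual_bundle n a
    by unfold_locales (use assms in auto)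
  show ?thesis
  proof (intro conjI allI impI class_group_lift_exists)
    fix L assume "class_group_lift (proj_dual_bundle n a) L"
    then interpret class_lift n a L
      by unfold_locales
    show "\<exists>h \<in> ring_iso (cox_poly_ring n Quot cox_ideal n a) (cox_ring (proj_dual_bundle n a) L).
          \<forall>c. h (cox_ideal n a +>\<^bsub>cox_poly_ring n\<^esub> mconst c) =
              Poly_Mapping.single 0 (ambient_const c)"
      by (rule cox_ring_presentation)
  qed
qed

end
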